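(* Let $\alpha\in\mathbb{R}$, $W\in\mathbb{R}^{n\times n}$, and consider the Hopfield network $$\dot x=-\alpha x+Wf(x),\qquad x\in\mathbb{R}^n,\qquad f(x)=\begin{bmatrix}\tanh(x_1)&\dots&\tanh(x_n)\end{bmatrix}^T.$$ If $\sigma_1(W)<\alpha$, then the network is contractive. If $$\sqrt{\sigma_1^2(W)+\sigma_2^2(W)}<\sqrt2\,\alpha$$ (where $n\ge2$), then the network is $2$-contractive and every solution converges to an equilibrium point.
   Context: $\sigma_1(W)\ge\sigma_2(W)\ge\dots\ge\sigma_n(W)\ge 0$ are the ordered singular values of $W$. For $M\in\mathbb{R}^{n\times m}$ and $1\le k\le\min\{n,m\}$, the $k$-multiplicative compound $M^{(k)}$ is the $\binom nk\times\binom mk$ matrix of all $k\times k$ minors of $M$, with row and column index sets ordered lexicographically. A system $\dot x=g(t,x)$ on a state space $\Omega\subseteq\mathbb{R}^n$, with Jacobian $J(t,x)=\frac{\partial g}{\partial x}(t,x)$, is $k$-contractive with rate $\eta>0$ with respect to a norm $|\cdot|$ on $\mathbb{R}^{\binom nk}$ if for every solution $x:[s,T]\to\Omega$ ($0\le s<T$) and all solutions $\delta^1,\dots,\delta^k:[s,T]\to\mathbb{R}^n$ of the variational equation $\dot\delta(t)=J(t,x(t))\delta(t)$, the matrix $X(t):=[\delta^1(t)\ \cdots\ \delta^k(t)]\in\mathbb{R}^{n\times k}$ satisfies $|X(t)^{(k)}|\le e^{-\eta(t-s)}|X(s)^{(k)}|$ for all $t\in[s,T]$. The system is called $k$-contractive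 if this holds for some rate $\eta>0$ and some norm. "Contractive" means $1$-contractive. *)

theory Defs
  imports
    "HOL-Analysis.Analysis"
    "HOL-Computational_Algebra.Polynomial"
    "Jordan_Normal_Form.Char_Poly"
    "Jordan_Normal_Form.DL_Submatrix"
begin

text \<open>
  States live in the Euclidean space \<open>real^'n\<close>, where the differential equation is posed.  Compound
  matrices and characteristic polynomials are taken in the carrier-based matrix library, because
  the size of a compound depends on the natural number \<open>k\<close>.  The order on the finite
  index type \<open>'n\<close> identifies it with \<open>{0..<CARD('n)}\<close>, increasingly.
\<close>

definition coord_index :: "nat \<Rightarrow> 'n::{finite,linorder}" where
  "coord_index i = sorted_list_of_set UNIV ! i"

definition vec_of :: "real^'n::{finite,linorder} \<Rightarrow> real Matrix.vec" where
  "vec_of v = Matrix.vec CARD('n) (\<lambda>i. vec_nth v (coord_index i))"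

definition mat_of :: "real^'n::{finite,linorder}^'n::{finite,linorder} \<Rightarrow> real Matrix.mat" where
  "mat_of A = Matrix.mat CARD('n) CARD('n)
     (\<lambda>(i, j). vec_nth (vec_nth A (coord_index i)) (coord_index j))"

lemma bij_betw_coord_index: "bij_betw (coord_index :: nat \<Rightarrow> 'n::{finite,linorder}) {..<CARD('n)} UNIV"
  unfolding coord_index_def by (rule bij_betw_nth) simp_all

lemma strict_mono_on_coord_index:
  "strict_mono_on {..<CARD('n)} (coord_index :: nat \<Rightarrow> 'n::{finite,linorder})"
  unfolding coord_index_def strict_mono_on_def
  by (auto simp: sorted_wrt_nth_less[OF strict_sorted_list_of_set])

text \<open>Square roots of the eigenvalues of \<open>A\<^sup>T A\<close>, with algebraic multiplicity, in decreasing order.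
  For an \<open>n \<times> n\<close> matrix the list has length \<open>n\<close>, because \<open>A\<^sup>T A\<close> is symmetric and hence its
  characteristic polynomial splits over the reals; \<open>singular_value\<close> counts from 1.\<close>

definition singular_values :: "real Matrix.mat \<Rightarrow> real list" where
  "singular_values A =
     rev (sorted_list_of_multiset (image_mset sqrt (proots (char_poly (transpose_mat A * A)))))"

definition singular_value :: "nat \<Rightarrow> real^'n::{finite,linorder}^'n::{finite,linorder} \<Rightarrow> real" where
  "singular_value i A = singular_values (mat_of A) ! (i - 1)"

text \<open>\<open>subseqs\<close> produces sublists with the first element before those without it; hence the
  sublists of fixed length of \<open>[0..<n]\<close> come in lexicographic order.\<close>

definition lex_subsets :: "nat \<Rightarrow> nat \<Rightarrow> nat list list" where
  "lex_subsets n k = filter (\<lambda>I. length I = k) (subseqs [0..<n])"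

lemma set_lex_subsets:
  "set ` set (lex_subsets n k) = {I. I \<subseteq> {..<n} \<and> card I = k}"
proof -
  have "length xs = card (set xs)" if "xs \<in> set (subseqs [0..<n])" for xs
    using that by (metis distinct_card distinct_upt subseqs_distinctD)
  then have "set ` set (lex_subsets n k) = {I \<in> set ` set (subseqs [0..<n]). card I = k}"
    unfolding lex_subsets_def by auto
  then show ?thesis
    by (auto simp: subseqs_powset atLeast0LessThan)
qed

lemma length_lex_subsets: "length (lex_subsets n k) = n choose k"
proof -
  have d: "distinct (map set (subseqs [0..<n]))"
    by (rule distinct_set_subseqs) simp
  then have "distinct (map set (lex_subsets n k))"
    unfolding lex_subsets_def by (rule distinct_map_filter)
  then have "length (lex_subsets n k) = card (set ` set (lex_subsets n k))"
    by (metis distinct_card length_map set_map)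
  then show ?thesis
    using n_subsets[of "{..<n}" k] by (simp add: set_lex_subsets)
qed

lemma sorted_lex_subsets:
  "sorted_wrt (\<lambda>I J. (I, J) \<in> lexord {(a, b). a < b}) (lex_subsets n k)"
proof -
  have "sorted_wrt (\<lambda>I J. (I, J) \<in> lexord {(a, b). a < b})
          (filter (\<lambda>I. length I = k) (subseqs xs))"
    if "sorted_wrt (<) xs" for xs :: "nat list"
    using that
  proof (induction xs arbitrary: k)
    case (Cons x xs)
    have f: "filter (\<lambda>I. length I = k) (subseqs (x # xs)) =
        map ((#) x) (filter (\<lambda>I. Suc (length I) = k) (subseqs xs)) @
        filter (\<lambda>I. length I = k) (subseqs xs)"
      by (simp add: Let_def filter_map o_def)
    have s: "sorted_wrt (\<lambda>I J. (I, J) \<in> lexord {(a, b). a < b})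
        (filter (\<lambda>I. Suc (length I) = k) (subseqs xs))"
      using Cons by (cases k) auto
    have c: "(x # I, J) \<in> lexord {(a, b). a < b}"
      if "Suc (length I) = k" "J \<in> set (subseqs xs)" "length J = k" for I J
    proof (cases J)
      case (Cons y ys)
      have "set J \<in> Pow (set xs)"
        using that(2) subseqs_powset[of xs] by blast
      then have "x < y"
        using Cons Cons.prems \<open>sorted_wrt (<) (x # xs)\<close> by auto
      then show ?thesis using Cons by simp
    qed (use that in auto)
    show ?case
      unfolding f using s c Cons by (auto simp: sorted_wrt_append sorted_wrt_map)
  qed auto
  then show ?thesis
    by (simp add: lex_subsets_def)
qed

definition compound :: "nat \<Rightarrow> real Matrix.mat \<Rightarrow> real Matrix.mat" where
  "compound k M = Matrix.mat (dim_row M choose k) (dim_col M choose k)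
     (\<lambda>(i, j). Determinant.det (submatrix M
        (set (lex_subsets (dim_row M) k ! i)) (set (lex_subsets (dim_col M) k ! j))))"

definition is_norm_on :: "nat \<Rightarrow> (real Matrix.vec \<Rightarrow> real) \<Rightarrow> bool" where
  "is_norm_on N \<nu> \<longleftrightarrow>
     (\<forall>v\<in>carrier_vec N. 0 \<le> \<nu> v \<and> (\<nu> v = 0 \<longleftrightarrow> v = 0\<^sub>v N)) \<and>
     (\<forall>c. \<forall>v\<in>carrier_vec N. \<nu> (c \<cdot>\<^sub>v v) = \<bar>c\<bar> * \<nu> v) \<and>
     (\<forall>v\<in>carrier_vec N. \<forall>w\<in>carrier_vec N. \<nu> (v + w) \<le> \<nu> v + \<nu> w)"

definition solution_on ::
  "(real \<Rightarrow> real^'n \<Rightarrow> real^'n) \<Rightarrow> (real^'n) set \<Rightarrow> real set \<Rightarrow> (real \<Rightarrow> real^'n) \<Rightarrow> bool" where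
  "solution_on g \<Omega> I x \<longleftrightarrow>
     (\<forall>t\<in>I. x t \<in> \<Omega> \<and> (x has_vector_derivative g t (x t)) (at t within I))"

definition variational_solution_on ::
  "(real \<Rightarrow> real^'n \<Rightarrow> real^'n) \<Rightarrow> (real^'n) set \<Rightarrow> real set \<Rightarrow> (real \<Rightarrow> real^'n) \<Rightarrow> (real \<Rightarrow> real^'n) \<Rightarrow> bool"
  where
  "variational_solution_on g \<Omega> I x \<delta> \<longleftrightarrow>
     solution_on (\<lambda>t d. jacobian (g t) (at (x t) within \<Omega>) *v d) UNIV I \<delta>"

text \<open>The compound of an \<open>n \<times> k\<close> matrix has a single column, which is the vector whose norm is taken.\<close>

definition k_contractive_with ::
  "nat \<Rightarrow> (real \<Rightarrow> real^'n::{finite,linorder} \<Rightarrow> real^'n::{finite,linorder}) \<Rightarrow>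
     (real^'n::{finite,linorder}) set \<Rightarrow> real \<Rightarrow> (real Matrix.vec \<Rightarrow> real) \<Rightarrow> bool" where
  "k_contractive_with k g \<Omega> \<eta> \<nu> \<longleftrightarrow>
     (\<forall>s T x \<delta>. 0 \<le> s \<and> s < T \<and> solution_on g \<Omega> {s..T} x \<and>
        (\<forall>j<k. variational_solution_on g \<Omega> {s..T} x (\<delta> j)) \<longrightarrow>
        (let X = (\<lambda>t. mat_of_cols CARD('n) (map (\<lambda>j. vec_of (\<delta> j t)) [0..<k]))
         in \<forall>t\<in>{s..T}. \<nu> (col (compound k (X t)) 0) \<le> exp (- \<eta> * (t - s)) * \<nu> (col (compound k (X s)) 0)))"

definition k_contractive ::
  "nat \<Rightarrow> (real \<Rightarrow> real^'n::{finite,linorder} \<Rightarrow> real^'n::{finite,linorder}) \<Rightarrow>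
     (real^'n::{finite,linorder}) set \<Rightarrow> bool" where
  "k_contractive k g \<Omega> \<longleftrightarrow>
     (\<exists>\<eta> \<nu>. 0 < \<eta> \<and> is_norm_on (CARD('n) choose k) \<nu> \<and> k_contractive_with k g \<Omega> \<eta> \<nu>)"

abbreviation contractive ::
  "(real \<Rightarrow> real^'n::{finite,linorder} \<Rightarrow> real^'n::{finite,linorder}) \<Rightarrow>
     (real^'n::{finite,linorder}) set \<Rightarrow> bool" where
  "contractive \<equiv> k_contractive 1"

definition hopfield :: "real \<Rightarrow> real^'n^'n \<Rightarrow> real^'n \<Rightarrow> real^'n" where
  "hopfield \<alpha> W x = - \<alpha> *\<^sub>R x + W *v (\<chi> i. tanh (vec_nth x i))"

definition equilibrium :: "(real^'n \<Rightarrow> real^'n) \<Rightarrow> real^'n \<Rightarrow> bool" where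
  "equilibrium F e \<longleftrightarrow> F e = 0"

end

theory Submission
  imports Defs
begin

text \<open>
  Write \<open>F\<close> for the vector field, \<open>J\<close> for its Jacobian and \<open>v = F y\<close> for the velocity of an orbit \<open>y\<close>.
  Ky Fan's inequality bounds the sum of the two largest eigenvalues of the symmetric part of
  \<open>J = - \<alpha> + W D\<close> by \<open>- \<eta> = \<sigma>\<^sub>1 + \<sigma>\<^sub>2 - 2 \<alpha> < 0\<close>, so the linearized flow contracts areas in the
      Euclidean norm.

  Convergence does not go through the closing lemma.  Pulling the one-form \<open>F \<bullet> dx\<close> back along the flow
  for a time \<open>\<tau>\<close> multiplies its exterior derivative by \<open>exp (- \<eta> \<tau>)\<close>, and what remains is exact
  up to that factor; hence \<open>\<integral> |v|\<^sup>2 \<le> \<epsilon> \<integral> |v| + C\<^sub>\<epsilon>\<close> along every bounded orbit.  So if an orbit has infinite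
  length, it contains arbitrarily long slow arcs.  On the other hand, the area of velocity and
  acceleration contracts as well, which says that either the speed decays exponentially or the curvature
  is bounded.  In the second case a slow orbit moves almost along an eigenvector of \<open>J\<close> with eigenvalue
  above \<open>\<sigma>\<^sub>2 - \<alpha>\<close>, therefore the bounded function \<open>w\<^sub>1 \<bullet> tanh y\<close>, with \<open>w\<^sub>1\<close> the top right singular vector
  of \<open>W\<close>, is strictly monotone with slope comparable to the speed.  Slow arcs thus have bounded length,
  every orbit has finite length, and it converges.
\<close>

no_notation scalar_prod (infix "\<bullet>" 70)
no_notation vec_index (infixl "$" 100)

section \<open>Area-contracting vector fields\<close>

text \<open>Why the pulled-back form measures energy: the linearized flow carries \<open>v t\<close>
  to \<open>v (t + \<tau>)\<close>, so the form takes the value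
  \<open>v (t + \<tau>) \<bullet> v (t + \<tau>)\<close> on the velocity. Integration along rays
  from the origin supplies a bounded potential; the error is at most \<open>K\<close> times the
  exterior derivative per unit of length. With Euler steps in place of the flow only half of the
  contraction rate is kept, which is harmless because \<tau> is free.

  Energy and slow arcs meet through arc length. The speed grows by at most \<open>L\<close> per unit
  of length, so an arc too long to be slow contains a piece of fixed length on which the speed is
  bounded below. Energy then grows at least linearly with length, with a slope independent of
  \<epsilon>, against \<open>energy_le_len\<close>.

  Equilibria are not assumed to be isolated, so it would not be enough to know that limit sets
  consist of equilibria. Finite length gives a single limit.\<close>

definition gram :: "'a::real_inner \<Rightarrow> 'a \<Rightarrow> real" where
  "gram u w = (u \<bullet> u) * (w \<bullet> w) - (u \<bullet> w)\<^sup>2"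

lemma gram_nonneg: "0 \<le> gram u w"
  using Cauchy_Schwarz_ineq[of u w] by (simp add: gram_def)

lemma gram_le: "gram u w \<le> (u \<bullet> u) * (w \<bullet> w)"
  by (simp add: gram_def)

lemma sqrt_gram_le: "sqrt (gram u w) \<le> norm u * norm w"
  by (rule real_le_lsqrt)
     (use gram_le[of u w] in \<open>simp_all add: power_mult_distrib power2_norm_eq_inner\<close>)

text \<open>Areas are invariant under shears. Together with the orthogonal decomposition below this
  reduces inequalities about \<open>gram\<close> to orthogonal pairs, where it is the product of the
  squared lengths.\<close>

lemma gram_shear: "gram u (c *\<^sub>R u + w) = gram u w"
  by (simp add: gram_def inner_add inner_commute power2_eq_square algebra_simps)

lemma orthogonal_decomposition:
  fixes u w :: "'a::real_inner"
  obtains c z where "w = c *\<^sub>R u + z" "u \<bullet> z = 0"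
proof (cases "u = 0")
  case True
  then show ?thesis using that[of 0 w] by simp
next
  case False
  then show ?thesis
    using that[of "(u \<bullet> w) / (u \<bullet> u)" "w - ((u \<bullet> w) / (u \<bullet> u)) *\<^sub>R u"]
    by (simp add: inner_diff_right)
qed

lemma linear_expansion:
  fixes f :: "'a::euclidean_space \<Rightarrow> 'b::real_vector"
  assumes "linear f"
  shows "f u = (\<Sum>b\<in>Basis. (u \<bullet> b) *\<^sub>R f b)"
proof -
  have "f u = f (\<Sum>b\<in>Basis. (u \<bullet> b) *\<^sub>R b)" by (simp add: euclidean_representation)
  also have "\<dots> = (\<Sum>b\<in>Basis. (u \<bullet> b) *\<^sub>R f b)"
    by (simp add: linear_sum[OF assms] linear_cmul[OF assms])
  finally show ?thesis .
qed

text \<open>All that the convergence argument takes from the vector field: two derivatives with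
  global bounds, and area contraction. Divided by the squared lengths,
  \<open>trace_orthogonal\<close> bounds the sum of two Rayleigh quotients of \<open>J x\<close>
  over an orthogonal pair by -\<eta>; the product form also covers zero vectors.\<close>

locale contracting_field =
  fixes F :: "'a::euclidean_space \<Rightarrow> 'a" and J :: "'a \<Rightarrow> 'a \<Rightarrow> 'a" and H :: "'a \<Rightarrow> 'a \<Rightarrow> 'a \<Rightarrow> 'a"
    and L B \<eta> :: real
  assumes F_deriv: "(F has_derivative J x) (at x)"
    and J_deriv: "((\<lambda>x. J x w) has_derivative (\<lambda>u. H x u w)) (at x)"
    and H_sym: "H x u w = H x w u"
    and H_cont: "continuous_on UNIV (\<lambda>(x, u, w). H x u w)"
    and J_bound: "norm (J x w) \<le> L * norm w"
    and H_bound: "norm (H x u w) \<le> B * norm u * norm w"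
    and L_pos: "0 < L" and B_pos: "0 < B" and eta_pos: "0 < \<eta>"
    and trace_orthogonal: "u \<bullet> w = 0 \<Longrightarrow>
      (u \<bullet> u) * (w \<bullet> J x w) + (w \<bullet> w) * (u \<bullet> J x u) \<le> - \<eta> * ((u \<bullet> u) * (w \<bullet> w))"
begin

lemma J_linear: "bounded_linear (J x)"
  by (rule has_derivative_bounded_linear[OF F_deriv])

lemma J_simps: "J x (u + w) = J x u + J x w" "J x (c *\<^sub>R u) = c *\<^sub>R J x u"
  using J_linear[of x] by (simp_all add: bounded_linear.linear linear_add linear_cmul)

text \<open>The left-hand side is half the derivative of \<open>gram u w\<close> when
  \<open>u\<close> and \<open>w\<close> move by the variational equation. Like \<open>gram\<close>,
  it only sees the component of \<open>w\<close> orthogonal to \<open>u\<close>.\<close>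

lemma trace_gram:
  "(u \<bullet> u) * (w \<bullet> J x w) + (w \<bullet> w) * (u \<bullet> J x u) - (u \<bullet> w) * (u \<bullet> J x w + w \<bullet> J x u)
    \<le> - \<eta> * gram u w"
proof -
  obtain c z where w: "w = c *\<^sub>R u + z" and z: "u \<bullet> z = 0"
    by (rule orthogonal_decomposition)
  have "(u \<bullet> u) * (w \<bullet> J x w) + (w \<bullet> w) * (u \<bullet> J x u) - (u \<bullet> w) * (u \<bullet> J x w + w \<bullet> J x u)
      = (u \<bullet> u) * (z \<bullet> J x z) + (z \<bullet> z) * (u \<bullet> J x u)"
    using z by (simp add: w J_simps inner_add inner_commute[of z u] algebra_simps)
  moreover have "gram u w = (u \<bullet> u) * (z \<bullet> z)"
    using z by (simp add: w gram_shear) (simp add: gram_def)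
  ultimately show ?thesis
    using trace_orthogonal[OF z, of x] by simp
qed

text \<open>Euler steps stand in for the flow, so that no smooth dependence on initial values is needed.\<close>

definition euler :: "real \<Rightarrow> 'a \<Rightarrow> 'a" where "euler h x = x + h *\<^sub>R F x"
definition deuler :: "real \<Rightarrow> 'a \<Rightarrow> 'a \<Rightarrow> 'a" where "deuler h x u = u + h *\<^sub>R J x u"

lemma deuler_simps: "deuler h x (u + w) = deuler h x u + deuler h x w"
  "deuler h x (c *\<^sub>R u) = c *\<^sub>R deuler h x u"
  by (simp_all add: deuler_def J_simps algebra_simps)

text \<open>For orthogonal vectors the arithmetic-geometric mean inequality turns the product of the two
  growth factors into the trace.\<close>

lemma gram_deuler:
  assumes h: "0 \<le> h" "h * L\<^sup>2 \<le> \<eta> / 2" "h * \<eta> \<le> 1"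
  shows "gram (deuler h x u) (deuler h x w) \<le> (1 - \<eta> * h / 2)\<^sup>2 * gram u w"
proof (cases "u = 0")
  case True
  then show ?thesis by (simp add: gram_def deuler_def J_simps(2)[of x 0, simplified])
next
  case u: False
  obtain c z where w: "w = c *\<^sub>R u + z" and z: "u \<bullet> z = 0"
    by (rule orthogonal_decomposition)
  have g: "gram u w = (u \<bullet> u) * (z \<bullet> z)"
    using z by (simp add: w gram_shear) (simp add: gram_def)
  have gd: "gram (deuler h x u) (deuler h x w) = gram (deuler h x u) (deuler h x z)"
    by (simp add: w deuler_simps gram_shear)
  show ?thesis
  proof (cases "z = 0")
    case True
    then show ?thesis by (simp add: g gd) (simp add: gram_def deuler_def J_simps(2)[of x 0, simplified])
  next
    case z0: False
    define p q where "p = (u \<bullet> J x u) / (u \<bullet> u)" and "q = (z \<bullet> J x z) / (z \<bullet> z)"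
    have n: "deuler h x y \<bullet> deuler h x y \<le> (y \<bullet> y) * (1 + 2 * h * ((y \<bullet> J x y) / (y \<bullet> y)) + h\<^sup>2 * L\<^sup>2)"
      if "y \<noteq> 0" for y
    proof -
      have "J x y \<bullet> J x y \<le> (L * norm y)\<^sup>2"
        using J_bound[of x y] by (metis norm_ge_zero power2_norm_eq_inner power_mono)
      then have "h\<^sup>2 * (J x y \<bullet> J x y) \<le> h\<^sup>2 * (L\<^sup>2 * (y \<bullet> y))"
        by (intro mult_left_mono) (simp_all add: power_mult_distrib power2_norm_eq_inner)
      then show ?thesis using that
        by (simp add: deuler_def inner_add inner_commute[of "J x y" y] power2_eq_square algebra_simps)
    qed
    define X where "X = 1 + 2 * h * p + h\<^sup>2 * L\<^sup>2"
    define Y where "Y = 1 + 2 * h * q + h\<^sup>2 * L\<^sup>2"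
    have X: "deuler h x u \<bullet> deuler h x u \<le> (u \<bullet> u) * X" and Y: "deuler h x z \<bullet> deuler h x z \<le> (z \<bullet> z) * Y"
      using n[OF u] n[OF z0] by (simp_all add: X_def Y_def p_def q_def)
    have uz: "0 < u \<bullet> u" "0 < z \<bullet> z" using u z0 by simp_all
    have X0: "0 \<le> X" and Y0: "0 \<le> Y"
      using order_trans[OF inner_ge_zero X] order_trans[OF inner_ge_zero Y] uz
      by (simp_all add: zero_le_mult_iff)
    have "p + q \<le> - \<eta>"
      using trace_orthogonal[OF z, of x] uz
      by (simp add: p_def q_def divide_simps) (simp add: algebra_simps)
    then have "h * (p + q) \<le> h * - \<eta>" using h(1) by (rule mult_left_mono)
    \<comment> \<open>The quadratic term of the Euler step is absorbed by half of the rate; this is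
      where \<eta> turns into \<eta>/2.\<close>
    moreover have "h * (h * L\<^sup>2) \<le> h * (\<eta> / 2)" using h by (intro mult_left_mono) auto
    ultimately have s: "(X + Y) / 2 \<le> 1 - \<eta> * h / 2"
      by (simp add: X_def Y_def power2_eq_square field_simps)
    have "X * Y \<le> ((X + Y) / 2)\<^sup>2"
      using zero_le_power2[of "X - Y"] by (simp add: power2_eq_square field_simps)
    also have "\<dots> \<le> (1 - \<eta> * h / 2)\<^sup>2"
      using s X0 Y0 by (intro power_mono) auto
    finally have XY: "X * Y \<le> (1 - \<eta> * h / 2)\<^sup>2" .
    have "gram (deuler h x u) (deuler h x z) \<le> ((u \<bullet> u) * X) * ((z \<bullet> z) * Y)"
      using gram_le X Y X0 by (intro order_trans[OF gram_le mult_mono]) auto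
    also have "\<dots> = ((u \<bullet> u) * (z \<bullet> z)) * (X * Y)" by simp
    also have "\<dots> \<le> ((u \<bullet> u) * (z \<bullet> z)) * (1 - \<eta> * h / 2)\<^sup>2"
      using XY by (intro mult_left_mono) auto
    finally show ?thesis by (simp add: g gd mult.commute)
  qed
qed

lemma sqrt_gram_deuler:
  assumes "0 \<le> h" "h * L\<^sup>2 \<le> \<eta> / 2" "h * \<eta> \<le> 1"
  shows "sqrt (gram (deuler h x u) (deuler h x w)) \<le> (1 - \<eta> * h / 2) * sqrt (gram u w)"
proof -
  have "0 \<le> 1 - \<eta> * h / 2" using assms(3) by (simp add: mult.commute)
  then show ?thesis
    using real_sqrt_le_mono[OF gram_deuler[OF assms, of x u w]] by (simp add: real_sqrt_mult)
qed

lemma H_bounded_linear: "bounded_linear (\<lambda>u. H x u w)"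
  by (rule has_derivative_bounded_linear[OF J_deriv])

text \<open>The assumptions differentiate \<open>\<lambda>x. J x w\<close> only for fixed
  \<open>w\<close>. Expanding the second argument in the basis makes \<open>J x w\<close> a finite
  sum of products of functions of one argument each, and the product rule applies. Symmetry of
  \<open>H\<close> gives linearity in the slot where the expansion is undone.\<close>

lemma J_joint_deriv:
  "((\<lambda>(x, w). J x w) has_derivative (\<lambda>(p, q). H x p w + J x q)) (at (x, w))"
proof -
  have J: "J y u = (\<Sum>b\<in>Basis. (u \<bullet> b) *\<^sub>R J y b)" for y u
    by (rule linear_expansion) (simp add: J_linear bounded_linear.linear)
  have H: "H y p u = (\<Sum>b\<in>Basis. (u \<bullet> b) *\<^sub>R H y p b)" for y p u
    using H_bounded_linear[of y p] H_sym
    by (intro linear_expansion) (simp add: bounded_linear.linear)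
  have "((\<lambda>z. J (fst z) b) has_derivative (\<lambda>z. H x (fst z) b)) (at (x, w))" for b
  proof -
    have "(fst has_derivative fst) (at (x, w))" by (intro derivative_intros)
    moreover have "((\<lambda>x. J x b) has_derivative (\<lambda>u. H x u b)) (at (fst (x, w)))"
      by (simp add: J_deriv)
    ultimately show ?thesis
      using diff_chain_at[of fst fst "(x, w)" "\<lambda>x. J x b" "\<lambda>u. H x u b"] by (simp add: o_def)
  qed
  then have "((\<lambda>z. \<Sum>b\<in>Basis. (snd z \<bullet> b) *\<^sub>R J (fst z) b) has_derivative
      (\<lambda>z. \<Sum>b\<in>Basis. (w \<bullet> b) *\<^sub>R H x (fst z) b + (snd z \<bullet> b) *\<^sub>R J x b)) (at (x, w))"
    by (auto intro!: derivative_eq_intros)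
  moreover have "(\<lambda>(x, w). J x w) = (\<lambda>z. \<Sum>b\<in>Basis. (snd z \<bullet> b) *\<^sub>R J (fst z) b)"
    by (auto simp: fun_eq_iff intro: J)
  moreover have "(\<lambda>(p, q). H x p w + J x q) = (\<lambda>z. \<Sum>b\<in>Basis. (w \<bullet> b) *\<^sub>R H x (fst z) b + (snd z \<bullet> b)
      *\<^sub>R J x b)"
    by (auto simp: fun_eq_iff sum.distrib J[symmetric] H[symmetric])
  ultimately show ?thesis by simp
qed

end

section \<open>Differential inequalities, with one-sided derivatives at the ends of the time
  interval\<close>

lemma has_real_derivative_nonpos_imp_le:
  fixes f :: "real \<Rightarrow> real"
  assumes "a \<le> b" "{a..b} \<subseteq> S"
    and "\<And>t. t \<in> {a..b} \<Longrightarrow> (f has_real_derivative f' t) (at t within S)"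
    and "\<And>t. a < t \<Longrightarrow> t < b \<Longrightarrow> f' t \<le> 0"
  shows "f b \<le> f a"
proof (rule DERIV_nonpos_imp_decreasing_open[OF assms(1)])
  fix t assume t: "a < t" "t < b"
  then have "(f has_real_derivative f' t) (at t within {a<..<b})"
    using assms(2) by (intro DERIV_subset[OF assms(3)]) auto
  with t assms(4) show "\<exists>D. (f has_real_derivative D) (at t) \<and> D \<le> 0"
    by (auto simp: at_within_open[of t "{a<..<b}"])
next
  show "continuous_on {a..b} f"
    by (rule DERIV_continuous_on) (rule DERIV_subset[OF assms(3) assms(2)])
qed

lemma gronwall_le:
  fixes f :: "real \<Rightarrow> real"
  assumes "a \<le> b" "{a..b} \<subseteq> S"
    and "\<And>t. t \<in> {a..b} \<Longrightarrow> (f has_real_derivative f' t) (at t within S)"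
    and "\<And>t. a < t \<Longrightarrow> t < b \<Longrightarrow> f' t \<le> k * f t"
  shows "f b \<le> exp (k * (b - a)) * f a"
proof -
  have "exp (- k * (b - a)) * f b \<le> exp (- k * (a - a)) * f a"
  proof (rule has_real_derivative_nonpos_imp_le[OF assms(1,2)])
    show "((\<lambda>t. exp (- k * (t - a)) * f t) has_real_derivative
        exp (- k * (t - a)) * (f' t - k * f t)) (at t within S)" if "t \<in> {a..b}" for t
      using assms(3)[OF that] by (auto intro!: derivative_eq_intros simp: algebra_simps)
    show "exp (- k * (t - a)) * (f' t - k * f t) \<le> 0" if "a < t" "t < b" for t
      using assms(4)[OF that] by (simp add: mult_le_0_iff)
  qed
  then have "exp (k * (b - a)) * (exp (- k * (b - a)) * f b) \<le> exp (k * (b - a)) * f a"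
    by (intro mult_left_mono) auto
  then show ?thesis by (simp flip: mult.assoc exp_add)
qed

section \<open>One-forms, their pullbacks by Euler steps, and their potentials\<close>

context contracting_field
begin

text \<open>\<open>A\<close> is the derivative of the one-form \<open>a\<close> in its base point; the last clause bounds the exterior
  derivative of \<open>a\<close> by \<open>c\<close> times the area form.\<close>

definition one_form :: "('a \<Rightarrow> 'a \<Rightarrow> real) \<Rightarrow> ('a \<Rightarrow> 'a \<Rightarrow> 'a \<Rightarrow> real) \<Rightarrow> real \<Rightarrow> bool" where
  "one_form a A c \<longleftrightarrow>
     (\<forall>x u. ((\<lambda>(x, u). a x u) has_derivative (\<lambda>(p, q). A x p u + a x q)) (at (x, u))) \<and>
     (\<forall>x. linear (a x)) \<and>
     continuous_on UNIV (\<lambda>(x, p, u). A x p u) \<and>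
     (\<forall>x p u. \<bar>A x p u - A x u p\<bar> \<le> c * sqrt (gram p u))"

lemma J_cont: "continuous_on UNIV (\<lambda>(x, u). J x u)"
  using J_joint_deriv by (intro continuous_at_imp_continuous_on) (auto intro: has_derivative_continuous)

text \<open>The exterior derivative is the pairing with \<open>J\<close> minus its transpose. Being
  alternating, it ignores the component of \<open>u\<close> along \<open>p\<close>; for an
  orthogonal pair the area is the product of the norms and each of the two terms costs
  \<open>L\<close>.\<close>

lemma one_form_F: "one_form (\<lambda>x u. F x \<bullet> u) (\<lambda>x p u. J x p \<bullet> u) (2 * L)"
  unfolding one_form_def
proof (intro conjI allI)
  fix x p u :: 'a
  have "((\<lambda>z. F (fst z)) has_derivative (\<lambda>z. J x (fst z))) (at (x, u))"
    using diff_chain_at[of fst fst "(x, u)" F "J x"] F_deriv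
    by (simp add: o_def has_derivative_fst[OF has_derivative_ident])
  then have "((\<lambda>z. F (fst z) \<bullet> snd z) has_derivative (\<lambda>z. F x \<bullet> snd z + J x (fst z) \<bullet> u)) (at (x, u))"
    by (auto intro!: derivative_eq_intros)
  then show "((\<lambda>(x, u). F x \<bullet> u) has_derivative (\<lambda>(p, q). J x p \<bullet> u + F x \<bullet> q)) (at (x, u))"
    by (simp add: case_prod_unfold add.commute)
  show "linear ((\<bullet>) (F x))"
    by (simp add: bounded_linear.linear bounded_linear_inner_right)
  have "continuous_on UNIV (\<lambda>z :: 'a \<times> 'a \<times> 'a. (\<lambda>(x, u). J x u) (fst z, fst (snd z)))"
    by (rule continuous_on_compose2[OF J_cont]) (auto intro!: continuous_intros)
  then show "continuous_on UNIV (\<lambda>(x, p, u). J x p \<bullet> u)"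
    by (auto simp: case_prod_unfold intro!: continuous_intros)
  obtain c z where u: "u = c *\<^sub>R p + z" and z: "p \<bullet> z = 0"
    by (rule orthogonal_decomposition)
  have "J x p \<bullet> u - J x u \<bullet> p = J x p \<bullet> z - J x z \<bullet> p"
    by (simp add: u J_simps inner_add)
  moreover have "\<bar>J x p \<bullet> z\<bar> \<le> L * (norm p * norm z)"
    using Cauchy_Schwarz_ineq2[of "J x p" z] mult_right_mono[OF J_bound[of x p], of "norm z"]
    by (simp add: mult.assoc)
  moreover have "\<bar>J x z \<bullet> p\<bar> \<le> L * (norm p * norm z)"
    using Cauchy_Schwarz_ineq2[of "J x z" p] mult_right_mono[OF J_bound[of x z], of "norm p"]
    by (simp add: mult.assoc mult.commute[of "norm p"])
  moreover have "sqrt (gram p u) = norm p * norm z"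
    using z by (simp add: u gram_shear) (simp add: gram_def real_sqrt_mult norm_eq_sqrt_inner)
  ultimately show "\<bar>J x p \<bullet> u - J x u \<bullet> p\<bar> \<le> 2 * L * sqrt (gram p u)"
    by simp
qed

text \<open>Pullback commutes with the exterior derivative: the terms with
  \<open>h *\<^sub>R H x p u\<close> cancel by symmetry of \<open>H\<close>. What remains is the old
  exterior derivative on the images of \<open>p\<close> and \<open>u\<close> under
  \<open>deuler h x\<close>, whose area has shrunk.\<close>

lemma one_form_euler:
  assumes a: "one_form a A c" and c: "0 \<le> c"
    and h: "0 \<le> h" "h * L\<^sup>2 \<le> \<eta> / 2" "h * \<eta> \<le> 1"
  shows "one_form (\<lambda>x u. a (euler h x) (deuler h x u))
     (\<lambda>x p u. A (euler h x) (deuler h x p) (deuler h x u) + a (euler h x) (h *\<^sub>R H x p u))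
     (c * (1 - \<eta> * h / 2))"
  unfolding one_form_def
proof (intro conjI allI)
  fix x p u :: 'a
  have lin: "linear (a x)" for x using a by (simp add: one_form_def)
  note lins = linear_add[OF lin] linear_cmul[OF lin]
  \<comment> \<open>A one-form is treated as a function on the tangent bundle, and
    \<open>\<Psi>\<close> is the tangent map of the Euler step.\<close>
  define \<Psi> where "\<Psi> = (\<lambda>(x, u). (euler h x, deuler h x u))"
  have F1: "((\<lambda>z. F (fst z)) has_derivative (\<lambda>z. J x (fst z))) (at (x, u))" for x u
    using diff_chain_at[of fst fst "(x, u)" F "J x"] F_deriv
    by (simp add: o_def has_derivative_fst[OF has_derivative_ident])
  have J1: "((\<lambda>z. J (fst z) (snd z)) has_derivative (\<lambda>z. H x (fst z) u + J x (snd z))) (at (x, u))" for x u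
    using J_joint_deriv[of x u] by (simp add: case_prod_unfold)
  have psi: "(\<Psi> has_derivative (\<lambda>(p, q). (deuler h x p, deuler h x q + h *\<^sub>R H x p u))) (at (x, u))" for x u
    unfolding \<Psi>_def case_prod_unfold euler_def deuler_def
    by (rule has_derivative_Pair; (rule derivative_eq_intros F1 J1 refl)+; simp add: algebra_simps)
  have "((\<lambda>(x, u). a x u) \<circ> \<Psi> has_derivative
      (\<lambda>(p, q). A (euler h x) p (deuler h x u) + a (euler h x) q) \<circ>
      (\<lambda>(p, q). (deuler h x p, deuler h x q + h *\<^sub>R H x p u))) (at (x, u))"
    by (rule diff_chain_at[OF psi]) (use a in \<open>simp add: one_form_def \<Psi>_def\<close>)
  then show "((\<lambda>(x, u). a (euler h x) (deuler h x u)) has_derivative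
     (\<lambda>(p, q). A (euler h x) (deuler h x p) (deuler h x u) + a (euler h x) (h *\<^sub>R H x p u) +
        a (euler h x) (deuler h x q))) (at (x, u))"
    by (simp add: o_def case_prod_unfold \<Psi>_def lins algebra_simps)
  show "linear (\<lambda>u. a (euler h x) (deuler h x u))"
    by (intro linearI) (simp_all add: deuler_simps lins)
  have Fc: "continuous_on UNIV F"
    using F_deriv by (intro continuous_at_imp_continuous_on) (auto intro: has_derivative_continuous)
  have ac: "continuous_on UNIV (\<lambda>(x, u). a x u)"
    using a by (intro continuous_at_imp_continuous_on) (auto simp: one_form_def intro:
        has_derivative_continuous)
  have Ac: "continuous_on UNIV (\<lambda>(x, p, u). A x p u)" using a by (simp add: one_form_def)
  have Jc: "continuous_on UNIV (\<lambda>z. J (f z) (g z))"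
    if "continuous_on UNIV f" "continuous_on UNIV g" for f g :: "'a \<times> 'a \<times> 'a \<Rightarrow> 'a"
    using continuous_on_compose2[OF J_cont continuous_on_Pair[OF that]] by simp
  have e: "continuous_on UNIV (\<lambda>z :: 'a \<times> 'a \<times> 'a. euler h (fst z))"
    unfolding euler_def by (auto intro!: continuous_intros continuous_on_compose2[OF Fc])
  have d1: "continuous_on UNIV (\<lambda>z :: 'a \<times> 'a \<times> 'a. deuler h (fst z) (fst (snd z)))"
   and d2: "continuous_on UNIV (\<lambda>z :: 'a \<times> 'a \<times> 'a. deuler h (fst z) (snd (snd z)))"
    unfolding deuler_def by (auto intro!: continuous_intros Jc)
  have hH: "continuous_on UNIV (\<lambda>z :: 'a \<times> 'a \<times> 'a. h *\<^sub>R H (fst z) (fst (snd z)) (snd (snd z)))"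
    using H_cont by (auto simp: case_prod_unfold intro!: continuous_intros)
  show "continuous_on UNIV (\<lambda>(x, p, u). A (euler h x) (deuler h x p) (deuler h x u) + a (euler h x) (h
      *\<^sub>R H x p u))"
    using continuous_on_compose2[OF Ac continuous_on_Pair[OF e continuous_on_Pair[OF d1 d2]]]
      continuous_on_compose2[OF ac continuous_on_Pair[OF e hH]]
    by (auto simp: case_prod_unfold intro!: continuous_intros)
  have "\<bar>A (euler h x) (deuler h x p) (deuler h x u) - A (euler h x) (deuler h x u) (deuler h x p)\<bar>
      \<le> c * sqrt (gram (deuler h x p) (deuler h x u))"
    using a by (simp add: one_form_def)
  also have "\<dots> \<le> c * ((1 - \<eta> * h / 2) * sqrt (gram p u))"
    using c by (intro mult_left_mono sqrt_gram_deuler h)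
  finally show "\<bar>A (euler h x) (deuler h x p) (deuler h x u) + a (euler h x) (h *\<^sub>R H x p u) -
      (A (euler h x) (deuler h x u) (deuler h x p) + a (euler h x) (h *\<^sub>R H x u p))\<bar>
      \<le> c * (1 - \<eta> * h / 2) * sqrt (gram p u)"
    by (simp add: H_sym[of x p u] mult.assoc)
qed

text \<open>The pullback of \<open>F \<bullet> dx\<close> under \<open>k\<close> Euler steps of size
  \<open>h\<close>, in place of the pullback under the flow for the time
  \<open>k * h\<close>.\<close>

fun euler_form :: "real \<Rightarrow> nat \<Rightarrow> 'a \<Rightarrow> 'a \<Rightarrow> real" where
  "euler_form h 0 x u = F x \<bullet> u"
| "euler_form h (Suc k) x u = euler_form h k (euler h x) (deuler h x u)"

lemma one_form_euler_form:
  assumes h: "0 \<le> h" "h * L\<^sup>2 \<le> \<eta> / 2" "h * \<eta> \<le> 1"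
  shows "\<exists>A. one_form (euler_form h k) A (2 * L * (1 - \<eta> * h / 2) ^ k)"
proof (induction k)
  case 0
  show ?case using one_form_F by (auto simp: fun_eq_iff)
next
  case (Suc k)
  then obtain A where A: "one_form (euler_form h k) A (2 * L * (1 - \<eta> * h / 2) ^ k)" by auto
  have "0 \<le> 1 - \<eta> * h / 2" using h(3) by (simp add: mult.commute)
  then have "0 \<le> 2 * L * (1 - \<eta> * h / 2) ^ k" using L_pos by simp
  from one_form_euler[OF A this h] show ?case
    by (auto simp: mult_ac)
qed

text \<open>Up to a multiple of its exterior derivative, a one-form is the differential of its integral over
  the ray from the origin.\<close>

lemma one_form_potential:
  assumes a: "one_form a A c" and c: "0 \<le> c"
    and y: "\<And>t. 0 \<le> t \<Longrightarrow> (y has_vector_derivative v t) (at t within {0..})"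
    and v: "continuous_on {0..} v" and t: "0 \<le> t"
  shows "\<exists>D. ((\<lambda>t. integral {0..1} (\<lambda>\<sigma>. a (\<sigma> *\<^sub>R y t) (y t))) has_real_derivative D) (at t within {0..}) \<and>
    \<bar>D - a (y t) (v t)\<bar> \<le> c * (norm (y t) * norm (v t))"
proof -
  have lin: "linear (a x)" for x using a by (simp add: one_form_def)
  note lins = linear_add[OF lin] linear_cmul[OF lin]
  have ad: "((\<lambda>(x, u). a x u) has_derivative (\<lambda>(p, q). A x p u + a x q)) (at (x, u))" for x u
    using a by (simp add: one_form_def)
  have ac: "continuous_on UNIV (\<lambda>(x, u). a x u)"
    using a by (intro continuous_at_imp_continuous_on) (auto simp: one_form_def intro:
        has_derivative_continuous)
  have Ac: "continuous_on UNIV (\<lambda>(x, p, u). A x p u)" using a by (simp add: one_form_def)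
  have A0: "A x (s *\<^sub>R p) u = s * A x p u" for x s p u
    using linear_cmul[OF has_derivative_linear[OF ad[of x u]], of s "(p, 0)"] linear_0[OF lin] by simp
  have yc: "continuous_on {0..} y"
    using y by (auto simp: continuous_on_eq_continuous_within intro: has_vector_derivative_continuous)
  define f where "f = (\<lambda>t \<sigma>. a (\<sigma> *\<^sub>R y t) (y t))"
  \<comment> \<open>The time derivative of the integrand \<open>f\<close>.\<close>
  define g where "g = (\<lambda>t \<sigma>. A (\<sigma> *\<^sub>R y t) (\<sigma> *\<^sub>R v t) (y t) + a (\<sigma> *\<^sub>R y t) (v t))"
  have df: "((\<lambda>t. f t \<sigma>) has_vector_derivative g s \<sigma>) (at s within {0..})" if "0 \<le> s" for s \<sigma>
  proof -
    have "((\<lambda>t. (\<sigma> *\<^sub>R y t, y t)) has_vector_derivative (\<sigma> *\<^sub>R v s, v s)) (at s within {0..})"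
      using y[OF that] by (auto intro!: derivative_eq_intros)
    from vector_derivative_diff_chain_within[OF this has_derivative_at_withinI[OF ad]]
    show ?thesis by (simp add: o_def f_def g_def)
  qed
  have gc: "continuous_on ({0..} \<times> cbox 0 1) (\<lambda>(t, \<sigma>). g t \<sigma>)"
  proof -
    have 1: "continuous_on ({0..} \<times> cbox 0 1) (\<lambda>z :: real \<times> real. y (fst z))"
     and 2: "continuous_on ({0..} \<times> cbox 0 1) (\<lambda>z :: real \<times> real. v (fst z))"
      by (rule continuous_on_compose2[OF yc] continuous_on_compose2[OF v]; auto intro!: continuous_intros)+
    have 3: "continuous_on ({0..} \<times> cbox 0 1) (\<lambda>z :: real \<times> real. snd z *\<^sub>R y (fst z))"
     and 4: "continuous_on ({0..} \<times> cbox 0 1) (\<lambda>z :: real \<times> real. snd z *\<^sub>R v (fst z))"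
      using 1 2 by (auto intro!: continuous_intros)
    show ?thesis
      using continuous_on_compose2[OF Ac continuous_on_Pair[OF 3 continuous_on_Pair[OF 4 1]]]
        continuous_on_compose2[OF ac continuous_on_Pair[OF 3 2]]
      by (auto simp: g_def case_prod_unfold intro!: continuous_intros)
  qed
  have fi: "f s integrable_on cbox 0 1" for s
    unfolding f_def
    by (intro integrable_continuous continuous_on_compose2[OF ac, of _ "\<lambda>\<sigma>. (\<sigma> *\<^sub>R y s, y s)", simplified])
       (auto intro!: continuous_intros)
  have "((\<lambda>t. integral (cbox 0 1) (f t)) has_vector_derivative integral (cbox 0 1) (g t)) (at t within
      {0..})"
    by (rule leibniz_rule_vector_derivative[OF _ fi gc]) (use df t in auto)
  then have D: "((\<lambda>t. integral {0..1} (\<lambda>\<sigma>. a (\<sigma> *\<^sub>R y t) (y t))) has_real_derivative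
      integral {0..1} (g t)) (at t within {0..})"
    by (simp add: f_def has_real_derivative_iff_has_vector_derivative)
  \<comment> \<open>The value at the end of the ray is the integral over \<sigma> of the derivative
    of \<open>\<sigma> * a (\<sigma> *\<^sub>R y t) (v t)\<close>. Subtracted from
    \<open>g t\<close>, it leaves \<sigma> times the exterior derivative on the pair
    \<open>v t\<close>, \<open>y t\<close>, as in the proof of the Poincare lemma.\<close>
  have e: "((\<lambda>\<sigma>. a (\<sigma> *\<^sub>R y t) (v t) + \<sigma> * A (\<sigma> *\<^sub>R y t) (y t) (v t)) has_integral a (y t) (v t)) {0..1}"
  proof -
    have 1: "((\<lambda>\<sigma>. (\<sigma> *\<^sub>R y t, v t)) has_vector_derivative (y t, 0)) (at \<sigma> within {0..1})" for \<sigma>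
      by (auto intro!: derivative_eq_intros)
    have 2: "((\<lambda>\<sigma>. a (\<sigma> *\<^sub>R y t) (v t)) has_real_derivative A (\<sigma> *\<^sub>R y t) (y t) (v t)) (at \<sigma> within
        {0..1})" for \<sigma>
      using vector_derivative_diff_chain_within[OF 1 has_derivative_at_withinI[OF ad]] linear_0[OF lin]
      by (simp add: o_def has_real_derivative_iff_has_vector_derivative)
    have "((\<lambda>\<sigma>. \<sigma> * a (\<sigma> *\<^sub>R y t) (v t)) has_vector_derivative
        a (\<sigma> *\<^sub>R y t) (v t) + \<sigma> * A (\<sigma> *\<^sub>R y t) (y t) (v t)) (at \<sigma> within {0..1})" for \<sigma>
      unfolding has_real_derivative_iff_has_vector_derivative[symmetric]
      by (rule derivative_eq_intros 2 refl)+ simp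
    then show ?thesis
      using fundamental_theorem_of_calculus[of 0 1 "\<lambda>\<sigma>. \<sigma> * a (\<sigma> *\<^sub>R y t) (v t)"] by fastforce
  qed
  have gi: "(g t has_integral integral {0..1} (g t)) {0..1}"
  proof -
    have "continuous_on (cbox 0 1) (\<lambda>\<sigma>. (\<lambda>(t, \<sigma>). g t \<sigma>) (t, \<sigma>))"
      by (rule continuous_on_compose2[OF gc]) (use t in \<open>auto intro!: continuous_intros\<close>)
    then show ?thesis by (simp add: integrable_integral integrable_continuous_real)
  qed
  have "((\<lambda>\<sigma>. \<sigma> * (A (\<sigma> *\<^sub>R y t) (v t) (y t) - A (\<sigma> *\<^sub>R y t) (y t) (v t))) has_integral
      (integral {0..1} (g t) - a (y t) (v t))) {0..1}"
    using has_integral_diff[OF gi e] by (simp add: g_def A0 algebra_simps)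
  then have "norm (integral {0..1} (g t) - a (y t) (v t)) \<le> (c * (norm (y t) * norm (v t))) * measure
      lborel {0..1::real}"
  proof (rule has_integral_bound_real[rotated 2])
    show "0 \<le> c * (norm (y t) * norm (v t))" using c by simp
    fix \<sigma> :: real assume "\<sigma> \<in> {0..1} - {}"
    then have s: "0 \<le> \<sigma>" "\<sigma> \<le> 1" by auto
    have "\<bar>A (\<sigma> *\<^sub>R y t) (v t) (y t) - A (\<sigma> *\<^sub>R y t) (y t) (v t)\<bar> \<le> c * sqrt (gram (v t) (y t))"
      using a by (simp add: one_form_def)
    also have "\<dots> \<le> c * (norm (v t) * norm (y t))"
      using c sqrt_gram_le by (rule mult_left_mono[rotated])
    finally have "\<bar>A (\<sigma> *\<^sub>R y t) (v t) (y t) - A (\<sigma> *\<^sub>R y t) (y t) (v t)\<bar> \<le> c * (norm (v t) * norm (y t))" .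
    from mult_mono[OF s(2) this] s(1)
    show "norm (\<sigma> * (A (\<sigma> *\<^sub>R y t) (v t) (y t) - A (\<sigma> *\<^sub>R y t) (y t) (v t))) \<le> c * (norm (y t) * norm
        (v t))"
      by (simp add: abs_mult mult_ac)
  qed auto
  with D show ?thesis by auto
qed

end

section \<open>Energy and length of an orbit\<close>

lemma integral_has_real_derivative_atLeast:
  fixes f :: "real \<Rightarrow> real"
  assumes f: "continuous_on {0..} f" and t: "0 \<le> t"
  shows "((\<lambda>u. integral {0..u} f) has_real_derivative f t) (at t within {0..})"
proof -
  have "((\<lambda>u. integral {0..u} f) has_real_derivative f t) (at t within {0..t + 1})"
    by (rule integral_has_real_derivative) (use t in \<open>auto intro: continuous_on_subset[OF f]\<close>)
  moreover have "at t within {0..t + 1} = at t within {0..}"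
    by (rule at_within_nhd[of _ "{t - 1<..<t + 1}"]) auto
  ultimately show ?thesis by simp
qed

lemma norm_diff_le_derivative_bound:
  fixes f :: "real \<Rightarrow> 'a::euclidean_space"
  assumes "a \<le> b" "{a..b} \<subseteq> S"
    and "\<And>t. t \<in> {a..b} \<Longrightarrow> (f has_vector_derivative f' t) (at t within S)"
    and "\<And>t. t \<in> {a..b} \<Longrightarrow> norm (f' t) \<le> M"
  shows "norm (f b - f a) \<le> M * (b - a)"
proof -
  have M: "0 \<le> M" using assms(1) order_trans[OF norm_ge_zero assms(4)[of a]] by simp
  have "(f' has_integral (f b - f a)) {a..b}"
    using assms(1-3) by (intro fundamental_theorem_of_calculus)
      (auto intro: has_vector_derivative_within_subset)
  from has_integral_bound_real[OF M _ this, of "{}"] show ?thesis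
    using assms(1,4) by simp
qed

lemma has_real_derivative_inner:
  assumes "(f has_vector_derivative f') (at t within S)" "(g has_vector_derivative g') (at t within S)"
  shows "((\<lambda>t. f t \<bullet> g t) has_real_derivative (f t \<bullet> g' + f' \<bullet> g t)) (at t within S)"
  unfolding has_field_derivative_def
  by (rule has_derivative_eq_rhs[OF has_derivative_inner[OF assms[unfolded has_vector_derivative_def]]])
     (simp add: fun_eq_iff algebra_simps)

section \<open>Bounded orbits and the accuracy of Euler steps along them\<close>

locale bounded_orbit = contracting_field F J H L B \<eta>
  for F :: "'a::euclidean_space \<Rightarrow> 'a" and J H L B \<eta> +
  fixes y :: "real \<Rightarrow> 'a" and K :: real
  assumes y_deriv: "0 \<le> t \<Longrightarrow> (y has_vector_derivative F (y t)) (at t within {0..})"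
    and y_bound: "0 \<le> t \<Longrightarrow> norm (y t) \<le> K"
begin

definition v :: "real \<Rightarrow> 'a" where "v t = F (y t)"
definition acc :: "real \<Rightarrow> 'a" where "acc t = J (y t) (v t)"

lemma y_deriv_v: "0 \<le> t \<Longrightarrow> (y has_vector_derivative v t) (at t within {0..})"
  using y_deriv by (simp add: v_def)

lemma v_deriv: "0 \<le> t \<Longrightarrow> (v has_vector_derivative acc t) (at t within {0..})"
  using vector_derivative_diff_chain_within[OF y_deriv_v has_derivative_at_withinI[OF F_deriv]]
  by (simp add: o_def v_def[abs_def] acc_def)

lemma acc_deriv:
  assumes "0 \<le> t"
  shows "(acc has_vector_derivative H (y t) (v t) (v t) + J (y t) (acc t)) (at t within {0..})"
proof -
  have "((\<lambda>t. (y t, v t)) has_vector_derivative (v t, acc t)) (at t within {0..})"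
    using y_deriv_v[OF assms] v_deriv[OF assms] by (rule has_vector_derivative_Pair)
  from vector_derivative_diff_chain_within[OF this has_derivative_at_withinI[OF J_joint_deriv]]
  show ?thesis by (simp add: o_def acc_def[abs_def])
qed

lemma v_cont: "continuous_on {0..} v"
  using v_deriv by (auto simp: continuous_on_eq_continuous_within intro: has_vector_derivative_continuous)

lemma K_nonneg: "0 \<le> K"
  using y_bound[of 0] norm_ge_zero[of "y 0"] by linarith

lemma F_lipschitz: "norm (F p - F q) \<le> L * norm (p - q)"
proof (rule differentiable_bound[of UNIV])
  show "onorm (J x) \<le> L" for x
    by (rule onorm_bound) (use L_pos J_bound in auto)
qed (use F_deriv in auto)

lemma J_lipschitz: "norm (J p w - J q w) \<le> B * norm w * norm (p - q)"
proof (rule differentiable_bound[of UNIV "\<lambda>x. J x w"])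
  show "onorm (\<lambda>u. H x u w) \<le> B * norm w" for x
    by (rule onorm_bound) (use B_pos H_bound[of x _ w] in \<open>auto simp: mult_ac\<close>)
qed (use J_deriv in auto)

definition V :: real where "V = norm (F 0) + L * K + 1"

lemma V_pos: "0 < V"
  using L_pos K_nonneg by (auto simp: V_def intro!: add_nonneg_pos add_nonneg_nonneg)

lemma v_bound: "0 \<le> t \<Longrightarrow> norm (v t) \<le> V"
proof -
  assume t: "0 \<le> t"
  have "norm (v t) \<le> norm (F 0) + norm (F (y t) - F 0)"
    by (metis add.commute diff_add_cancel norm_triangle_ineq v_def)
  also have "norm (F (y t) - F 0) \<le> L * K"
    using order_trans[OF F_lipschitz[of "y t" 0]] y_bound[OF t] L_pos by simp
  finally show ?thesis by (simp add: V_def)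
qed

text \<open>The bound is relative to the current speed, because the Euler errors will be integrated
  against arc length. It also shows that an orbit at an equilibrium stays there.\<close>

lemma v_growth:
  assumes "0 \<le> t" "0 \<le> r"
  shows "norm (v (t + r)) \<le> exp (L * r) * norm (v t)"
proof -
  have "v (t + r) \<bullet> v (t + r) \<le> exp (2 * L * (t + r - t)) * (v t \<bullet> v t)"
  proof (rule gronwall_le[of _ _ "{0..}"])
    show "((\<lambda>s. v s \<bullet> v s) has_real_derivative 2 * (v s \<bullet> acc s)) (at s within {0..})"
      if "s \<in> {t..t + r}" for s
      by (intro DERIV_cong[OF has_real_derivative_inner[OF v_deriv v_deriv]])
         (use assms that in \<open>auto simp: inner_commute\<close>)
    fix s
    have "v s \<bullet> acc s \<le> norm (v s) * (L * norm (v s))"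
      unfolding acc_def by (intro order_trans[OF norm_cauchy_schwarz] mult_left_mono J_bound) auto
    then show "2 * (v s \<bullet> acc s) \<le> 2 * L * (v s \<bullet> v s)"
      by (simp add: dot_square_norm power2_eq_square mult_ac)
  qed (use assms in auto)
  also have "\<dots> = (exp (L * r) * norm (v t))\<^sup>2"
    using exp_double[of "L * r"] by (simp add: power_mult_distrib power2_norm_eq_inner mult.assoc)
  finally have "(norm (v (t + r)))\<^sup>2 \<le> (exp (L * r) * norm (v t))\<^sup>2"
    by (simp only: power2_norm_eq_inner)
  then show ?thesis by (rule power2_le_imp_le) simp
qed

text \<open>In units of the speed, \<open>L\<close> bounds the second derivative of \<open>y\<close>
  and \<open>L\<^sup>2 + B * V\<close> that of \<open>v\<close>; the factor \<open>exp L\<close>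
  compares the speeds within one step of size at most 1.\<close>

definition M :: real where "M = (L + (L\<^sup>2 + B * V)) * exp L"

lemma euler_local_error:
  assumes t: "0 \<le> t" and h: "0 \<le> h" "h \<le> 1"
  shows "norm (y (t + h) - euler h (y t)) + norm (v (t + h) - deuler h (y t) (v t)) \<le> M * h\<^sup>2 * norm (v t)"
proof -
  have v1: "norm (v s) \<le> exp L * norm (v t)" if "s \<in> {t..t + h}" for s
  proof -
    have "norm (v s) \<le> exp (L * (s - t)) * norm (v t)" using v_growth[of t "s - t"] t that by simp
    also have "\<dots> \<le> exp (L * 1) * norm (v t)"
      using that h L_pos by (intro mult_right_mono) auto
    finally show ?thesis by simp
  qed
  have a1: "norm (acc s) \<le> L * exp L * norm (v t)" if "s \<in> {t..t + h}" for s
    unfolding acc_def using mult_left_mono[OF v1[OF that], of L] L_pos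
    by (intro order_trans[OF J_bound]) (simp add: mult.assoc)
  have j1: "norm (H (y s) (v s) (v s) + J (y s) (acc s)) \<le> (L\<^sup>2 + B * V) * exp L * norm (v t)"
    if s: "s \<in> {t..t + h}" for s
  proof -
    have "norm (H (y s) (v s) (v s)) \<le> (B * norm (v s)) * norm (v s)" by (rule H_bound)
    also have "\<dots> \<le> (B * V) * (exp L * norm (v t))"
      using s t v_bound[of s] B_pos V_pos v1[OF s] by (intro mult_mono mult_left_mono) auto
    finally have 1: "norm (H (y s) (v s) (v s)) \<le> B * V * exp L * norm (v t)" by simp
    have "norm (J (y s) (acc s)) \<le> L * (L * exp L * norm (v t))"
      using L_pos a1[OF s] by (intro order_trans[OF J_bound] mult_left_mono) auto
    with 1 show ?thesis
      by (intro order_trans[OF norm_triangle_ineq]) (simp add: power2_eq_square algebra_simps)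
  qed
  have sub: "{t..s} \<subseteq> {0..}" "{t..t + h} \<subseteq> {0..}" for s using t by auto
  have y2: "norm (y (t + h) - y t - (t + h - t) *\<^sub>R v t) \<le> norm (t + h - t) * (h * (L * exp L * norm
      (v t)))"
  proof (rule vector_differentiable_bound_linearization[of "{t..t + h}"])
    fix s assume s: "s \<in> {t..t + h}"
    show "(y has_vector_derivative v s) (at s within {t..t + h})"
      using s t by (auto intro: has_vector_derivative_within_subset[OF y_deriv_v])
    have "norm (v s - v t) \<le> (L * exp L * norm (v t)) * (s - t)"
      by (rule norm_diff_le_derivative_bound[OF _ sub(1), where f' = acc]) (use s t in \<open>auto intro: a1
          v_deriv\<close>)
    also have "\<dots> \<le> (L * exp L * norm (v t)) * h"
      using s L_pos by (intro mult_left_mono) auto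
    finally show "norm (v s - v t) \<le> h * (L * exp L * norm (v t))" by (simp add: mult.commute)
  qed (use h in \<open>auto simp: closed_segment_eq_real_ivl\<close>)
  have v2: "norm (v (t + h) - v t - (t + h - t) *\<^sub>R acc t)
      \<le> norm (t + h - t) * (h * ((L\<^sup>2 + B * V) * exp L * norm (v t)))"
  proof (rule vector_differentiable_bound_linearization[of "{t..t + h}"])
    fix s assume s: "s \<in> {t..t + h}"
    show "(v has_vector_derivative acc s) (at s within {t..t + h})"
      using s t by (auto intro: has_vector_derivative_within_subset[OF v_deriv])
    have "norm (acc s - acc t) \<le> ((L\<^sup>2 + B * V) * exp L * norm (v t)) * (s - t)"
      by (rule norm_diff_le_derivative_bound[OF _ sub(1),
            where f' = "\<lambda>s. H (y s) (v s) (v s) + J (y s) (acc s)"]) (use s t in \<open>auto intro: j1 acc_deriv\<close>)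
    also have "\<dots> \<le> ((L\<^sup>2 + B * V) * exp L * norm (v t)) * h"
      using s B_pos V_pos by (intro mult_left_mono) auto
    finally show "norm (acc s - acc t) \<le> h * ((L\<^sup>2 + B * V) * exp L * norm (v t))" by (simp add:
        mult.commute)
  qed (use h in \<open>auto simp: closed_segment_eq_real_ivl\<close>)
  have "norm (y (t + h) - euler h (y t)) + norm (v (t + h) - deuler h (y t) (v t)) \<le>
      h * (h * (L * exp L * norm (v t))) + h * (h * ((L\<^sup>2 + B * V) * exp L * norm (v t)))"
    using y2 v2 h by (simp add: euler_def deuler_def acc_def v_def diff_diff_eq)
  also have "\<dots> = M * h\<^sup>2 * norm (v t)" by (simp add: M_def power2_eq_square algebra_simps)
  finally show ?thesis .
qed

text \<open>A Lipschitz constant along the orbit for the field together with its variational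
  equation: \<open>B * V\<close> accounts for the dependence of \<open>J x (v t)\<close> on
  \<open>x\<close>.\<close>

definition \<Lambda> :: real where "\<Lambda> = L + B * V"

text \<open>A discrete Gronwall estimate. As \<open>euler_form\<close> peels off the first step, the
  induction advances the base time \<open>t\<close> and has to admit an initial error
  \<open>e\<close>. The witnesses \<open>p'\<close> and \<open>q'\<close> are the end of the
  discrete trajectory and its transported vector.\<close>

lemma euler_global_error:
  assumes h: "0 \<le> h" "h \<le> 1" and "0 \<le> t" "0 \<le> e" "0 \<le> S"
    and "norm (p - y t) + norm (q - v t) \<le> e"
    and "\<And>r. t \<le> r \<Longrightarrow> r \<le> t + k * h \<Longrightarrow> norm (v r) \<le> S"
  shows "\<exists>p' q'. euler_form h k p q = F p' \<bullet> q' \<and>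
    norm (p' - y (t + k * h)) + norm (q' - v (t + k * h)) \<le> (e + k * (M * h\<^sup>2 * S)) * exp (\<Lambda> * (k * h))"
  using assms(3-)
proof (induction k arbitrary: t p q e)
  case 0
  then show ?case by auto
next
  case (Suc k)
  define d where "d = M * h\<^sup>2 * S"
  have M0: "0 \<le> M" using L_pos B_pos V_pos by (simp add: M_def)
  then have d0: "0 \<le> d" using Suc.prems by (simp add: d_def)
  have kh: "0 \<le> real k * h" using h by simp
  have L0: "0 \<le> \<Lambda>" using L_pos B_pos V_pos by (simp add: \<Lambda>_def)
  define e1 where "e1 = (1 + \<Lambda> * h) * e + d"
  have a: "norm (euler h p - euler h (y t)) \<le> (1 + h * L) * norm (p - y t)"
  proof -
    have "euler h p - euler h (y t) = (p - y t) + h *\<^sub>R (F p - F (y t))"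
      by (simp add: euler_def algebra_simps)
    also have "norm \<dots> \<le> norm (p - y t) + h * (L * norm (p - y t))"
      using h F_lipschitz by (intro order_trans[OF norm_triangle_ineq]) (auto intro!: mult_left_mono)
    finally show ?thesis by (simp add: algebra_simps)
  qed
  have b: "norm (deuler h p q - deuler h (y t) (v t)) \<le> (1 + h * L) * norm (q - v t) + h * (B * V) *
      norm (p - y t)"
  proof -
    \<comment> \<open>The mixed term is split so that the Lipschitz bound of \<open>J\<close> is
      applied to the true velocity \<open>v t\<close>, which is bounded by \<open>V\<close>, and not
      to \<open>q\<close>.\<close>
    have "deuler h p q - deuler h (y t) (v t) = (q - v t) + h *\<^sub>R (J p (q - v t) + (J p (v t) - J (y
        t) (v t)))"
      using J_simps(1)[of p "q - v t" "v t"] by (simp add: deuler_def algebra_simps)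
    also have "norm \<dots> \<le> norm (q - v t) + h * (L * norm (q - v t) + B * V * norm (p - y t))"
    proof -
      have "norm (J p (v t) - J (y t) (v t)) \<le> B * norm (v t) * norm (p - y t)" by (rule J_lipschitz)
      also have "\<dots> \<le> B * V * norm (p - y t)"
        using v_bound[OF Suc.prems(1)] B_pos by (intro mult_right_mono mult_left_mono) auto
      finally have "norm (J p (q - v t) + (J p (v t) - J (y t) (v t))) \<le> L * norm (q - v t) + B * V *
          norm (p - y t)"
        using J_bound[of p "q - v t"] by (intro order_trans[OF norm_triangle_ineq]) auto
      then show ?thesis using h by (intro order_trans[OF norm_triangle_ineq]) (auto intro!: mult_left_mono)
    qed
    finally show ?thesis by (simp add: algebra_simps)
  qed
  have "norm (v t) \<le> S" using Suc.prems(5)[of t] h by simp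
  then have "M * h\<^sup>2 * norm (v t) \<le> d" unfolding d_def using M0 by (intro mult_left_mono) auto
  with euler_local_error[OF Suc.prems(1) h]
  have c: "norm (y (t + h) - euler h (y t)) + norm (v (t + h) - deuler h (y t) (v t)) \<le> d" by simp
  have "norm (euler h p - y (t + h)) + norm (deuler h p q - v (t + h)) \<le>
      (norm (euler h p - euler h (y t)) + norm (deuler h p q - deuler h (y t) (v t))) + d"
    using c norm_triangle_ineq4[of "euler h p - euler h (y t)" "y (t + h) - euler h (y t)"]
      norm_triangle_ineq4[of "deuler h p q - deuler h (y t) (v t)" "v (t + h) - deuler h (y t) (v t)"]
          by simp
  also have "\<dots> \<le> (1 + \<Lambda> * h) * (norm (p - y t) + norm (q - v t)) + d"
  proof -
    have "0 \<le> h * (B * V) * norm (q - v t)" using h B_pos V_pos by simp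
    with a b show ?thesis by (simp add: \<Lambda>_def algebra_simps)
  qed
  also have "\<dots> \<le> e1"
    unfolding e1_def using Suc.prems(4) L0 h by (intro add_right_mono mult_left_mono) auto
  finally have e1: "norm (euler h p - y (t + h)) + norm (deuler h p q - v (t + h)) \<le> e1" .
  have "0 \<le> e1" using Suc.prems L0 h d0 by (simp add: e1_def)
  have tk: "t + h + real k * h = t + real (Suc k) * h" by (simp add: algebra_simps)
  have "\<exists>p' q'. euler_form h k (euler h p) (deuler h p q) = F p' \<bullet> q' \<and>
    norm (p' - y (t + h + k * h)) + norm (q' - v (t + h + k * h)) \<le> (e1 + k * (M * h\<^sup>2 * S)) * exp (\<Lambda>
        * (k * h))"
    by (rule Suc.IH) (use Suc.prems h e1 \<open>0 \<le> e1\<close> tk in auto)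
  then obtain p' q' where "euler_form h k (euler h p) (deuler h p q) = F p' \<bullet> q'"
    and pq: "norm (p' - y (t + real (Suc k) * h)) + norm (q' - v (t + real (Suc k) * h))
      \<le> (e1 + k * d) * exp (\<Lambda> * (k * h))"
    unfolding tk d_def by blast
  moreover have "(e1 + k * d) * exp (\<Lambda> * (k * h)) \<le> (e + real (Suc k) * d) * exp (\<Lambda> * (real (Suc k) * h))"
  proof -
    have x: "1 + \<Lambda> * h \<le> exp (\<Lambda> * h)" by (rule exp_ge_add_one_self)
    have y: "1 \<le> exp (\<Lambda> * h)" using L0 h by simp
    have "e1 + k * d \<le> exp (\<Lambda> * h) * e + exp (\<Lambda> * h) * (real (Suc k) * d)"
    proof -
      have "(1 + \<Lambda> * h) * e \<le> exp (\<Lambda> * h) * e" using x Suc.prems(2) by (rule mult_right_mono)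
      moreover have "1 * (real (Suc k) * d) \<le> exp (\<Lambda> * h) * (real (Suc k) * d)"
        using y d0 by (intro mult_right_mono) auto
      ultimately show ?thesis by (simp add: e1_def algebra_simps)
    qed
    then have "(e1 + k * d) * exp (\<Lambda> * (k * h)) \<le> (exp (\<Lambda> * h) * (e + real (Suc k) * d)) * exp (\<Lambda> * (k
        * h))"
      by (intro mult_right_mono) (simp_all add: distrib_left)
    also have "\<dots> = (e + real (Suc k) * d) * exp (\<Lambda> * (real (Suc k) * h))"
      by (simp add: algebra_simps flip: exp_add)
    finally show ?thesis .
  qed
  ultimately show ?case unfolding d_def[symmetric]
    by (intro exI[of _ p'] exI[of _ q']) (auto intro: order_trans)
qed

end

section \<open>Energy is small compared with length\<close>

context bounded_orbit
begin

definition len :: "real \<Rightarrow> real" where "len t = integral {0..t} (\<lambda>s. norm (v s))"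
definition energy :: "real \<Rightarrow> real" where "energy t = integral {0..t} (\<lambda>s. v s \<bullet> v s)"

lemma len_deriv: "0 \<le> t \<Longrightarrow> (len has_real_derivative norm (v t)) (at t within {0..})"
  unfolding len_def by (rule integral_has_real_derivative_atLeast) (auto intro!: continuous_intros v_cont)

lemma energy_deriv: "0 \<le> t \<Longrightarrow> (energy has_real_derivative v t \<bullet> v t) (at t within {0..})"
  unfolding energy_def by (rule integral_has_real_derivative_atLeast) (auto intro!: continuous_intros
      v_cont)

lemma energy_mono: "0 \<le> a \<Longrightarrow> a \<le> b \<Longrightarrow> energy a \<le> energy b"
  using has_real_derivative_nonpos_imp_le[of a b "{0..}" "\<lambda>t. - energy t" "\<lambda>t. - (v t \<bullet> v t)"]
  by (force intro: derivative_intros energy_deriv)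

lemma len_mono: "0 \<le> a \<Longrightarrow> a \<le> b \<Longrightarrow> len a \<le> len b"
  using has_real_derivative_nonpos_imp_le[of a b "{0..}" "\<lambda>t. - len t" "\<lambda>t. - norm (v t)"]
  by (force intro: derivative_intros len_deriv)

text \<open>The velocity solves the variational equation, so the exact pullback of the form sends
  \<open>v t\<close> to the delayed energy density. The error is uniform in time and proportional to
  the speed, so that it integrates to a multiple of \<open>len\<close>.\<close>

lemma euler_form_approx:
  assumes tau: "0 < \<tau>" and eps: "0 < \<epsilon>"
  shows "\<exists>N. \<forall>n\<ge>N. \<forall>t\<ge>0.
    \<bar>euler_form (\<tau> / n) n (y t) (v t) - v (t + \<tau>) \<bullet> v (t + \<tau>)\<bar> \<le> \<epsilon> * norm (v t)"
proof -
  define C where "C = \<tau>\<^sup>2 * M * exp (L * \<tau>) * exp (\<Lambda> * \<tau>)"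
  have M0: "0 \<le> M" using L_pos B_pos V_pos by (simp add: M_def)
  have C0: "0 \<le> C" using M0 by (simp add: C_def)
  \<comment> \<open>The three summands serve, in this order, for step size at most 1, for
    \<open>e \<le> 1\<close>, and for the final factor \<epsilon>.\<close>
  obtain N :: nat where N: "\<tau> + C * V + (L * (V + 1) + V) * C / \<epsilon> < N"
    using reals_Archimedean2 by blast
  have LV: "0 \<le> L * (V + 1) + V" using L_pos V_pos by simp
  have CV: "0 \<le> C * V" "0 \<le> (L * (V + 1) + V) * C / \<epsilon>"
    using C0 V_pos LV eps by simp_all
  show ?thesis
  proof (intro exI[of _ N] allI impI)
    fix n t :: real and m assume "N \<le> m" and t: "0 \<le> t"
    have n: "real N \<le> real m" using \<open>N \<le> m\<close> by simp
    define h where "h = \<tau> / m"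
    have m0: "0 < real m" using n N CV tau by linarith
    have h: "0 \<le> h" "h \<le> 1"
      using tau n N CV m0 by (auto simp: h_def divide_le_eq)
    have mh: "real m * h = \<tau>" using m0 by (simp add: h_def)
    define S where "S = exp (L * \<tau>) * norm (v t)"
    have S: "norm (v r) \<le> S" if "t \<le> r" "r \<le> t + m * h" for r
    proof -
      have "norm (v r) \<le> exp (L * (r - t)) * norm (v t)" using v_growth[OF t, of "r - t"] that by simp
      also have "\<dots> \<le> S" unfolding S_def
        using that L_pos mh by (intro mult_right_mono) auto
      finally show ?thesis .
    qed
    obtain p q where pq: "euler_form h m (y t) (v t) = F p \<bullet> q"
      and e: "norm (p - y (t + m * h)) + norm (q - v (t + m * h)) \<le> (0 + m * (M * h\<^sup>2 * S)) * exp (\<Lambda> *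
          (m * h))"
      using euler_global_error[OF h t, of 0 S "y t" "v t" m] S by (auto simp: S_def)
    define e where "e = C * norm (v t) / m"
    have "(0 + m * (M * h\<^sup>2 * S)) * exp (\<Lambda> * (m * h)) = e"
      using m0 by (simp add: mh e_def C_def S_def) (simp add: h_def power2_eq_square)
    with e mh have e: "norm (p - y (t + \<tau>)) + norm (q - v (t + \<tau>)) \<le> e" by simp
    have "C * norm (v t) \<le> C * V" using C0 v_bound[OF t] by (intro mult_left_mono) auto
    then have "e \<le> 1" using n N CV tau m0 by (simp add: e_def divide_le_eq)
    have tt: "0 \<le> t + \<tau>" using t tau by simp
    have "norm q \<le> norm (v (t + \<tau>)) + norm (q - v (t + \<tau>))"
      by (metis add.commute diff_add_cancel norm_triangle_ineq)
    then have q: "norm q \<le> V + 1"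
      using v_bound[OF tt] e \<open>e \<le> 1\<close> norm_ge_zero[of "p - y (t + \<tau>)"] by linarith
    have "F p \<bullet> q - v (t + \<tau>) \<bullet> v (t + \<tau>) = (F p - F (y (t + \<tau>))) \<bullet> q + v (t + \<tau>) \<bullet> (q - v (t + \<tau>))"
      by (simp add: v_def inner_diff)
    then have "\<bar>F p \<bullet> q - v (t + \<tau>) \<bullet> v (t + \<tau>)\<bar>
        \<le> norm (F p - F (y (t + \<tau>))) * norm q + norm (v (t + \<tau>)) * norm (q - v (t + \<tau>))"
      using Cauchy_Schwarz_ineq2[of "F p - F (y (t + \<tau>))" q]
        Cauchy_Schwarz_ineq2[of "v (t + \<tau>)" "q - v (t + \<tau>)"] by linarith
    also have "\<dots> \<le> (L * norm (p - y (t + \<tau>))) * (V + 1) + V * norm (q - v (t + \<tau>))"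
      using q v_bound[OF tt] L_pos V_pos by (intro add_mono mult_mono F_lipschitz) auto
    also have "\<dots> \<le> (L * e) * (V + 1) + V * e"
      using e L_pos V_pos order_trans[OF le_add_same_cancel1[THEN iffD2] e]
        order_trans[OF le_add_same_cancel2[THEN iffD2] e]
      by (intro add_mono mult_right_mono mult_left_mono) auto
    also have "\<dots> = ((L * (V + 1) + V) * C / m) * norm (v t)"
      by (simp add: e_def add_divide_distrib algebra_simps)
    also have "\<dots> \<le> \<epsilon> * norm (v t)"
    proof (rule mult_right_mono)
      have "(L * (V + 1) + V) * C / \<epsilon> \<le> m" using n N CV tau by linarith
      then show "(L * (V + 1) + V) * C / m \<le> \<epsilon>"
        using eps m0 by (simp add: divide_le_eq mult.commute)
    qed simp
    finally show "\<bar>euler_form (\<tau> / m) m (y t) (v t) - v (t + \<tau>) \<bullet> v (t + \<tau>)\<bar> \<le> \<epsilon> * norm (v t)"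
      by (simp add: pq flip: h_def)
  qed
qed

text \<open>Half of \<epsilon> pays for the defect of the potential, which is small for large
  \<tau>; the other half pays for the Euler discretization, which is small for large
  \<open>n\<close>. The potential is bounded along the orbit and enters the constant.\<close>

lemma energy_le_len:
  assumes eps: "0 < \<epsilon>"
  shows "\<exists>C. \<forall>T\<ge>0. energy T \<le> \<epsilon> * len T + C"
proof -
  obtain \<tau> where tau: "0 < \<tau>" and small: "2 * L * K * exp (- \<eta> * \<tau> / 2) \<le> \<epsilon> / 2"
  proof -
    \<comment> \<open>From \<open>exp x \<ge> x\<close>, the exponential of
      \<open>\<eta> * \<tau> / 2\<close> is at least \<open>4 * L * K / \<epsilon>\<close>.\<close>
    define \<tau> where "\<tau> = 4 * (2 * L * K) / (\<epsilon> * \<eta>) + 1"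
    have LK: "0 \<le> 2 * L * K" using L_pos K_nonneg by simp
    have tau: "0 < \<tau>" using LK eps eta_pos by (auto simp: \<tau>_def intro!: add_nonneg_pos)
    have "\<eta> * \<tau> / 2 \<le> exp (\<eta> * \<tau> / 2)" using exp_ge_add_one_self[of "\<eta> * \<tau> / 2"] by linarith
    moreover have "\<eta> * \<tau> / 2 \<ge> 2 * (2 * L * K) / \<epsilon>"
      using eps eta_pos by (simp add: \<tau>_def field_simps)
    ultimately have "2 * (2 * L * K) / \<epsilon> \<le> exp (\<eta> * \<tau> / 2)" by linarith
    then have "2 * L * K * exp (- (\<eta> * \<tau> / 2)) \<le> \<epsilon> / 2"
      using eps by (simp add: exp_minus field_simps)
    then show ?thesis using that[OF tau] by simp
  qed
  obtain N where N: "\<And>n t. N \<le> n \<Longrightarrow> 0 \<le> t \<Longrightarrow>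
      \<bar>euler_form (\<tau> / n) n (y t) (v t) - v (t + \<tau>) \<bullet> v (t + \<tau>)\<bar> \<le> \<epsilon> / 2 * norm (v t)"
    using euler_form_approx[OF tau, of "\<epsilon> / 2"] eps by auto
  obtain n :: nat where n: "N + \<tau> * L\<^sup>2 * 2 / \<eta> + \<tau> * \<eta> < n" using reals_Archimedean2 by blast
  have nn: "0 \<le> \<tau> * L\<^sup>2 * 2 / \<eta>" "0 < \<tau> * \<eta>" using tau eta_pos by simp_all
  have n0: "0 < real n" and nN: "N \<le> n" using n nn by linarith+
  define h where "h = \<tau> / n"
  have "\<tau> * L\<^sup>2 * 2 / \<eta> \<le> n" "\<tau> * \<eta> \<le> n" using n nn by linarith+
  then have h: "0 \<le> h" "h * L\<^sup>2 \<le> \<eta> / 2" "h * \<eta> \<le> 1"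
    using tau n0 eta_pos by (simp_all add: h_def field_simps)
  define c where "c = 2 * L * (1 - \<eta> * h / 2) ^ n"
  have w0: "0 \<le> 1 - \<eta> * h / 2" using h(3) by (simp add: mult.commute)
  then have c0: "0 \<le> c" using L_pos by (simp add: c_def)
  have "(1 - \<eta> * h / 2) ^ n \<le> exp (- \<eta> * h / 2) ^ n"
    using exp_ge_add_one_self[of "- \<eta> * h / 2"] w0 by (intro power_mono) auto
  also have "\<dots> = exp (- \<eta> * \<tau> / 2)"
    using n0 by (simp add: h_def flip: exp_of_nat_mult)
  finally have "c * K \<le> (2 * L * exp (- \<eta> * \<tau> / 2)) * K"
    unfolding c_def using L_pos K_nonneg by (intro mult_right_mono mult_left_mono) auto
  then have cK: "c * K \<le> \<epsilon> / 2" using small by (simp add: mult_ac)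
  obtain A where A: "one_form (euler_form h n) A c"
    using one_form_euler_form[OF h] unfolding c_def by blast
  define pot where "pot = (\<lambda>t. integral {0..1} (\<lambda>\<sigma>. euler_form h n (\<sigma> *\<^sub>R y t) (y t)))"
  have "\<exists>D. (pot has_real_derivative D) (at t within {0..}) \<and>
      \<bar>D - euler_form h n (y t) (v t)\<bar> \<le> c * (norm (y t) * norm (v t))" if "0 \<le> t" for t
    unfolding pot_def by (rule one_form_potential[OF A c0 y_deriv_v v_cont that])
  then obtain D where D: "\<And>t. 0 \<le> t \<Longrightarrow> (pot has_real_derivative D t) (at t within {0..})"
    and Db: "\<And>t. 0 \<le> t \<Longrightarrow> \<bar>D t - euler_form h n (y t) (v t)\<bar> \<le> c * (norm (y t) * norm (v t))"
    by metis
  have key: "v (t + \<tau>) \<bullet> v (t + \<tau>) \<le> D t + \<epsilon> * norm (v t)" if t: "0 \<le> t" for t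
  proof -
    have "c * (norm (y t) * norm (v t)) \<le> (c * K) * norm (v t)"
      using c0 y_bound[OF t] by (simp add: mult.assoc mult_left_mono mult_right_mono)
    also have "\<dots> \<le> \<epsilon> / 2 * norm (v t)" using cK by (rule mult_right_mono) simp
    finally show ?thesis using Db[OF t] N[OF nN t] unfolding h_def[symmetric] abs_le_iff
      by (simp add: field_simps)
  qed
  have ac: "continuous_on UNIV (\<lambda>(x, u). euler_form h n x u)"
    using A by (intro continuous_at_imp_continuous_on) (auto simp: one_form_def intro:
        has_derivative_continuous)
  have "compact ((\<lambda>(x, u). euler_form h n x u) ` (cball 0 K \<times> cball 0 K))"
    by (intro compact_continuous_image continuous_on_subset[OF ac] compact_Times) auto
  then obtain P where "\<And>z. z \<in> (\<lambda>(x, u). euler_form h n x u) ` (cball 0 K \<times> cball 0 K) \<Longrightarrow> norm z \<le> P"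
    using compact_imp_bounded bounded_iff by metis
  then have P: "\<bar>euler_form h n x u\<bar> \<le> P" if "norm x \<le> K" "norm u \<le> K" for x u
    using that by (force simp: image_iff)
  have pot: "\<bar>pot t\<bar> \<le> P" if t: "0 \<le> t" for t
  proof -
    have i: "(\<lambda>\<sigma>. euler_form h n (\<sigma> *\<^sub>R y t) (y t)) integrable_on {0..1}"
      by (intro integrable_continuous_real continuous_on_compose2[OF ac, of _ "\<lambda>\<sigma>. (\<sigma> *\<^sub>R y t, y t)",
          simplified])
         (auto intro!: continuous_intros)
    have "norm (pot t) \<le> P * measure lborel {0..1::real}"
      unfolding pot_def
    proof (rule has_integral_bound_real[OF _ _ integrable_integral[OF i]])
      show "0 \<le> P" using P[of 0 0] K_nonneg by simp
      fix \<sigma> :: real assume "\<sigma> \<in> {0..1} - {}"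
      then have "norm (\<sigma> *\<^sub>R y t) \<le> 1 * K"
        using y_bound[OF t] by (simp only: norm_scaleR) (intro mult_mono, auto)
      then show "norm (euler_form h n (\<sigma> *\<^sub>R y t) (y t)) \<le> P" using P[OF _ y_bound[OF t]] by simp
    qed simp
    then show ?thesis by simp
  qed
  \<comment> \<open>The delay costs \<open>energy \<tau>\<close>, and the potential costs
    \<open>P\<close> at either end of the time interval.\<close>
  show ?thesis
  proof (intro exI[of _ "energy \<tau> + 2 * P"] allI impI)
    fix T :: real assume T: "0 \<le> T"
    have "energy (T + \<tau>) - pot T - \<epsilon> * len T \<le> energy (0 + \<tau>) - pot 0 - \<epsilon> * len 0"
    proof (rule has_real_derivative_nonpos_imp_le[of 0 T "{0..}"
          "\<lambda>t. energy (t + \<tau>) - pot t - \<epsilon> * len t" "\<lambda>t. v (t + \<tau>) \<bullet> v (t + \<tau>) - D t - \<epsilon> * norm (v t)"])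
      fix t assume t: "t \<in> {0..T}"
      have "((\<lambda>t. energy (t + \<tau>)) has_real_derivative (v (t + \<tau>) \<bullet> v (t + \<tau>)) * 1) (at t within {0..})"
      proof (rule DERIV_chain2[where f = energy and g = "\<lambda>t. t + \<tau>"])
        show "(energy has_real_derivative v (t + \<tau>) \<bullet> v (t + \<tau>)) (at (t + \<tau>))"
          using energy_deriv[of "t + \<tau>"] t tau at_within_interior[of "t + \<tau>" "{0..}"] by simp
      qed (auto intro!: derivative_eq_intros)
      then have e: "((\<lambda>t. energy (t + \<tau>)) has_real_derivative v (t + \<tau>) \<bullet> v (t + \<tau>)) (at t within
          {0..})" by simp
      show "((\<lambda>t. energy (t + \<tau>) - pot t - \<epsilon> * len t) has_real_derivative
          v (t + \<tau>) \<bullet> v (t + \<tau>) - D t - \<epsilon> * norm (v t)) (at t within {0..})"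
        using t by (auto intro!: derivative_eq_intros e D len_deriv)
    next
      show "v (t + \<tau>) \<bullet> v (t + \<tau>) - D t - \<epsilon> * norm (v t) \<le> 0" if "0 < t" for t
        using key[of t] that by simp
    qed (use T in auto)
    moreover have "energy T \<le> energy (T + \<tau>)" using T tau by (intro energy_mono) auto
    moreover have "len 0 = 0" by (simp add: len_def)
    ultimately show "energy T \<le> \<epsilon> * len T + (energy \<tau> + 2 * P)"
      using pot[OF T] pot[of 0] by (simp add: abs_le_iff)
  qed
qed

end

section \<open>Slow arcs\<close>

lemma continuous_nonzero_same_sign:
  fixes f :: "real \<Rightarrow> real"
  assumes "continuous_on {a..b} f" "\<And>t. t \<in> {a..b} \<Longrightarrow> f t \<noteq> 0"
  shows "(\<forall>t\<in>{a..b}. 0 < f t) \<or> (\<forall>t\<in>{a..b}. f t < 0)"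
proof (rule ccontr)
  assume "\<not> ?thesis"
  then obtain s t where st: "s \<in> {a..b}" "t \<in> {a..b}" "f s \<le> 0" "0 \<le> f t" by force
  have "connected (f ` {a..b})" using assms(1) by (intro connected_continuous_image) auto
  then have "0 \<in> f ` {a..b}"
    by (rule connectedD_interval[of _ "f s" "f t"]) (use st in auto)
  then show False using assms(2) by auto
qed

text \<open>The function \<open>g\<close> is bounded, but it changes at a rate comparable to the
  speed when the velocity is almost an eigenvector of \<open>J\<close> with eigenvalue at least
  -\<eta>/12. Along such motion the variation of \<open>g\<close> controls the length.\<close>

locale separating_functional = bounded_orbit F J H L B \<eta> y K
  for F :: "'a::euclidean_space \<Rightarrow> 'a" and J H L B \<eta> y K +
  fixes g :: "'a \<Rightarrow> real" and dg :: "'a \<Rightarrow> 'a \<Rightarrow> real" and G c \<delta> :: real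
  assumes g_deriv: "(g has_derivative dg x) (at x)"
    and dg_cont: "continuous_on UNIV (\<lambda>(x, u). dg x u)"
    and g_bound: "\<bar>g x\<bar> \<le> G"
    and c_pos: "0 < c" and delta_pos: "0 < \<delta>"
    and dg_expands: "norm (J x u - \<rho> *\<^sub>R u) \<le> \<delta> * norm u \<Longrightarrow> - \<eta> / 12 \<le> \<rho> \<Longrightarrow> c * norm u \<le> \<bar>dg x u\<bar>"

text \<open>Without equilibria on the orbit, growth rate and curvature are defined at all
  times.\<close>

locale moving_orbit = separating_functional +
  assumes v_nonzero: "0 \<le> t \<Longrightarrow> F (y t) \<noteq> 0"
begin

lemma v_pos: "0 \<le> t \<Longrightarrow> 0 < v t \<bullet> v t"
  using v_nonzero by (simp add: v_def)

lemma acc_cont: "continuous_on {0..} acc"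
  using acc_deriv by (auto simp: continuous_on_eq_continuous_within intro: has_vector_derivative_continuous)

text \<open>\<open>\<rho>\<close> is the growth rate of the speed, and \<open>R / S\<close> is the squared curvature of the orbit.\<close>

definition \<rho> :: "real \<Rightarrow> real" where "\<rho> t = (v t \<bullet> acc t) / (v t \<bullet> v t)"
definition R :: "real \<Rightarrow> real" where "R t = gram (v t) (acc t)"
definition S :: "real \<Rightarrow> real" where "S t = (v t \<bullet> v t) ^ 3"
definition n :: "real \<Rightarrow> 'a" where "n t = acc t - \<rho> t *\<^sub>R v t"

lemma S_pos: "0 \<le> t \<Longrightarrow> 0 < S t"
  using v_pos by (simp add: S_def)

lemma R_nonneg: "0 \<le> R t"
  by (simp add: R_def gram_nonneg)

lemma v_acc: "0 \<le> t \<Longrightarrow> v t \<bullet> acc t = \<rho> t * (v t \<bullet> v t)"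
  using v_pos[of t] by (simp add: \<rho>_def)

lemma v_n: "0 \<le> t \<Longrightarrow> v t \<bullet> n t = 0"
  by (simp add: n_def inner_diff_right v_acc)

lemma acc_n: "acc t = \<rho> t *\<^sub>R v t + n t"
  by (simp add: n_def)

lemma R_n: "0 \<le> t \<Longrightarrow> R t = (v t \<bullet> v t) * (n t \<bullet> n t)"
  using v_n[of t] by (simp add: R_def acc_n gram_shear) (simp add: gram_def)

lemma rho_le: "0 \<le> t \<Longrightarrow> \<rho> t \<le> L"
proof -
  assume t: "0 \<le> t"
  have "v t \<bullet> acc t \<le> norm (v t) * (L * norm (v t))"
    unfolding acc_def by (intro order_trans[OF norm_cauchy_schwarz] mult_left_mono J_bound) auto
  then show ?thesis
    using v_pos[OF t] by (simp add: \<rho>_def divide_le_eq dot_square_norm power2_eq_square mult_ac)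
qed

lemma vv_deriv: "0 \<le> t \<Longrightarrow> ((\<lambda>t. v t \<bullet> v t) has_real_derivative 2 * \<rho> t * (v t \<bullet> v t)) (at t within {0..})"
  by (intro DERIV_cong[OF has_real_derivative_inner[OF v_deriv v_deriv]])
     (auto simp: inner_commute[of "acc t" "v t"] v_acc)

lemma S_deriv: "0 \<le> t \<Longrightarrow> (S has_real_derivative 6 * \<rho> t * S t) (at t within {0..})"
  unfolding S_def by (rule derivative_eq_intros vv_deriv refl | assumption)+ (simp add: power3_eq_cube
      power2_eq_square)

lemma speed_deriv: "0 \<le> t \<Longrightarrow> ((\<lambda>t. norm (v t)) has_real_derivative \<rho> t * norm (v t)) (at t within {0..})"
proof -
  assume t: "0 \<le> t"
  have 1: "((\<lambda>t. sqrt (v t \<bullet> v t)) has_real_derivative inverse (sqrt (v t \<bullet> v t)) / 2 * (2 * \<rho> t * (v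
      t \<bullet> v t))) (at t within {0..})"
    using DERIV_chain2[OF DERIV_real_sqrt vv_deriv] v_pos t by auto
  have 2: "inverse (sqrt (v t \<bullet> v t)) / 2 * (2 * \<rho> t * (v t \<bullet> v t)) = \<rho> t * sqrt (v t \<bullet> v t)"
    using v_pos[OF t] by (simp add: field_simps)
  show ?thesis unfolding norm_eq_sqrt_inner by (rule DERIV_cong[OF 1 2])
qed

text \<open>The velocity solves the variational equation and the acceleration solves it up to the
  forcing \<open>H (y t) (v t) (v t)\<close>. Contraction of squared area gives the rate
  \<open>- 2 * \<eta>\<close>; one \<eta> is spent on the forcing, whose remainder has the order of
  \<open>S\<close>.\<close>

lemma R_deriv:
  assumes t: "0 \<le> t"
  shows "\<exists>D. (R has_real_derivative D) (at t within {0..}) \<and> D \<le> - \<eta> * R t + B\<^sup>2 / \<eta> * S t"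
proof -
  define w where "w = H (y t) (v t) (v t)"
  define j where "j = J (y t) (acc t)"
  define s where "s = v t \<bullet> v t"
  have s: "0 < s" using v_pos[OF t] by (simp add: s_def)
  have va: "((\<lambda>t. v t \<bullet> acc t) has_real_derivative v t \<bullet> (w + j) + acc t \<bullet> acc t) (at t within {0..})"
    using has_real_derivative_inner[OF v_deriv[OF t] acc_deriv[OF t]] by (simp add: w_def j_def)
  have aa: "((\<lambda>t. acc t \<bullet> acc t) has_real_derivative acc t \<bullet> (w + j) + (w + j) \<bullet> acc t) (at t within {0..})"
    using has_real_derivative_inner[OF acc_deriv[OF t] acc_deriv[OF t]] by (simp add: w_def j_def)
  define D where "D = 2 * (s * (acc t \<bullet> j) - (v t \<bullet> acc t) * (v t \<bullet> j)) + 2 * (s * (acc t \<bullet> w) - (v t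
      \<bullet> acc t) * (v t \<bullet> w))"
  have "(R has_real_derivative D) (at t within {0..})"
    unfolding R_def gram_def D_def s_def
    by (rule derivative_eq_intros vv_deriv[OF t] va aa refl)+
       (simp add: inner_add inner_commute v_acc[OF t] algebra_simps)
  moreover have "D \<le> - \<eta> * R t + B\<^sup>2 / \<eta> * S t"
  proof -
    have J: "J (y t) (v t) = acc t" by (simp add: acc_def)
    have 1: "s * (acc t \<bullet> j) - (v t \<bullet> acc t) * (v t \<bullet> j) \<le> - \<eta> * R t"
      using trace_gram[of "v t" "acc t" "y t"]
      by (simp add: J R_def s_def j_def algebra_simps inner_commute)
    \<comment> \<open>The area spanned with \<open>v t\<close> sees only the normal part
      \<open>n t\<close> of the acceleration, so the forcing is paired with
      \<open>n t\<close>.\<close>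
    have e: "s * (acc t \<bullet> w) - (v t \<bullet> acc t) * (v t \<bullet> w) = s * (n t \<bullet> w)"
      by (simp add: n_def inner_diff_left v_acc[OF t] s_def algebra_simps)
    have "n t \<bullet> w \<le> norm (n t) * (B * norm (v t) * norm (v t))"
      unfolding w_def by (intro order_trans[OF norm_cauchy_schwarz] mult_left_mono H_bound) auto
    also have "\<dots> = norm (n t) * (B * s)"
      by (simp add: s_def dot_square_norm power2_eq_square)
    finally have nw: "n t \<bullet> w \<le> norm (n t) * (B * s)" .
    have sq: "2 * (norm (n t) * (B * s)) \<le> \<eta> * (norm (n t))\<^sup>2 + (B * s)\<^sup>2 / \<eta>"
    proof -
      have "0 \<le> (\<eta> * norm (n t) - B * s)\<^sup>2 / \<eta>" using eta_pos by simp
      then show ?thesis using eta_pos by (simp add: power2_eq_square field_simps)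
    qed
    have "2 * (s * (n t \<bullet> w)) \<le> s * (2 * (norm (n t) * (B * s)))"
      using mult_left_mono[OF nw, of s] s by simp
    also have "\<dots> \<le> s * (\<eta> * (norm (n t))\<^sup>2 + (B * s)\<^sup>2 / \<eta>)"
      using sq s by (intro mult_left_mono) auto
    also have "\<dots> = \<eta> * R t + B\<^sup>2 / \<eta> * S t"
      unfolding R_n[OF t] S_def s_def[symmetric] power2_norm_eq_inner
      by (simp add: power2_eq_square power3_eq_cube algebra_simps)
    finally have "2 * (s * (n t \<bullet> w)) \<le> \<eta> * R t + B\<^sup>2 / \<eta> * S t" .
    moreover have "2 * a + 2 * b \<le> - r + q" if "a \<le> - r" "2 * b \<le> r + q" for a b r q :: real
      using that by linarith
    ultimately show ?thesis unfolding D_def e using 1 by simp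
  qed
  ultimately show ?thesis by blast
qed

text \<open>In the derivative of the quotient the terms quadratic in \<rho> cancel. The rest is the
  forcing, a term with \<open>J (y t) (n t)\<close>, and the nonnegative
  \<open>n t \<bullet> n t\<close>. A curvature bound \<open>C\<close> gives
  \<open>norm (n t) \<le> C * s\<close>, so \<rho> falls by at most \<open>L * C + B\<close> per
  unit of length.\<close>

lemma rho_deriv:
  assumes t: "0 \<le> t" and R: "R t \<le> C\<^sup>2 * S t" and C: "0 \<le> C"
  shows "\<exists>D. (\<rho> has_real_derivative D) (at t within {0..}) \<and> - (L * C + B) * norm (v t) \<le> D"
proof -
  define w where "w = H (y t) (v t) (v t)"
  define s where "s = v t \<bullet> v t"
  have s: "0 < s" using v_pos[OF t] by (simp add: s_def)
  have ns: "s = norm (v t) * norm (v t)" by (simp add: s_def dot_square_norm power2_eq_square)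
  define X where "X = v t \<bullet> (w + J (y t) (acc t)) + acc t \<bullet> acc t"
  have va: "((\<lambda>t. v t \<bullet> acc t) has_real_derivative X) (at t within {0..})"
    using has_real_derivative_inner[OF v_deriv[OF t] acc_deriv[OF t]] by (simp add: w_def X_def)
  define D where "D = (X - 2 * \<rho> t * (\<rho> t * s)) / s"
  have "((\<lambda>t. (v t \<bullet> acc t) / (v t \<bullet> v t)) has_real_derivative (X * s - (v t \<bullet> acc t) * (2 * \<rho> t * s))
      / (s * s)) (at t within {0..})"
    unfolding s_def by (rule DERIV_divide[OF va vv_deriv[OF t]]) (use s in \<open>simp add: s_def\<close>)
  moreover have "(X * s - (v t \<bullet> acc t) * (2 * \<rho> t * s)) / (s * s) = D"
    using s by (simp add: D_def v_acc[OF t] s_def[symmetric] field_simps)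
  ultimately have "(\<rho> has_real_derivative D) (at t within {0..})"
    by (simp add: \<rho>_def[abs_def])
  moreover have "- (L * C + B) * norm (v t) \<le> D"
  proof -
    have JJ: "J (y t) (acc t) = \<rho> t *\<^sub>R acc t + J (y t) (n t)"
      by (subst acc_n) (simp add: J_simps acc_def)
    have X: "X = v t \<bullet> w + \<rho> t * (\<rho> t * s) + v t \<bullet> J (y t) (n t) + acc t \<bullet> acc t"
      by (simp add: X_def JJ inner_add_right v_acc[OF t] s_def)
    have aa: "acc t \<bullet> acc t = \<rho> t * (\<rho> t * s) + n t \<bullet> n t"
      using v_n[OF t] by (simp add: acc_n inner_add inner_commute[of "n t" "v t"] s_def)
    have D: "D = (v t \<bullet> w + v t \<bullet> J (y t) (n t) + n t \<bullet> n t) / s"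
      by (simp add: D_def X aa)
    have "s * (norm (n t))\<^sup>2 \<le> s * (C * s)\<^sup>2"
      using R unfolding R_n[OF t] S_def s_def[symmetric] power2_norm_eq_inner
      by (simp add: power2_eq_square power3_eq_cube algebra_simps)
    then have "norm (n t) \<le> C * s"
      using s C by (intro power2_le_imp_le[of "norm (n t)"]) auto
    then have "L * norm (n t) \<le> L * (C * s)" using L_pos by (intro mult_left_mono) auto
    then have "norm (v t) * norm (J (y t) (n t)) \<le> norm (v t) * (L * (C * s))"
      using J_bound[of "y t" "n t"] by (intro mult_left_mono) auto
    then have a: "- (norm (v t) * (L * C) * s) \<le> v t \<bullet> J (y t) (n t)"
      using Cauchy_Schwarz_ineq2[of "v t" "J (y t) (n t)"] by (simp add: mult_ac)
    have "norm (v t) * norm w \<le> norm (v t) * (B * s)"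
      unfolding w_def ns using H_bound[of "y t" "v t" "v t"] by (intro mult_left_mono) (auto simp: mult_ac)
    then have b: "- (norm (v t) * B * s) \<le> v t \<bullet> w"
      using Cauchy_Schwarz_ineq2[of "v t" w] by (simp add: mult_ac)
    have "- (L * C + B) * norm (v t) * s \<le> v t \<bullet> w + v t \<bullet> J (y t) (n t) + n t \<bullet> n t"
    proof -
      have "- (L * C + B) * norm (v t) * s = - (norm (v t) * (L * C) * s) + - (norm (v t) * B * s)"
        by (simp add: algebra_simps)
      then show ?thesis using a b inner_ge_zero[of "n t"] by linarith
    qed
    then show ?thesis using s by (simp add: D le_divide_eq)
  qed
  ultimately show ?thesis by blast
qed

end

section \<open>Either the speed decays or the curvature stays bounded\<close>

context moving_orbit
begin

definition C1 :: real where "C1 = B\<^sup>2 / \<eta>"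
definition N :: real where "N = (\<eta> / 8) / C1"
text \<open>Each summand provides one of the inequalities in \<open>C0_ge\<close>: the first makes
  \<open>R \<le> C0 * S\<close> persist, the second makes \<open>Y\<close> decay while this bound is
  violated.\<close>

definition C0 :: real where "C0 = 2 * C1 / \<eta> + (3 * \<eta> / 8 + 6 * L) * 4 / (3 * \<eta> * N)"

lemma consts_pos: "0 < C1" "0 < N" "0 < C0"
  using B_pos eta_pos L_pos by (auto simp: C1_def N_def C0_def intro!: add_pos_pos)

lemma C0_ge: "2 * C1 \<le> \<eta> * C0" "3 * \<eta> / 8 + 6 * L \<le> 3 * \<eta> / 4 * N * C0"
proof -
  have "0 \<le> (3 * \<eta> / 8 + 6 * L) * 4 / (3 * \<eta> * N)" using eta_pos L_pos consts_pos by simp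
  then have "\<eta> * (2 * C1 / \<eta>) \<le> \<eta> * C0" using eta_pos by (intro mult_left_mono) (auto simp: C0_def)
  then show "2 * C1 \<le> \<eta> * C0" using eta_pos by simp
  have "0 \<le> 2 * C1 / \<eta>" using eta_pos consts_pos by simp
  then have "3 * \<eta> / 4 * N * ((3 * \<eta> / 8 + 6 * L) * 4 / (3 * \<eta> * N)) \<le> 3 * \<eta> / 4 * N * C0"
    using eta_pos consts_pos by (intro mult_left_mono) (auto simp: C0_def)
  then show "3 * \<eta> / 8 + 6 * L \<le> 3 * \<eta> / 4 * N * C0"
    using eta_pos consts_pos by simp
qed

text \<open>\<open>N\<close> and \<open>C0\<close> are chosen such that \<open>Y\<close> below, hence also the speed, decays exponentially until the
  orbit is good.  Along a slow orbit goodness then persists with \<open>- \<eta> / 12\<close> in place of \<open>- \<eta> / 16\<close>.\<close>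

definition good :: "real \<Rightarrow> bool" where
  "good t \<longleftrightarrow> R t \<le> C0 * S t \<and> - \<eta> / 16 \<le> \<rho> t"

definition Y :: "real \<Rightarrow> real" where "Y t = N * R t + S t"

text \<open>Goodness can fail in two ways. If the curvature is large, the decay of
  \<open>N * R\<close> outweighs the growth of \<open>S\<close>, whose rate is at most
  \<open>6 * L\<close>. If \<rho> is below -\<eta>/16, then \<open>S\<close> decays at the rate
  3\<eta>/8, of which \<eta>/8 pays for the forcing in \<open>R\<close>.\<close>

lemma Y_deriv_bad:
  assumes t: "0 \<le> t" and bad: "\<not> good t" and D: "D \<le> - \<eta> * R t + C1 * S t"
  shows "N * D + 6 * \<rho> t * S t \<le> - (\<eta> / 4) * Y t"
proof -
  have S: "0 < S t" and R: "0 \<le> R t" using S_pos[OF t] R_nonneg by auto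
  have "N * D \<le> N * (- \<eta> * R t + C1 * S t)" using D consts_pos by (intro mult_left_mono) auto
  also have "\<dots> = - \<eta> * (N * R t) + \<eta> / 8 * S t"
    using consts_pos by (simp add: N_def field_simps)
  finally have ND: "N * D \<le> - \<eta> * (N * R t) + \<eta> / 8 * S t" .
  show ?thesis
  proof (cases "C0 * S t < R t")
    case True
    have "\<rho> t * S t \<le> L * S t" using rho_le[OF t] S by (intro mult_right_mono) auto
    moreover have "(3 * \<eta> / 8 + 6 * L) * S t \<le> 3 * \<eta> / 4 * N * C0 * S t"
      using C0_ge S by (intro mult_right_mono) auto
    moreover have "(3 * \<eta> / 4 * N) * (C0 * S t) \<le> (3 * \<eta> / 4 * N) * R t"
      using True eta_pos consts_pos by (intro mult_left_mono) auto
    ultimately show ?thesis using ND by (simp add: Y_def algebra_simps)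
  next
    case False
    then have "\<rho> t \<le> - \<eta> / 16" using bad by (auto simp: good_def)
    then have "\<rho> t * S t \<le> - \<eta> / 16 * S t" using S by (intro mult_right_mono) auto
    moreover have "0 \<le> \<eta> * (N * R t)" using eta_pos consts_pos R by simp
    ultimately show ?thesis using ND by (simp add: Y_def algebra_simps)
  qed
qed

text \<open>\<open>S\<close> is the sixth power of the speed and is dominated by \<open>Y\<close>.
  Decay of \<open>Y\<close> at the rate \<eta>/4 is decay of the speed at the rate \<eta>/24, hence
  the integral 24/\<eta>. The root is taken of an upper bound for \<open>Y\<close> along the
  orbit.\<close>

definition len_bad :: real where
  "len_bad = 24 / \<eta> * root 6 (N * L\<^sup>2 * V ^ 4 + V ^ 6)"

lemma len_until_good:
  assumes ab: "0 \<le> a" "a \<le> b" and bad: "\<And>t. a \<le> t \<Longrightarrow> t < b \<Longrightarrow> \<not> good t"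
  shows "len b - len a \<le> len_bad"
proof -
  define Z where "Z = N * L\<^sup>2 * V ^ 4 + V ^ 6"
  define z where "z = root 6 Z"
  have Z0: "0 \<le> Z" using consts_pos V_pos by (simp add: Z_def)
  have z0: "0 \<le> z" using Z0 by (simp add: z_def)
  have z6: "z ^ 6 = Z" using Z0 by (simp add: z_def)
  have "\<forall>t. \<exists>D. 0 \<le> t \<longrightarrow> (R has_real_derivative D) (at t within {0..}) \<and> D \<le> - \<eta> * R t + C1 * S t"
    using R_deriv unfolding C1_def by blast
  then obtain D where D: "\<And>t. 0 \<le> t \<Longrightarrow> (R has_real_derivative D t) (at t within {0..})"
    and Dle: "\<And>t. 0 \<le> t \<Longrightarrow> D t \<le> - \<eta> * R t + C1 * S t" by metis
  have Ya: "Y a \<le> Z"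
  proof -
    have n: "norm (v a) \<le> V" "norm (acc a) \<le> L * V"
      using v_bound[OF ab(1)] J_bound[of "y a" "v a"] mult_left_mono[OF v_bound[OF ab(1)], of L] L_pos
      unfolding acc_def by linarith+
    have "R a \<le> (norm (v a))\<^sup>2 * (norm (acc a))\<^sup>2"
      using gram_le[of "v a" "acc a"] by (simp add: R_def power2_norm_eq_inner)
    also have "\<dots> \<le> V\<^sup>2 * (L * V)\<^sup>2" using n by (intro mult_mono power_mono) auto
    finally have "N * R a \<le> N * (V\<^sup>2 * (L * V)\<^sup>2)" using consts_pos by (intro mult_left_mono) auto
    moreover have "S a \<le> V ^ 6"
    proof -
      have "S a = (norm (v a)) ^ 6"
        by (simp add: S_def power2_norm_eq_inner[symmetric] del: power2_norm_eq_inner flip: power_mult)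
      then show ?thesis using power_mono[OF n(1), of 6] by simp
    qed
    moreover have "N * (V\<^sup>2 * (L * V)\<^sup>2) = N * L\<^sup>2 * V ^ 4"
      by (simp add: power_mult_distrib eval_nat_numeral)
    ultimately show ?thesis by (simp add: Y_def Z_def)
  qed
  have speed: "norm (v t) \<le> z * exp (- \<eta> / 24 * (t - a))" if t: "a < t" "t < b" for t
  proof -
    have "Y t \<le> exp (- (\<eta> / 4) * (t - a)) * Y a"
    proof (rule gronwall_le[of a t "{0..}" Y "\<lambda>s. N * D s + 6 * \<rho> s * S s"])
      show "(Y has_real_derivative N * D s + 6 * \<rho> s * S s) (at s within {0..})" if "s \<in> {a..t}" for s
        unfolding Y_def[abs_def] using that ab by (auto intro!: derivative_eq_intros D S_deriv)
      show "N * D s + 6 * \<rho> s * S s \<le> - (\<eta> / 4) * Y s" if "a < s" "s < t" for s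
        using that ab t by (intro Y_deriv_bad bad Dle) auto
    qed (use t ab in auto)
    also have "\<dots> \<le> exp (- (\<eta> / 4) * (t - a)) * Z" using Ya by simp
    finally have "S t \<le> exp (- (\<eta> / 4) * (t - a)) * Z"
      using consts_pos R_nonneg[of t] by (simp add: Y_def)
        (meson add_increasing mult_nonneg_nonneg less_imp_le order_trans order_refl)
    moreover have "S t = (norm (v t)) ^ 6"
      by (simp add: S_def power2_norm_eq_inner[symmetric] flip: power_mult)
    moreover have "(z * exp (- \<eta> / 24 * (t - a))) ^ 6 = exp (- (\<eta> / 4) * (t - a)) * Z"
      by (simp add: power_mult_distrib z6 flip: exp_of_nat_mult)
    ultimately show ?thesis
      using z0 by (intro power_le_imp_le_base[of "norm (v t)" 5]) auto
  qed
  have "len b + 24 / \<eta> * z * exp (- \<eta> / 24 * (b - a)) \<le> len a + 24 / \<eta> * z * exp (- \<eta> / 24 * (a - a))"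
  proof (rule has_real_derivative_nonpos_imp_le[of a b "{0..}"
        "\<lambda>t. len t + 24 / \<eta> * z * exp (- \<eta> / 24 * (t - a))" "\<lambda>t. norm (v t) - z * exp (- \<eta> / 24 * (t -
            a))"])
    show "((\<lambda>t. len t + 24 / \<eta> * z * exp (- \<eta> / 24 * (t - a))) has_real_derivative
        norm (v t) - z * exp (- \<eta> / 24 * (t - a))) (at t within {0..})" if "t \<in> {a..b}" for t
      using that ab eta_pos by (auto intro!: derivative_eq_intros len_deriv)
    show "norm (v t) - z * exp (- \<eta> / 24 * (t - a)) \<le> 0" if "a < t" "t < b" for t
      using speed[OF that] by simp
  qed (use ab in auto)
  moreover have "0 \<le> 24 / \<eta> * z * exp (- \<eta> / 24 * (b - a))" using z0 eta_pos by simp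
  ultimately show ?thesis by (simp add: len_bad_def z_def Z_def)
qed

text \<open>While \<rho> is below -\<eta>/16, the decay of \<open>\<kappa> * norm (v t)\<close>
  compensates the largest possible fall of \<rho>. In \<open>\<theta>\<close>, the first entry gives
  \<open>\<kappa> * \<theta> \<le> \<eta> / 96\<close>, half of the gap between -\<eta>/16 and
  -\<eta>/12; the second makes the velocity an eigenvector up to the relative error
  \<delta>.\<close>

definition \<kappa> :: real where "\<kappa> = (L * sqrt C0 + B) * 16 / \<eta>"
definition \<theta> :: real where "\<theta> = min (\<eta> / (96 * \<kappa>)) (\<delta> / sqrt C0)"

lemma kappa_pos: "0 < \<kappa>"
  using L_pos B_pos eta_pos consts_pos by (auto simp: \<kappa>_def intro!: divide_pos_pos add_pos_pos)

lemma theta_pos: "0 < \<theta>"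
  using kappa_pos eta_pos delta_pos consts_pos by (simp add: \<theta>_def)

text \<open>For \<rho> at least -\<eta>/12 the rate of decay of \<open>S\<close> is at most
  \<eta>/2. \<open>R\<close> decays at the rate \<eta> up to the forcing \<open>C1 * S\<close>, so
  it cannot overtake \<open>C0 * S\<close>.\<close>

lemma curvature_stays_bounded:
  assumes m: "0 \<le> m" "m \<le> t" and R: "R m \<le> C0 * S m"
    and rho: "\<And>s. m < s \<Longrightarrow> s < t \<Longrightarrow> - \<eta> / 12 \<le> \<rho> s"
  shows "R t \<le> C0 * S t"
proof -
  have "\<forall>t. \<exists>D. 0 \<le> t \<longrightarrow> (R has_real_derivative D) (at t within {0..}) \<and> D \<le> - \<eta> * R t + C1 * S t"
    using R_deriv unfolding C1_def by blast
  then obtain D where D: "\<And>t. 0 \<le> t \<Longrightarrow> (R has_real_derivative D t) (at t within {0..})"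
    and Dle: "\<And>t. 0 \<le> t \<Longrightarrow> D t \<le> - \<eta> * R t + C1 * S t" by metis
  have "R t - C0 * S t \<le> exp (- \<eta> * (t - m)) * (R m - C0 * S m)"
  proof (rule gronwall_le[of m t "{0..}" "\<lambda>t. R t - C0 * S t" "\<lambda>t. D t - C0 * (6 * \<rho> t * S t)"])
    show "((\<lambda>t. R t - C0 * S t) has_real_derivative D s - C0 * (6 * \<rho> s * S s)) (at s within {0..})"
      if "s \<in> {m..t}" for s
      using that m by (auto intro!: derivative_eq_intros D S_deriv)
    show "D s - C0 * (6 * \<rho> s * S s) \<le> - \<eta> * (R s - C0 * S s)" if s: "m < s" "s < t" for s
    proof -
      have s0: "0 \<le> s" using s m by simp
      have CS: "0 \<le> C0 * S s" using consts_pos S_pos[OF s0] by simp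
      have "- \<eta> / 12 * (C0 * S s) \<le> \<rho> s * (C0 * S s)" by (rule mult_right_mono[OF rho[OF s] CS])
      moreover have "2 * C1 * S s \<le> \<eta> * C0 * S s" using C0_ge S_pos[OF s0] by (intro mult_right_mono) auto
      ultimately show ?thesis using Dle[OF s0] by (simp add: algebra_simps)
    qed
  qed (use m in auto)
  also have "\<dots> \<le> 0" using R by (simp add: mult_le_0_iff)
  finally show ?thesis by simp
qed

lemma rho_cont: "continuous_on {0..} \<rho>"
  unfolding \<rho>_def by (intro continuous_intros v_cont acc_cont) (use v_pos in force)

text \<open>Suppose that \<rho> falls to -\<eta>/12, first at the time \<open>p\<close>, and let
  \<open>q\<close> be the last time before \<open>p\<close> with \<rho> at least -\<eta>/16. Between
  them the speed decays exponentially, so little length is covered, while \<rho> changes slowly per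
  unit of length. The fall is at most \<eta>/96, but it should be at least \<eta>/48.\<close>

lemma growth_rate_stays_bounded:
  assumes m: "0 \<le> m" "m \<le> b" and good: "good m"
    and slow: "\<And>t. m \<le> t \<Longrightarrow> t \<le> b \<Longrightarrow> norm (v t) \<le> \<theta>"
    and t: "m \<le> t" "t \<le> b"
  shows "- \<eta> / 12 \<le> \<rho> t"
proof (rule ccontr)
  assume neg: "\<not> ?thesis"
  have cont: "continuous_on {m..t} \<rho>" by (rule continuous_on_subset[OF rho_cont]) (use m in auto)
  define A where "A = {s \<in> {m..t}. \<rho> s \<le> - \<eta> / 12}"
  have "closed A" unfolding A_def
    by (intro continuous_on_closed_Collect_le cont continuous_intros) auto
  moreover have "t \<in> A" using neg t by (auto simp: A_def)
  moreover have "bdd_below A" by (auto simp: A_def intro: bdd_belowI[of _ m])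
  ultimately have p: "Inf A \<in> A" "\<And>s. s \<in> A \<Longrightarrow> Inf A \<le> s"
    using closed_contains_Inf[of A] cInf_lower by blast+
  define p where "p = Inf A"
  have pA: "m \<le> p" "p \<le> t" "\<rho> p \<le> - \<eta> / 12" using p(1) by (auto simp: A_def p_def)
  have pm: "- \<eta> / 12 < \<rho> s" if "m \<le> s" "s < p" for s
    using p(2)[of s] that pA by (force simp: A_def p_def)
  \<comment> \<open>The two bounds support each other: the curvature is controlled as long as \<rho>
    is above -\<eta>/12, that is, up to \<open>p\<close>.\<close>
  have Rb: "R s \<le> C0 * S s" if "m \<le> s" "s \<le> p" for s
    by (rule curvature_stays_bounded[of m]) (use m that good pm in \<open>auto simp: good_def intro: less_imp_le\<close>)
  define Q where "Q = {s \<in> {m..p}. - \<eta> / 16 \<le> \<rho> s}"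
  have "closed Q" unfolding Q_def
    by (intro continuous_on_closed_Collect_le continuous_on_subset[OF cont] continuous_intros) (use pA
        in auto)
  moreover have "m \<in> Q" using good pA by (auto simp: Q_def good_def)
  moreover have "bdd_above Q" by (auto simp: Q_def intro: bdd_aboveI[of _ p])
  ultimately have q: "Sup Q \<in> Q" "\<And>s. s \<in> Q \<Longrightarrow> s \<le> Sup Q"
    using closed_contains_Sup[of Q] cSup_upper by blast+
  define q where "q = Sup Q"
  have qQ: "m \<le> q" "q \<le> p" "- \<eta> / 16 \<le> \<rho> q" using q(1) by (auto simp: Q_def q_def)
  have qp: "\<rho> s < - \<eta> / 16" if "q < s" "s \<le> p" for s
    using q(2)[of s] that qQ by (force simp: Q_def q_def)
  have "\<forall>s. \<exists>D. 0 \<le> s \<longrightarrow> R s \<le> C0 * S s \<longrightarrow> (\<rho> has_real_derivative D) (at s within {0..}) \<and>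
      - (L * sqrt C0 + B) * norm (v s) \<le> D"
    using rho_deriv[of _ "sqrt C0"] consts_pos by simp
  then obtain D where D: "\<And>s. 0 \<le> s \<Longrightarrow> R s \<le> C0 * S s \<Longrightarrow> (\<rho> has_real_derivative D s) (at s within {0..})"
    and Dge: "\<And>s. 0 \<le> s \<Longrightarrow> R s \<le> C0 * S s \<Longrightarrow> - (L * sqrt C0 + B) * norm (v s) \<le> D s" by metis
  have "\<kappa> * norm (v p) - \<rho> p \<le> \<kappa> * norm (v q) - \<rho> q"
  proof (rule has_real_derivative_nonpos_imp_le[of q p "{0..}" "\<lambda>t. \<kappa> * norm (v t) - \<rho> t" "\<lambda>t. \<kappa> * (\<rho>
      t * norm (v t)) - D t"])
    show "((\<lambda>t. \<kappa> * norm (v t) - \<rho> t) has_real_derivative \<kappa> * (\<rho> s * norm (v s)) - D s) (at s within {0..})"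
      if "s \<in> {q..p}" for s
      using that qQ m Rb[of s] by (auto intro!: derivative_eq_intros D speed_deriv)
    show "\<kappa> * (\<rho> s * norm (v s)) - D s \<le> 0" if s: "q < s" "s < p" for s
    proof -
      have "\<rho> s * (\<kappa> * norm (v s)) \<le> - \<eta> / 16 * (\<kappa> * norm (v s))"
        using qp[of s] s kappa_pos by (intro mult_right_mono) auto
      moreover have "- \<eta> / 16 * (\<kappa> * norm (v s)) = - (L * sqrt C0 + B) * norm (v s)"
        using eta_pos by (simp add: \<kappa>_def field_simps)
      ultimately show ?thesis using Dge[of s] Rb[of s] s qQ m by (simp add: algebra_simps)
    qed
  qed (use qQ m in auto)
  moreover have "\<kappa> * norm (v q) \<le> \<kappa> * (\<eta> / (96 * \<kappa>))"
    using slow[of q] qQ pA t kappa_pos by (intro mult_left_mono) (auto simp: \<theta>_def)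
  moreover have "\<kappa> * (\<eta> / (96 * \<kappa>)) = \<eta> / 96" using kappa_pos by simp
  moreover have "0 \<le> \<kappa> * norm (v p)" using kappa_pos by simp
  ultimately show False using pA(3) qQ(3) eta_pos by linarith
qed

text \<open>Bounded curvature and low speed make the velocity almost an eigenvector, so
  \<open>dg\<close> does not vanish on it. By connectedness its sign is constant; \<open>g\<close>
  is monotone along the arc and its total variation is at most \<open>2 * G\<close>.\<close>

lemma len_after_good:
  assumes m: "0 \<le> m" "m \<le> b" and good: "good m"
    and slow: "\<And>t. m \<le> t \<Longrightarrow> t \<le> b \<Longrightarrow> norm (v t) \<le> \<theta>"
  shows "len b - len m \<le> 2 * G / c"
proof -
  have rho: "- \<eta> / 12 \<le> \<rho> t" if "m \<le> t" "t \<le> b" for t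
    by (rule growth_rate_stays_bounded[OF m good slow that])
  have Rb: "R t \<le> C0 * S t" if "m \<le> t" "t \<le> b" for t
    by (rule curvature_stays_bounded[of m]) (use m that good rho in \<open>auto simp: good_def\<close>)
  have dg: "c * norm (v t) \<le> \<bar>dg (y t) (v t)\<bar>" if t: "m \<le> t" "t \<le> b" for t
  proof (rule dg_expands[OF _ rho[OF t]])
    have t0: "0 \<le> t" using t m by simp
    define s where "s = v t \<bullet> v t"
    have s: "0 < s" using v_pos[OF t0] by (simp add: s_def)
    have "s * (norm (n t))\<^sup>2 \<le> s * (sqrt C0 * s)\<^sup>2"
      using Rb[OF t] consts_pos unfolding R_n[OF t0] S_def s_def[symmetric] power2_norm_eq_inner
      by (simp add: power_mult_distrib) (simp add: power2_eq_square power3_eq_cube algebra_simps)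
    then have "norm (n t) \<le> sqrt C0 * s"
      using s consts_pos by (intro power2_le_imp_le[of "norm (n t)"]) auto
    also have "sqrt C0 * s = (sqrt C0 * norm (v t)) * norm (v t)"
      by (simp add: s_def dot_square_norm power2_eq_square)
    also have "\<dots> \<le> \<delta> * norm (v t)"
    proof (rule mult_right_mono)
      have "sqrt C0 * norm (v t) \<le> sqrt C0 * (\<delta> / sqrt C0)"
        using slow[OF t] consts_pos by (intro mult_left_mono) (auto simp: \<theta>_def)
      then show "sqrt C0 * norm (v t) \<le> \<delta>" using consts_pos by simp
    qed simp
    finally show "norm (J (y t) (v t) - \<rho> t *\<^sub>R v t) \<le> \<delta> * norm (v t)" by (simp add: n_def acc_def)
  qed
  define f where "f = (\<lambda>t. dg (y t) (v t))"
  have gd: "((\<lambda>t. g (y t)) has_real_derivative f t) (at t within {0..})" if "0 \<le> t" for t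
    using vector_derivative_diff_chain_within[OF y_deriv_v[OF that] has_derivative_at_withinI[OF g_deriv]]
    by (simp add: o_def f_def has_real_derivative_iff_has_vector_derivative)
  have yc: "continuous_on {0..} y"
    using y_deriv_v by (auto simp: continuous_on_eq_continuous_within intro:
        has_vector_derivative_continuous)
  have fc: "continuous_on {m..b} f"
    unfolding f_def
    by (rule continuous_on_compose2[OF dg_cont, of _ "\<lambda>t. (y t, v t)", simplified])
       (use m in \<open>auto intro!: continuous_on_Pair continuous_on_subset[OF yc] continuous_on_subset[OF
           v_cont]\<close>)
  have "f t \<noteq> 0" if "t \<in> {m..b}" for t
    using dg[of t] that v_nonzero[of t] m c_pos by (auto simp: f_def v_def mult_le_0_iff)
  from continuous_nonzero_same_sign[OF fc this]
  obtain \<sigma> :: real where sg: "\<bar>\<sigma>\<bar> = 1" "\<And>t. t \<in> {m..b} \<Longrightarrow> \<sigma> * f t = \<bar>f t\<bar>"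
  proof
    assume "\<forall>t\<in>{m..b}. 0 < f t" then show ?thesis by (intro that[of 1]) (auto simp: abs_of_pos)
  next
    assume "\<forall>t\<in>{m..b}. f t < 0" then show ?thesis by (intro that[of "-1"]) (auto simp: abs_of_neg)
  qed
  have "c * len b - \<sigma> * g (y b) \<le> c * len m - \<sigma> * g (y m)"
  proof (rule has_real_derivative_nonpos_imp_le[of m b "{0..}" "\<lambda>t. c * len t - \<sigma> * g (y t)" "\<lambda>t. c *
      norm (v t) - \<sigma> * f t"])
    show "((\<lambda>t. c * len t - \<sigma> * g (y t)) has_real_derivative c * norm (v t) - \<sigma> * f t) (at t within {0..})"
      if "t \<in> {m..b}" for t
      using that m by (auto intro!: derivative_eq_intros len_deriv gd)
    show "c * norm (v t) - \<sigma> * f t \<le> 0" if "m < t" "t < b" for t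
      using dg[of t] sg(2)[of t] that by (simp add: f_def)
  qed (use m in auto)
  moreover have "\<sigma> * g x \<le> G" "- G \<le> \<sigma> * g x" for x
    using g_bound[of x] sg(1) by (auto simp: abs_if split: if_splits)
  ultimately have "c * (len b - len m) \<le> 2 * G"
    by (smt (verit) right_diff_distrib)
  then show ?thesis using c_pos by (simp add: le_divide_eq mult.commute)
qed

text \<open>The arc is cut at its first good time, which exists because goodness is a closed
  condition. Before it exponential decay bounds the length, after it the functional \<open>g\<close>
  does.\<close>

lemma slow_arc:
  assumes ab: "0 \<le> a" "a \<le> b" and slow: "\<And>t. a \<le> t \<Longrightarrow> t \<le> b \<Longrightarrow> norm (v t) \<le> \<theta>"
  shows "len b - len a \<le> len_bad + 2 * G / c"
proof (cases "\<exists>t\<in>{a..b}. good t")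
  case False
  then have "len b - len a \<le> len_bad" using ab by (intro len_until_good) auto
  moreover have "0 \<le> 2 * G / c" using g_bound[of 0] c_pos by simp
  ultimately show ?thesis by simp
next
  case True
  define A where "A = {t \<in> {a..b}. R t \<le> C0 * S t} \<inter> {t \<in> {a..b}. - \<eta> / 16 \<le> \<rho> t}"
  have cont: "continuous_on {a..b} v" "continuous_on {a..b} acc" "continuous_on {a..b} \<rho>"
    using ab by (auto intro: continuous_on_subset[OF v_cont] continuous_on_subset[OF acc_cont]
        continuous_on_subset[OF rho_cont])
  have "closed A" unfolding A_def R_def S_def gram_def
    by (intro closed_Int continuous_on_closed_Collect_le cont continuous_intros) auto
  moreover have "A \<noteq> {}" using True by (auto simp: A_def good_def)
  moreover have "bdd_below A" by (auto simp: A_def intro: bdd_belowI[of _ a])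
  ultimately have m: "Inf A \<in> A" "\<And>s. s \<in> A \<Longrightarrow> Inf A \<le> s"
    using closed_contains_Inf[of A] cInf_lower by blast+
  define m where "m = Inf A"
  have mA: "a \<le> m" "m \<le> b" "good m" using m(1) by (auto simp: A_def m_def good_def)
  have "\<not> good t" if "a \<le> t" "t < m" for t
    using m(2)[of t] that mA by (force simp: A_def m_def good_def)
  then have "len m - len a \<le> len_bad" using ab mA by (intro len_until_good) auto
  moreover have "len b - len m \<le> 2 * G / c"
    using ab mA slow by (intro len_after_good) auto
  ultimately show ?thesis by simp
qed

end

section \<open>Convergence\<close>

context bounded_orbit
begin

lemma len_cont: "continuous_on {0..} len"
  by (rule DERIV_continuous_on) (use len_deriv in auto)

lemma norm_diff_le_len:
  assumes "0 \<le> a" "a \<le> b"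
  shows "norm (y b - y a) \<le> len b - len a"
proof -
  \<comment> \<open>Testing with the chord itself turns the vector inequality into a real
    one.\<close>
  define w where "w = y b - y a"
  have "w \<bullet> y b - norm w * len b \<le> w \<bullet> y a - norm w * len a"
  proof (rule has_real_derivative_nonpos_imp_le[of a b "{0..}" "\<lambda>t. w \<bullet> y t - norm w * len t" "\<lambda>t. w \<bullet>
      v t - norm w * norm (v t)"])
    show "((\<lambda>t. w \<bullet> y t - norm w * len t) has_real_derivative w \<bullet> v t - norm w * norm (v t)) (at t
        within {0..})"
      if "t \<in> {a..b}" for t
    proof -
      have "((\<lambda>t. w \<bullet> y t) has_real_derivative w \<bullet> v t) (at t within {0..})"
        using has_real_derivative_inner[OF has_vector_derivative_const y_deriv_v, of t w] that assms by simp
      then show ?thesis using that assms by (auto intro!: derivative_eq_intros len_deriv)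
    qed
  qed (use assms norm_cauchy_schwarz in auto)
  moreover have "w \<bullet> y b - w \<bullet> y a = norm w * norm w"
    by (simp add: w_def dot_square_norm power2_eq_square flip: inner_diff_right)
  ultimately have "norm w * norm w \<le> norm w * (len b - len a)" by (simp add: algebra_simps)
  then show ?thesis using len_mono[OF assms] by (cases "w = 0") (auto simp: w_def)
qed

text \<open>The tails of \<open>len\<close> are small, so the orbit is Cauchy. If the field did not
  vanish at the limit, the speed would stay above a positive constant and the length would grow
  linearly.\<close>

lemma finite_length_converges:
  assumes C: "\<And>t. 0 \<le> t \<Longrightarrow> len t \<le> C"
  shows "\<exists>e. F e = 0 \<and> (y \<longlongrightarrow> e) at_top"
proof -
  have bdd: "bdd_above (len ` {0..})" by (rule bdd_aboveI[of _ C]) (use C in auto)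
  define s where "s = Sup (len ` {0..})"
  have upper: "len t \<le> s" if "0 \<le> t" for t
    unfolding s_def by (rule cSUP_upper[OF _ bdd]) (use that in auto)
  have tail: "\<exists>T\<ge>0. \<forall>a\<ge>T. \<forall>b\<ge>a. norm (y b - y a) < \<epsilon>" if "0 < \<epsilon>" for \<epsilon>
  proof -
    have "\<exists>x\<in>len ` {0..}. s - \<epsilon> < x"
      using less_cSupD[of "len ` {0..}" "s - \<epsilon>"] that by (auto simp: s_def)
    then obtain T where T: "0 \<le> T" "s - \<epsilon> < len T" by auto
    have "norm (y b - y a) < \<epsilon>" if "T \<le> a" "a \<le> b" for a b
      using norm_diff_le_len[of a b] len_mono[of T a] upper[of b] T that by linarith
    then show ?thesis using T by auto
  qed
  have "Cauchy (\<lambda>n. y (real n))"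
    unfolding Cauchy_altdef2
  proof (intro allI impI)
    fix \<epsilon> :: real assume "0 < \<epsilon>"
    then obtain T where T: "\<And>a b. T \<le> a \<Longrightarrow> a \<le> b \<Longrightarrow> norm (y b - y a) < \<epsilon>" using tail by blast
    obtain N :: nat where "T \<le> real N" using real_arch_simple by blast
    then show "\<exists>N. \<forall>n\<ge>N. dist (y (real n)) (y (real N)) < \<epsilon>"
      using T by (intro exI[of _ N]) (simp add: dist_norm)
  qed
  then obtain e where e: "(\<lambda>n. y (real n)) \<longlonglongrightarrow> e" using Cauchy_convergent convergent_def by blast
  have lim: "(y \<longlongrightarrow> e) at_top"
  proof (rule tendstoI)
    fix \<epsilon> :: real assume "0 < \<epsilon>"
    then obtain T where T: "0 \<le> T" "\<And>a b. T \<le> a \<Longrightarrow> a \<le> b \<Longrightarrow> norm (y b - y a) < \<epsilon> / 2"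
      using tail[of "\<epsilon> / 2"] by auto
    have "dist (y t) e < \<epsilon>" if t: "T \<le> t" for t
    proof -
      have "(\<lambda>n. norm (y (real n) - y t)) \<longlonglongrightarrow> norm (e - y t)" by (intro tendsto_intros e)
      moreover have "\<forall>\<^sub>F n in sequentially. norm (y (real n) - y t) \<le> \<epsilon> / 2"
        using eventually_ge_at_top[of "nat \<lceil>t\<rceil>"]
        by eventually_elim (use T t in \<open>auto intro!: less_imp_le simp: nat_ceiling_le_eq\<close>)
      ultimately have "norm (e - y t) \<le> \<epsilon> / 2"
        by (intro tendsto_upperbound) auto
      then show ?thesis using \<open>0 < \<epsilon>\<close> by (simp add: dist_norm norm_minus_commute)
    qed
    then show "\<forall>\<^sub>F t in at_top. dist (y t) e < \<epsilon>" by (auto simp: eventually_at_top_linorder)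
  qed
  have "F e = 0"
  proof (rule ccontr)
    assume "F e \<noteq> 0"
    define r where "r = norm (F e) / 2"
    have r: "0 < r" using \<open>F e \<noteq> 0\<close> by (simp add: r_def)
    have "isCont F e" using F_deriv has_derivative_continuous by blast
    then have "((\<lambda>t. norm (F (y t))) \<longlongrightarrow> norm (F e)) at_top"
      by (intro tendsto_intros isCont_tendsto_compose[OF _ lim])
    then have "\<forall>\<^sub>F t in at_top. r < norm (v t)"
      unfolding v_def by (rule order_tendstoD) (use r in \<open>simp add: r_def\<close>)
    then obtain T0 where T0: "\<And>t. T0 \<le> t \<Longrightarrow> r < norm (v t)" by (auto simp: eventually_at_top_linorder)
    define T where "T = max 0 T0"
    \<comment> \<open>At speed above \<open>r\<close>, the length at this time exceeds the bound
      \<open>C\<close> by at least \<open>r\<close>.\<close>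
    define b where "b = T + (C - len T) / r + 1"
    have lT: "len T \<le> C" using C by (simp add: T_def)
    then have b: "T \<le> b" using r by (simp add: b_def)
    have "r * b - len b \<le> r * T - len T"
    proof (rule has_real_derivative_nonpos_imp_le[of T b "{0..}" "\<lambda>t. r * t - len t" "\<lambda>t. r - norm (v t)"])
      show "((\<lambda>t. r * t - len t) has_real_derivative r - norm (v t)) (at t within {0..})" if "t \<in>
          {T..b}" for t
        using that by (auto intro!: derivative_eq_intros len_deriv simp: T_def)
      show "r - norm (v t) \<le> 0" if "T < t" for t using T0[of t] that by (simp add: T_def)
    qed (use b in \<open>auto simp: T_def\<close>)
    moreover have "r * b = r * T + (C - len T) + r" using r by (simp add: b_def field_simps)
    ultimately show False using C[of b] b r by (simp add: T_def)
  qed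
  with lim show ?thesis by blast
qed

end

section \<open>Every arc of a fixed length carries a fixed amount of energy\<close>

context moving_orbit
begin

lemma speed_lipschitz:
  assumes "0 \<le> a" "a \<le> b"
  shows "norm (v b) - L * len b \<le> norm (v a) - L * len a"
proof (rule has_real_derivative_nonpos_imp_le[of a b "{0..}" "\<lambda>t. norm (v t) - L * len t" "\<lambda>t. \<rho> t *
    norm (v t) - L * norm (v t)"])
  show "((\<lambda>t. norm (v t) - L * len t) has_real_derivative \<rho> t * norm (v t) - L * norm (v t)) (at t
      within {0..})"
    if "t \<in> {a..b}" for t
    using that assms by (auto intro!: derivative_eq_intros speed_deriv len_deriv)
  show "\<rho> t * norm (v t) - L * norm (v t) \<le> 0" if "a < t" for t
    using mult_right_mono[OF rho_le[of t] norm_ge_zero[of "v t"]] that assms by simp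
qed (use assms in auto)

lemma len_reaches:
  assumes "0 \<le> a" "a \<le> b" "len a \<le> l" "l \<le> len b"
  obtains t where "a \<le> t" "t \<le> b" "len t = l"
proof -
  have "\<exists>t\<ge>a. t \<le> b \<and> len t = l"
    by (rule IVT') (use assms in \<open>auto intro: continuous_on_subset[OF len_cont]\<close>)
  then show ?thesis using that by blast
qed

text \<open>Going back by the length \<open>d\<close> from a point with speed above \<theta>, the
  speed stays above \<theta>/2. The summand \<open>d\<close> in \<open>arc_length\<close> leaves
  room for going back, and the summand 1 makes the rest longer than any slow arc.\<close>

definition d :: real where "d = \<theta> / (2 * L)"
definition arc_length :: real where "arc_length = len_bad + 2 * G / c + 1 + d"

lemma d_pos: "0 < d" using theta_pos L_pos by (simp add: d_def)

lemma arc_energy: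
  assumes ab: "0 \<le> a" "a \<le> b" and l: "len b - len a = arc_length"
  shows "\<theta> / 2 * d \<le> energy b - energy a"
proof -
  have lb: "0 \<le> len_bad + 2 * G / c"
    using slow_arc[of a a] ab len_until_good[of a a] g_bound[of 0] c_pos
    by (simp add: add_nonneg_nonneg)
  obtain a' where a': "a \<le> a'" "a' \<le> b" "len a' = len a + d"
    by (rule len_reaches[OF ab, of "len a + d"]) (use l lb d_pos in \<open>auto simp: arc_length_def\<close>)
  obtain t where t: "a' \<le> t" "t \<le> b" "\<theta> < norm (v t)"
  proof (rule ccontr)
    assume "\<not> thesis"
    then have "len b - len a' \<le> len_bad + 2 * G / c"
      using ab a' that by (intro slow_arc) (auto simp: not_less[symmetric])
    then show False using l a' by (simp add: arc_length_def)
  qed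
  have "len a' \<le> len t" using ab a' t by (intro len_mono) auto
  then obtain q where q: "a \<le> q" "q \<le> t" "len q = len t - d"
    using len_reaches[of a t "len t - d"] ab a' t d_pos by auto
  have fast: "\<theta> / 2 \<le> norm (v s)" if s: "q < s" "s < t" for s
  proof -
    have "L * (len t - len s) \<le> L * d"
      using len_mono[of q s] s q ab L_pos by (intro mult_left_mono) auto
    also have "\<dots> = \<theta> / 2" using L_pos by (simp add: d_def)
    finally show ?thesis using speed_lipschitz[of s t] s q ab t by (simp add: algebra_simps)
  qed
  have "\<theta> / 2 * len t - energy t \<le> \<theta> / 2 * len q - energy q"
  proof (rule has_real_derivative_nonpos_imp_le[of q t "{0..}" "\<lambda>t. \<theta> / 2 * len t - energy t" "\<lambda>t. \<theta> /
      2 * norm (v t) - v t \<bullet> v t"])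
    show "((\<lambda>t. \<theta> / 2 * len t - energy t) has_real_derivative \<theta> / 2 * norm (v s) - v s \<bullet> v s) (at s
        within {0..})"
      if "s \<in> {q..t}" for s
      using that q ab by (auto intro!: derivative_eq_intros len_deriv energy_deriv)
    show "\<theta> / 2 * norm (v s) - v s \<bullet> v s \<le> 0" if s: "q < s" "s < t" for s
      using mult_right_mono[OF fast[OF s] norm_ge_zero[of "v s"]]
      by (simp add: dot_square_norm power2_eq_square)
  qed (use q ab in auto)
  moreover have "energy a \<le> energy q" "energy t \<le> energy b"
    using q t ab by (auto intro!: energy_mono)
  moreover have "\<theta> / 2 * len t - \<theta> / 2 * len q = \<theta> / 2 * d"
    unfolding q(3) by (simp add: algebra_simps)
  ultimately show ?thesis by linarith
qed

text \<open>On \<open>k\<close> consecutive arcs the energy is at least \<open>k * e0\<close>. With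
  \<epsilon> half of the energy per unit of length, \<open>energy_le_len\<close> allows only
  \<open>k * e0 / 2\<close> plus a constant.\<close>

lemma len_bounded: "\<exists>C. \<forall>t\<ge>0. len t \<le> C"
proof (rule ccontr)
  assume "\<not> ?thesis"
  then have unb: "\<And>C. \<exists>t\<ge>0. C < len t" by (auto simp: not_le)
  have lb: "0 \<le> len_bad + 2 * G / c"
    using slow_arc[of 0 0] len_until_good[of 0 0] g_bound[of 0] c_pos
    by (simp add: add_nonneg_nonneg)
  then have arc: "0 < arc_length" using d_pos by (simp add: arc_length_def)
  have l0: "len 0 = 0" "energy 0 = 0" by (simp_all add: len_def energy_def)
  define e0 where "e0 = \<theta> / 2 * d"
  have e0: "0 < e0" using theta_pos d_pos by (simp add: e0_def)
  have reach: "\<exists>t\<ge>0. len t = k * arc_length \<and> k * e0 \<le> energy t" for k :: nat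
  proof (induction k)
    case 0
    show ?case by (intro exI[of _ 0]) (simp add: l0)
  next
    case (Suc k)
    then obtain a where a: "0 \<le> a" "len a = k * arc_length" "k * e0 \<le> energy a" by auto
    obtain T where T: "0 \<le> T" "Suc k * arc_length < len T" using unb by blast
    have "a \<le> T"
    proof (rule ccontr)
      assume "\<not> a \<le> T"
      then have "len T \<le> len a" using T by (intro len_mono) auto
      with T a arc show False by (simp add: algebra_simps)
    qed
    obtain b where b: "a \<le> b" "len b = len a + arc_length"
      by (rule len_reaches[of a T "len a + arc_length"]) (use a T \<open>a \<le> T\<close> arc in \<open>auto simp: algebra_simps\<close>)
    have "e0 \<le> energy b - energy a"
      unfolding e0_def using a b by (intro arc_energy) auto
    with a b show ?case by (intro exI[of _ b]) (auto simp: algebra_simps)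
  qed
  obtain C where C: "\<And>T. 0 \<le> T \<Longrightarrow> energy T \<le> e0 / (2 * arc_length) * len T + C"
    using energy_le_len[of "e0 / (2 * arc_length)"] e0 arc by auto
  obtain k :: nat where k: "2 * C / e0 < k" using reals_Archimedean2 by blast
  obtain t where t: "0 \<le> t" "len t = k * arc_length" "k * e0 \<le> energy t" using reach by blast
  have "k * e0 \<le> e0 / (2 * arc_length) * (k * arc_length) + C" using C[OF t(1)] t by simp
  then have "k * e0 \<le> k * e0 / 2 + C" using arc by (simp add: mult.commute)
  then have "k * e0 \<le> 2 * C" by linarith
  then show False using k e0 by (simp add: divide_less_eq)
qed

end

context separating_functional
begin

theorem converges_to_equilibrium: "\<exists>e. F e = 0 \<and> (y \<longlongrightarrow> e) at_top"
proof (cases "\<exists>t\<ge>0. F (y t) = 0")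
  case True
  then obtain a where a: "0 \<le> a" "F (y a) = 0" by auto
  \<comment> \<open>Once zero, the velocity remains zero by \<open>v_growth\<close>, so such an
    orbit is eventually constant.\<close>
  have v0: "v t = 0" if "a \<le> t" for t
    using v_growth[of a "t - a"] a that by (simp add: v_def)
  have "y t = y a" if t: "a \<le> t" for t
  proof -
    have "norm (y t - y a) \<le> 0 * (t - a)"
    proof (rule norm_diff_le_derivative_bound[of a t "{0..}" y v])
      show "(y has_vector_derivative v s) (at s within {0..})" if "s \<in> {a..t}" for s
        using that a by (intro y_deriv_v) auto
    qed (use t a v0 in auto)
    then show ?thesis by simp
  qed
  then have "(y \<longlongrightarrow> y a) at_top"
    by (intro tendsto_eventually) (unfold eventually_at_top_linorder, blast)
  with a show ?thesis by blast
next
  case False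
  then interpret moving_orbit F J H L B \<eta> y K g dg G c \<delta>
    by unfold_locales auto
  from len_bounded show ?thesis using finite_length_converges by blast
qed

end

section \<open>Singular values\<close>

lemma quadratic_nonpos_imp_zero:
  fixes a q :: real
  assumes "\<And>t. 2 * t * a + t\<^sup>2 * q \<le> 0" and "0 \<le> a"
  shows "a = 0"
proof (rule ccontr)
  assume "a \<noteq> 0"
  then have a: "0 < a" using assms(2) by simp
  \<comment> \<open>Small enough for the linear term to dominate: \<open>t * \<bar>q\<bar>\<close>
    is at most \<open>a\<close>.\<close>
  define t where "t = a / (\<bar>q\<bar> + 1)"
  have t: "0 < t" using a by (simp add: t_def)
  have "t * (2 * a + t * q) \<le> 0" using assms(1)[of t] by (simp add: power2_eq_square algebra_simps)
  then have "2 * a + t * q \<le> 0" using t by (simp add: mult_le_0_iff)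
  moreover have "- (t * q) \<le> t * \<bar>q\<bar>" using t by (simp add: abs_if)
  moreover have "t * \<bar>q\<bar> \<le> a" using a by (simp add: t_def divide_le_eq mult_left_mono)
  ultimately show False using a by linarith
qed

text \<open>The Rayleigh quotient attains its maximum on the unit sphere of \<open>S\<close>. The
  residual \<open>w = f x - l *\<^sub>R x\<close> lies in \<open>S\<close> by invariance, and
  varying \<open>x\<close> in the direction \<open>w\<close> would increase the quotient unless
  \<open>w\<close> vanishes.\<close>

lemma symmetric_eigenvector_in_subspace:
  fixes f :: "'a::euclidean_space \<Rightarrow> 'a"
  assumes f: "linear f" and sym: "\<And>x y. f x \<bullet> y = x \<bullet> f y"
    and S: "subspace S" and inv: "\<And>x. x \<in> S \<Longrightarrow> f x \<in> S" and ne: "\<exists>x\<in>S. x \<noteq> 0"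
  obtains x l where "x \<in> S" "norm x = 1" "f x = l *\<^sub>R x"
proof -
  have "compact (S \<inter> sphere 0 1)" using S by (intro closed_Int_compact closed_subspace) auto
  moreover obtain z where z: "z \<in> S" "z \<noteq> 0" using ne by blast
  then have "(1 / norm z) *\<^sub>R z \<in> S \<inter> sphere 0 1" using S by (auto intro: subspace_scale)
  then have "S \<inter> sphere 0 1 \<noteq> {}" by blast
  moreover have "continuous_on (S \<inter> sphere 0 1) (\<lambda>x. x \<bullet> f x)"
    using f by (intro continuous_intros linear_continuous_on) (simp add: linear_conv_bounded_linear)
  ultimately obtain x where x: "x \<in> S \<inter> sphere 0 1"
    and max: "\<And>y. y \<in> S \<inter> sphere 0 1 \<Longrightarrow> y \<bullet> f y \<le> x \<bullet> f x"
    using continuous_attains_sup[of "S \<inter> sphere 0 1" "\<lambda>x. x \<bullet> f x"] by blast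
  define l where "l = x \<bullet> f x"
  have xx: "x \<bullet> x = 1" using x by (simp add: dot_square_norm)
  have le: "y \<bullet> f y \<le> l * (y \<bullet> y)" if "y \<in> S" for y
  proof (cases "y = 0")
    case False
    define u where "u = (1 / norm y) *\<^sub>R y"
    have u: "u \<in> S \<inter> sphere 0 1" using S that False by (auto simp: u_def intro: subspace_scale)
    have y: "y = norm y *\<^sub>R u" using False by (simp add: u_def)
    have "y \<bullet> f y = (norm y)\<^sup>2 * (u \<bullet> f u)"
      by (subst (1 2) y) (simp add: linear_cmul[OF f] power2_eq_square)
    also have "\<dots> \<le> (norm y)\<^sup>2 * l" using max[OF u] unfolding l_def by (rule mult_left_mono) simp
    finally show ?thesis by (simp add: dot_square_norm mult.commute)
  qed (simp add: linear_0[OF f])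
  define w where "w = f x - l *\<^sub>R x"
  have wS: "w \<in> S" unfolding w_def using S x inv by (auto intro!: subspace_diff subspace_scale)
  have "w \<bullet> w = 0"
  proof (rule quadratic_nonpos_imp_zero)
    fix t :: real
    have "x + t *\<^sub>R w \<in> S" using S x wS by (auto intro!: subspace_add subspace_scale)
    from le[OF this]
    have "l + 2 * t * (f x \<bullet> w) + t\<^sup>2 * (w \<bullet> f w) \<le> l * (1 + 2 * t * (x \<bullet> w) + t\<^sup>2 * (w \<bullet> w))"
      using sym[of x w]
      by (simp add: linear_add[OF f] linear_cmul[OF f] inner_add xx l_def[symmetric]
          inner_commute[of w x] inner_commute[of w "f x"] power2_eq_square algebra_simps)
    then show "2 * t * (w \<bullet> w) + t\<^sup>2 * (w \<bullet> f w - l * (w \<bullet> w)) \<le> 0"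
      by (simp add: w_def[THEN arg_cong[of _ _ "\<lambda>z. z \<bullet> w"]] inner_diff_left algebra_simps)
  qed simp
  then have "f x = l *\<^sub>R x" by (simp add: w_def)
  then show ?thesis using that x by auto
qed

lemma symmetric_orthonormal_eigenvectors:
  fixes f :: "'a::euclidean_space \<Rightarrow> 'a"
  assumes f: "linear f" and sym: "\<And>x y. f x \<bullet> y = x \<bullet> f y" and k: "k \<le> DIM('a)"
  shows "\<exists>B. finite B \<and> card B = k \<and> pairwise real_inner_class.orthogonal B \<and> (\<forall>b\<in>B. norm b = 1 \<and> (\<exists>l.
      f b = l *\<^sub>R b))"
  using k
proof (induction k)
  case 0
  show ?case by (intro exI[of _ "{}"]) auto
next
  case (Suc k)
  then obtain B where B: "finite B" "card B = k" "pairwise real_inner_class.orthogonal B"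
    and eig: "\<forall>b\<in>B. norm b = 1 \<and> (\<exists>l. f b = l *\<^sub>R b)" by auto
  define S where "S = {x. \<forall>b\<in>B. b \<bullet> x = 0}"
  \<comment> \<open>The orthogonal complement of the eigenvectors found so far is invariant by
    symmetry, and nonzero by dimension.\<close>
  have S: "subspace S" by (auto simp: S_def subspace_def inner_add_right)
  have inv: "f x \<in> S" if "x \<in> S" for x
    unfolding S_def
  proof (intro CollectI ballI)
    fix b assume b: "b \<in> B"
    then obtain l where "f b = l *\<^sub>R b" using eig by auto
    then show "b \<bullet> f x = 0" using that b sym[of b x] by (simp add: S_def)
  qed
  have "dim (span B) < DIM('a)"
    using dim_le_card'[OF B(1)] B(2) Suc.prems by (simp add: dim_span)
  then obtain x where x: "x \<noteq> 0" "\<And>y. y \<in> span (span B) \<Longrightarrow> real_inner_class.orthogonal x y"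
    using orthogonal_to_subspace_exists[of "span B"] by auto
  have "x \<in> S" using x(2) by (auto simp: S_def Linear_Algebra.orthogonal_def inner_commute span_base)
  then obtain z l where z: "z \<in> S" "norm z = 1" "f z = l *\<^sub>R z"
    using symmetric_eigenvector_in_subspace[OF f sym S inv] x(1) by blast
  have "z \<notin> B" using z by (auto simp: S_def)
  moreover have "pairwise real_inner_class.orthogonal (insert z B)"
    using B(3) z(1) by (auto simp: pairwise_insert S_def Linear_Algebra.orthogonal_def inner_commute)
  ultimately show ?case
    using B eig z by (intro exI[of _ "insert z B"]) auto
qed

lemma symmetric_orthonormal_eigenbasis:
  fixes f :: "real^'n \<Rightarrow> real^'n"
  assumes f: "linear f" and sym: "\<And>x y. f x \<bullet> y = x \<bullet> f y"
  obtains p :: "'n \<Rightarrow> real^'n" and d :: "'n \<Rightarrow> real"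
  where "\<And>i j. p i \<bullet> p j = (if i = j then 1 else 0)" "\<And>i. f (p i) = d i *\<^sub>R p i"
    "\<And>y. y = (\<Sum>i\<in>UNIV. (p i \<bullet> y) *\<^sub>R p i)"
proof -
  obtain B :: "(real^'n) set" where B: "finite B" "card B = CARD('n)" "pairwise
      real_inner_class.orthogonal B"
    and eig: "\<forall>b\<in>B. norm b = 1 \<and> (\<exists>l. f b = l *\<^sub>R b)"
    using symmetric_orthonormal_eigenvectors[OF f sym, of "CARD('n)"] by auto
  obtain p where p: "bij_betw p (UNIV :: 'n set) B"
    using B finite_same_card_bij[of "UNIV :: 'n set" B] by auto
  have pB: "p i \<in> B" for i using p by (auto simp: bij_betw_def)
  have orth: "p i \<bullet> p j = (if i = j then 1 else 0)" for i j
  proof (cases "i = j")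
    case True
    then show ?thesis using eig pB by (simp add: dot_square_norm)
  next
    case False
    then have "p i \<noteq> p j" using p by (auto simp: bij_betw_def inj_on_def)
    then show ?thesis using B(3) pB False by (auto simp: pairwise_def Linear_Algebra.orthogonal_def)
  qed
  have "\<forall>i. \<exists>l. f (p i) = l *\<^sub>R p i" using eig pB by auto
  then obtain d where d: "\<And>i. f (p i) = d i *\<^sub>R p i" by metis
  have "0 \<notin> B" using eig by (metis norm_zero zero_neq_one)
  then have "independent B" using B by (intro pairwise_orthogonal_independent) auto
  then have "UNIV \<subseteq> span B" using B by (intro card_ge_dim_independent) auto
  then have span: "span (range p) = UNIV" using p by (auto simp: bij_betw_def)
  have expand: "y = (\<Sum>i\<in>UNIV. (p i \<bullet> y) *\<^sub>R p i)" for y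
  proof -
    define z where "z = y - (\<Sum>i\<in>UNIV. (p i \<bullet> y) *\<^sub>R p i)"
    have "real_inner_class.orthogonal z z"
    proof (rule orthogonal_to_span[where S = "range p"])
      show "z \<in> span (range p)" by (simp only: span UNIV_I)
      show "real_inner_class.orthogonal z x" if "x \<in> range p" for x
        using that by (auto simp: z_def Linear_Algebra.orthogonal_def inner_diff_left inner_sum_left orth
            inner_commute[of y] if_distrib cong: if_cong)
    qed
    then show ?thesis by (simp add: z_def Linear_Algebra.orthogonal_def)
  qed
  show ?thesis by (rule that[OF orth d expand])
qed

section \<open>Characteristic polynomials in an eigenbasis and the list of singular values\<close>

lemma sum_coord_index:
  "(\<Sum>k = 0..<CARD('n). h (coord_index k)) = (\<Sum>k\<in>(UNIV :: 'n::{finite,linorder} set). h k)"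
  using sum.reindex_bij_betw[OF bij_betw_coord_index, of h] by (simp add: atLeast0LessThan)

lemma coord_index_eq_iff:
  "i < CARD('n) \<Longrightarrow> j < CARD('n) \<Longrightarrow> (coord_index i :: 'n::{finite,linorder}) = coord_index j \<longleftrightarrow> i = j"
  using bij_betw_coord_index[where ?'n = 'n] by (auto simp: bij_betw_def inj_on_def)

lemma mat_of_carrier [simp]: "mat_of (A :: real^'n::{finite,linorder}^'n::{finite,linorder}) \<in>
    carrier_mat CARD('n) CARD('n)"
  by (simp add: mat_of_def)

lemma mat_of_mult: "mat_of (A ** B) = mat_of A * mat_of (B ::
    real^'n::{finite,linorder}^'n::{finite,linorder})"
  by (rule eq_matI)
     (simp_all add: mat_of_def scalar_prod_def matrix_matrix_mult_def sum_coord_index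
        [where h = "\<lambda>k. vec_nth (vec_nth A _) k * vec_nth (vec_nth B k) _"])

lemma mat_of_transpose: "mat_of (Finite_Cartesian_Product.transpose A) = transpose_mat (mat_of A)"
  by (rule eq_matI) (simp_all add: mat_of_def Finite_Cartesian_Product.transpose_def)

lemma mat_of_one: "mat_of (Finite_Cartesian_Product.mat 1 ::
    real^'n::{finite,linorder}^'n::{finite,linorder}) = 1\<^sub>m CARD('n)"
  by (rule eq_matI) (simp_all add: mat_of_def Finite_Cartesian_Product.mat_def coord_index_eq_iff)

text \<open>An orthonormal eigenbasis gives a similarity to a diagonal matrix, so the roots with
  algebraic multiplicity are the eigenvalues counted by basis index.\<close>

lemma proots_char_poly_symmetric:
  fixes A :: "real^'n::{finite,linorder}^'n::{finite,linorder}" and p :: "'n \<Rightarrow> real^'n::{finite,linorder}"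
  assumes p: "\<And>i j. p i \<bullet> p j = (if i = j then 1 else 0)" and d: "\<And>i. A *v p i = d i *\<^sub>R p i"
  shows "proots (char_poly (mat_of A)) = image_mset d (mset_set UNIV)"
proof -
  define P :: "real^'n::{finite,linorder}^'n::{finite,linorder}" where "P = (\<chi> r i. vec_nth (p i) r)"
  define E :: "real^'n::{finite,linorder}^'n::{finite,linorder}" where "E = (\<chi> r i. if r = i then d i
      else 0)"
  have PP: "Finite_Cartesian_Product.transpose P ** P = Finite_Cartesian_Product.mat 1"
    using p by (simp add: P_def matrix_matrix_mult_def Finite_Cartesian_Product.transpose_def
        Finite_Cartesian_Product.mat_def Finite_Cartesian_Product.vec_eq_iff inner_vec_def)
  then have PP': "P ** Finite_Cartesian_Product.transpose P = Finite_Cartesian_Product.mat 1"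
    by (simp add: matrix_left_right_inverse)
  have AP: "A ** P = P ** E"
  proof -
    have 1: "vec_nth (vec_nth (A ** P) r) i = vec_nth (A *v p i) r" for r i
      by (simp add: P_def matrix_matrix_mult_def matrix_vector_mult_def)
    have 2: "vec_nth (vec_nth (P ** E) r) i = d i * vec_nth (p i) r" for r i
      by (simp add: P_def E_def matrix_matrix_mult_def if_distrib cong: if_cong)
    show ?thesis
      unfolding Finite_Cartesian_Product.vec_eq_iff by (simp only: 1 2 d vector_scaleR_component
          real_scaleR_def simp_thms)
  qed
  have "A = A ** P ** Finite_Cartesian_Product.transpose P"
    unfolding matrix_mul_assoc[symmetric] PP' by simp
  then have "A = P ** E ** Finite_Cartesian_Product.transpose P"
    by (simp only: AP)
  then have "similar_mat_wit (mat_of A) (mat_of E) (mat_of P) (mat_of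
      (Finite_Cartesian_Product.transpose P))"
    using arg_cong[OF PP, of mat_of] arg_cong[OF PP', of mat_of]
    by (intro similar_mat_witI[of _ _ "CARD('n)"])
       (simp_all only: mat_of_mult[symmetric] mat_of_one mat_of_carrier)
  then have "char_poly (mat_of A) = char_poly (mat_of E)"
    by (intro char_poly_similar) (auto simp: similar_mat_def)
  also have "\<dots> = (\<Prod>a\<leftarrow>diag_mat (mat_of E). [:- a, 1:])"
    by (rule char_poly_upper_triangular[OF mat_of_carrier])
       (auto simp: upper_triangular_def mat_of_def E_def coord_index_eq_iff)
  also have "diag_mat (mat_of E) = map (\<lambda>i. d (coord_index i)) [0..<CARD('n)]"
    by (auto simp: diag_mat_def mat_of_def E_def)
  finally have cp: "char_poly (mat_of A) = (\<Prod>i\<leftarrow>[0..<CARD('n)]. [:- d (coord_index i), 1:])"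
    by (simp add: o_def)
  have "proots (\<Prod>i\<leftarrow>xs. [:- d (coord_index i), 1:]) = image_mset (\<lambda>i. d (coord_index i)) (mset xs)" for xs
  proof (induction xs)
    case (Cons i xs)
    have "(\<Prod>i\<leftarrow>xs. [:- d (coord_index i), 1:]) \<noteq> 0" by (auto simp: prod_list_zero_iff)
    then have "proots ([:- d (coord_index i), 1:] * (\<Prod>i\<leftarrow>xs. [:- d (coord_index i), 1:])) =
       proots [:- d (coord_index i), 1:] + proots (\<Prod>i\<leftarrow>xs. [:- d (coord_index i), 1:])"
      by (intro proots_mult) auto
    then show ?case by (simp add: Cons.IH)
  qed simp
  then have "proots (char_poly (mat_of A)) = image_mset d (image_mset coord_index (mset_set {..<CARD('n)}))"
    by (simp add: cp multiset.map_comp o_def atLeast0LessThan)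
  also have "image_mset coord_index (mset_set {..<CARD('n)}) = mset_set (UNIV :: 'n set)"
    using bij_betw_coord_index[where ?'n = 'n] by (simp add: image_mset_mset_set bij_betw_def)
  finally show ?thesis .
qed

lemma singular_values_symmetric:
  fixes W :: "real^'n::{finite,linorder}^'n::{finite,linorder}" and p :: "'n \<Rightarrow> real^'n::{finite,linorder}"
  assumes p: "\<And>i j. p i \<bullet> p j = (if i = j then 1 else 0)"
    and d: "\<And>i. (Finite_Cartesian_Product.transpose W ** W) *v p i = d i *\<^sub>R p i"
  shows "mset (singular_values (mat_of W)) = image_mset (\<lambda>i. sqrt (d i)) (mset_set UNIV)"
    "sorted (rev (singular_values (mat_of W)))"
proof -
  have "proots (char_poly (transpose_mat (mat_of W) * mat_of W)) = image_mset d (mset_set UNIV)"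
    using proots_char_poly_symmetric[OF p d] by (simp add: mat_of_mult mat_of_transpose)
  then have "singular_values (mat_of W) = rev (sorted_list_of_multiset (image_mset (\<lambda>i. sqrt (d i))
      (mset_set UNIV)))"
    by (simp add: singular_values_def multiset.map_comp o_def)
  then show "mset (singular_values (mat_of W)) = image_mset (\<lambda>i. sqrt (d i)) (mset_set UNIV)"
    "sorted (rev (singular_values (mat_of W)))" by simp_all
qed

text \<open>In an eigenbasis \<open>p\<close> of \<open>W\<^sup>T W\<close>, the square of
  \<open>norm (W *v y)\<close> is the sum of \<open>d i * (p i \<bullet> y)\<^sup>2\<close>. The
  vector \<open>w\<close> is a top right singular vector, and the last inequality is the bound by
  the second singular value corrected in that direction.\<close>

lemma singular_value_bounds:
  fixes W :: "real^'n::{finite,linorder}^'n::{finite,linorder}"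
  shows "\<exists>w. norm w = 1 \<and> 0 \<le> singular_value 1 W \<and>
    (\<forall>y. norm (W *v y) \<le> singular_value 1 W * norm y) \<and>
    (2 \<le> CARD('n) \<longrightarrow> 0 \<le> singular_value 2 W \<and> singular_value 2 W \<le> singular_value 1 W \<and>
      (\<forall>y. (norm (W *v y))\<^sup>2 \<le> (singular_value 2 W)\<^sup>2 * (norm y)\<^sup>2 +
        ((singular_value 1 W)\<^sup>2 - (singular_value 2 W)\<^sup>2) * (w \<bullet> y)\<^sup>2))"
proof -
  define f where "f = (\<lambda>x. (Finite_Cartesian_Product.transpose W ** W) *v x)"
  have fW: "f x \<bullet> y = (W *v x) \<bullet> (W *v y)" for x y
    by (simp add: f_def matrix_vector_mul_assoc[symmetric] dot_lmul_matrix[symmetric] inner_commute)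
  have "linear f" by (simp add: f_def)
  moreover have "f x \<bullet> y = x \<bullet> f y" for x y using fW[of x y] fW[of y x] by (simp add: inner_commute)
  ultimately obtain p :: "'n \<Rightarrow> real^'n::{finite,linorder}" and d
    where p: "\<And>i j. p i \<bullet> p j = (if i = j then 1 else 0)" and fd: "\<And>i. f (p i) = d i *\<^sub>R p i"
      and expand: "\<And>y. y = (\<Sum>i\<in>UNIV. (p i \<bullet> y) *\<^sub>R p i)"
    using symmetric_orthonormal_eigenbasis[of f] by blast
  have d0: "0 \<le> d i" for i
    using fW[of "p i" "p i"] p[of i i] by (simp add: fd)
  have ny: "(norm y)\<^sup>2 = (\<Sum>i\<in>UNIV. (p i \<bullet> y)\<^sup>2)" for y
  proof -
    have "(norm y)\<^sup>2 = y \<bullet> (\<Sum>i\<in>UNIV. (p i \<bullet> y) *\<^sub>R p i)"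
      by (subst expand[symmetric]) (rule power2_norm_eq_inner)
    then show ?thesis by (simp add: inner_sum_right inner_commute[of y] power2_eq_square)
  qed
  have nW: "(norm (W *v y))\<^sup>2 = (\<Sum>i\<in>UNIV. d i * (p i \<bullet> y)\<^sup>2)" for y
  proof -
    have "(norm (W *v y))\<^sup>2 = f y \<bullet> y" by (simp add: fW power2_norm_eq_inner)
    also have "\<dots> = f y \<bullet> (\<Sum>i\<in>UNIV. (p i \<bullet> y) *\<^sub>R p i)" by (subst expand[symmetric]) simp
    also have "\<dots> = (\<Sum>i\<in>UNIV. (p i \<bullet> y) * (f y \<bullet> p i))" by (simp add: inner_sum_right)
    also have "\<dots> = (\<Sum>i\<in>UNIV. d i * (p i \<bullet> y)\<^sup>2)"
    proof (rule sum.cong)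
      fix i
      have "f y \<bullet> p i = y \<bullet> f (p i)" using fW[of y "p i"] fW[of "p i" y] by (simp add: inner_commute)
      then show "(p i \<bullet> y) * (f y \<bullet> p i) = d i * (p i \<bullet> y)\<^sup>2"
        by (simp add: fd inner_commute[of y] power2_eq_square)
    qed simp
    finally show ?thesis .
  qed
  define xs where "xs = singular_values (mat_of W)"
  have xs: "mset xs = image_mset (\<lambda>i. sqrt (d i)) (mset_set UNIV)" "sorted (rev xs)"
    unfolding xs_def by (rule singular_values_symmetric[OF p fd[unfolded f_def]])+
  have len: "length xs = CARD('n)" using arg_cong[OF xs(1), of size] by simp
  then obtain \<sigma> ys where cons: "xs = \<sigma> # ys" by (cases xs) auto
  have s1: "singular_value 1 W = \<sigma>" using cons by (simp add: singular_value_def xs_def)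
  have dec: "\<forall>z\<in>set ys. z \<le> \<sigma>" "sorted (rev ys)" using xs(2) by (auto simp: cons sorted_append)
  have "\<sigma> \<in> set xs" by (simp add: cons)
  also have "set xs = range (\<lambda>i. sqrt (d i))" using arg_cong[OF xs(1), of set_mset] by simp
  finally obtain i where i: "\<sigma> = sqrt (d i)" by blast
  \<comment> \<open>Only one index is removed, not all with the value \<sigma>; a repeated largest
    singular value therefore also heads the remaining list.\<close>
  have ys: "mset ys = image_mset (\<lambda>i. sqrt (d i)) (mset_set (UNIV - {i}))"
  proof -
    have "mset_set (UNIV :: 'n set) = add_mset i (mset_set (UNIV - {i}))"
      by (metis UNIV_I finite mset_set.remove)
    then show ?thesis using xs(1) by (simp add: cons i)
  qed
  have setys: "set ys = (\<lambda>i. sqrt (d i)) ` (UNIV - {i})" using arg_cong[OF ys, of set_mset] by simp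
  have \<sigma>0: "0 \<le> \<sigma>" using d0 by (simp add: i)
  have dle: "d j \<le> \<sigma>\<^sup>2" for j
  proof (cases "j = i")
    case True then show ?thesis using d0 by (simp add: i)
  next
    case False
    then have "sqrt (d j) \<le> \<sigma>" using dec(1) setys by auto
    then show ?thesis using sqrt_le_D by blast
  qed
  have 1: "norm (W *v y) \<le> \<sigma> * norm y" for y
  proof (rule power2_le_imp_le)
    have "(\<Sum>j\<in>UNIV. d j * (p j \<bullet> y)\<^sup>2) \<le> (\<Sum>j\<in>UNIV. \<sigma>\<^sup>2 * (p j \<bullet> y)\<^sup>2)"
      using dle by (intro sum_mono mult_right_mono) auto
    then show "(norm (W *v y))\<^sup>2 \<le> (\<sigma> * norm y)\<^sup>2"
      unfolding nW power_mult_distrib ny[of y] sum_distrib_left .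
  qed (use \<sigma>0 in simp)
  have 2: "0 \<le> singular_value 2 W \<and> singular_value 2 W \<le> \<sigma> \<and>
      (\<forall>y. (norm (W *v y))\<^sup>2 \<le> (singular_value 2 W)\<^sup>2 * (norm y)\<^sup>2 + (\<sigma>\<^sup>2 - (singular_value 2 W)\<^sup>2) *
          (p i \<bullet> y)\<^sup>2)"
    if n2: "2 \<le> CARD('n)"
  proof -
    obtain \<tau> zs where c2: "ys = \<tau> # zs" using len n2 cons by (cases ys) auto
    have s2: "singular_value 2 W = \<tau>" using cons c2 by (simp add: singular_value_def xs_def)
    have "\<tau> \<in> set ys" by (simp add: c2)
    then have \<tau>0: "0 \<le> \<tau>" using setys d0 by auto
    have \<tau>\<sigma>: "\<tau> \<le> \<sigma>" using dec(1) by (simp add: c2)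
    have dle2: "d j \<le> \<tau>\<^sup>2" if "j \<noteq> i" for j
    proof -
      have "sqrt (d j) \<in> set ys" using that setys by auto
      then have "sqrt (d j) \<le> \<tau>" using dec(2) by (auto simp: c2 sorted_append)
      then show ?thesis using sqrt_le_D by blast
    qed
    have "(norm (W *v y))\<^sup>2 \<le> \<tau>\<^sup>2 * (norm y)\<^sup>2 + (\<sigma>\<^sup>2 - \<tau>\<^sup>2) * (p i \<bullet> y)\<^sup>2" for y
    proof -
      have "(norm (W *v y))\<^sup>2 = d i * (p i \<bullet> y)\<^sup>2 + (\<Sum>j\<in>UNIV - {i}. d j * (p j \<bullet> y)\<^sup>2)"
        unfolding nW by (subst sum.remove[of UNIV i]) auto
      also have "\<dots> \<le> \<sigma>\<^sup>2 * (p i \<bullet> y)\<^sup>2 + (\<Sum>j\<in>UNIV - {i}. \<tau>\<^sup>2 * (p j \<bullet> y)\<^sup>2)"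
        using dle dle2 by (intro add_mono sum_mono mult_right_mono) auto
      also have "(\<Sum>j\<in>UNIV - {i}. \<tau>\<^sup>2 * (p j \<bullet> y)\<^sup>2) = \<tau>\<^sup>2 * (norm y)\<^sup>2 - \<tau>\<^sup>2 * (p i \<bullet> y)\<^sup>2"
      proof -
        have "(norm y)\<^sup>2 = (p i \<bullet> y)\<^sup>2 + (\<Sum>j\<in>UNIV - {i}. (p j \<bullet> y)\<^sup>2)"
          unfolding ny by (rule sum.remove) auto
        then show ?thesis by (simp add: sum_distrib_left algebra_simps)
      qed
      finally show ?thesis by (simp add: algebra_simps)
    qed
    then show ?thesis using \<tau>0 \<tau>\<sigma> by (simp add: s2)
  qed
  have "norm (p i) = 1" using p[of i i] by (simp add: norm_eq_sqrt_inner)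
  then show ?thesis using \<sigma>0 1 2 unfolding s1 by blast
qed

section \<open>Compound columns\<close>

text \<open>Lagrange's identity. Summation over all ordered pairs counts each two-by-two minor
  twice.\<close>

lemma gram_coordinates:
  fixes u w :: "real^'n::finite"
  shows "2 * gram u w = (\<Sum>i\<in>UNIV. \<Sum>j\<in>UNIV. (vec_nth u i * vec_nth w j - vec_nth u j * vec_nth w i)\<^sup>2)"
proof -
  have "(\<Sum>i\<in>UNIV. \<Sum>j\<in>UNIV. (vec_nth u i * vec_nth w j - vec_nth u j * vec_nth w i)\<^sup>2) =
    (\<Sum>i\<in>UNIV. \<Sum>j\<in>UNIV. (vec_nth u i * vec_nth u i) * (vec_nth w j * vec_nth w j)) +
    (\<Sum>i\<in>UNIV. \<Sum>j\<in>UNIV. (vec_nth w i * vec_nth w i) * (vec_nth u j * vec_nth u j)) -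
    2 * (\<Sum>i\<in>UNIV. \<Sum>j\<in>UNIV. (vec_nth u i * vec_nth w i) * (vec_nth u j * vec_nth w j))"
    unfolding sum_distrib_left sum.distrib[symmetric] sum_subtractf[symmetric]
    by (intro sum.cong refl) (simp add: power2_eq_square algebra_simps)
  also have "\<dots> = 2 * gram u w"
    unfolding sum_product[symmetric] by (simp add: gram_def inner_vec_def power2_eq_square mult.commute)
  finally show ?thesis by simp
qed

definition euclid_norm :: "real Matrix.vec \<Rightarrow> real" where
  "euclid_norm v = sqrt (\<Sum>i<dim_vec v. (vec_index v i)\<^sup>2)"

lemma is_norm_on_euclid_norm: "is_norm_on N euclid_norm"
proof -
  have L2: "euclid_norm v = L2_set (vec_index v) {..<N}" if "v \<in> carrier_vec N" for v
    using that by (simp add: euclid_norm_def L2_set_def)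
  have tri: "euclid_norm (v + w) \<le> euclid_norm v + euclid_norm w"
    if "v \<in> carrier_vec N" "w \<in> carrier_vec N" for v w
  proof -
    have "L2_set (vec_index (v + w)) {..<N} = L2_set (\<lambda>i. vec_index v i + vec_index w i) {..<N}"
      using that by (intro L2_set_cong) auto
    then show ?thesis
      using that L2_set_triangle_ineq[of "vec_index v" "vec_index w" "{..<N}"] by (simp add: L2)
  qed
  have scale: "euclid_norm (c \<cdot>\<^sub>v v) = \<bar>c\<bar> * euclid_norm v" if "v \<in> carrier_vec N" for c v
  proof -
    have "(\<Sum>i<N. (vec_index (c \<cdot>\<^sub>v v) i)\<^sup>2) = c\<^sup>2 * (\<Sum>i<N. (vec_index v i)\<^sup>2)"
      using that by (auto simp: sum_distrib_left power_mult_distrib intro!: sum.cong)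
    then show ?thesis using that by (simp add: euclid_norm_def real_sqrt_mult)
  qed
  have zero: "euclid_norm v = 0 \<longleftrightarrow> v = 0\<^sub>v N" if "v \<in> carrier_vec N" for v
    using that by (auto simp: L2 L2_set_eq_0_iff intro!: eq_vecI)
  have "0 \<le> euclid_norm v" for v by (simp add: euclid_norm_def sum_nonneg)
  with tri scale zero show ?thesis by (simp add: is_norm_on_def)
qed

lemma set_lex_subsets_full: "set (lex_subsets k k ! 0) = {..<k}"
proof -
  have "lex_subsets k k ! 0 \<in> set (lex_subsets k k)" by (simp add: length_lex_subsets)
  then have "set (lex_subsets k k ! 0) \<in> set ` set (lex_subsets k k)" by (rule imageI)
  then have "set (lex_subsets k k ! 0) \<subseteq> {..<k}" "card (set (lex_subsets k k ! 0)) = k"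
    by (simp_all add: set_lex_subsets)
  then show ?thesis by (intro card_subset_eq) auto
qed

text \<open>The only column belongs to the full set of columns of \<open>M\<close>. The Euclidean
  norm does not depend on the order of the rows, so the lexicographic list is replaced by the family
  of \<open>k\<close>-subsets.\<close>

lemma euclid_norm_compound_col:
  assumes M: "M \<in> carrier_mat n k" and k: "k \<le> n"
  shows "(euclid_norm (col (compound k M) 0))\<^sup>2 =
    (\<Sum>I | I \<subseteq> {..<n} \<and> card I = k. (Determinant.det (submatrix M I {..<k}))\<^sup>2)"
proof -
  have dims: "dim_row (compound k M) = n choose k" "dim_col (compound k M) = 1"
    using M by (auto simp: compound_def)
  have k1: "set (lex_subsets k k ! 0) = {..<k}"
    by (rule set_lex_subsets_full)
  have "euclid_norm (col (compound k M) 0) ^ 2 = (\<Sum>i<n choose k. (compound k M $$ (i, 0))\<^sup>2)"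
    by (simp add: euclid_norm_def dims sum_nonneg)
  also have "\<dots> = (\<Sum>i<n choose k. (Determinant.det (submatrix M (set (lex_subsets n k ! i)) {..<k}))\<^sup>2)"
    using M k1 by (intro sum.cong) (auto simp: compound_def)
  also have "\<dots> = (\<Sum>I\<in>set ` set (lex_subsets n k). (Determinant.det (submatrix M I {..<k}))\<^sup>2)"
  proof (rule sum.reindex_bij_betw)
    have "distinct (map set (subseqs [0..<n]))" by (rule distinct_set_subseqs) simp
    then have "distinct (map set (lex_subsets n k))"
      unfolding lex_subsets_def by (rule distinct_map_filter)
    from bij_betw_nth[OF this refl refl]
    have "bij_betw ((!) (map set (lex_subsets n k))) {..<n choose k} (set ` set (lex_subsets n k))"
      by (simp add: length_lex_subsets)
    moreover have "map set (lex_subsets n k) ! i = set (lex_subsets n k ! i)" if "i \<in> {..<n choose k}" for i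
      using that by (simp add: length_lex_subsets)
    ultimately show "bij_betw (\<lambda>i. set (lex_subsets n k ! i)) {..<n choose k} (set ` set (lex_subsets n k))"
      by (subst bij_betw_cong[of _ "\<lambda>i. set (lex_subsets n k ! i)" "(!) (map set (lex_subsets n k))"]) auto
  qed
  finally show ?thesis by (simp add: set_lex_subsets)
qed


lemma det_2:
  assumes "A \<in> carrier_mat 2 2"
  shows "Determinant.det A = A $$ (0, 0) * A $$ (1, 1) - A $$ (1, 0) * (A $$ (0, 1) :: real)"
proof -
  have c: "mat_delete A i 0 \<in> carrier_mat 1 1" for i
    using mat_delete_carrier[of A 2 2 i 0] assms by simp
  have "Determinant.det A = (\<Sum>i<2. A $$ (i, 0) * cofactor A i 0)"
    by (rule laplace_expansion_column[OF assms]) simp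
  also have "\<dots> = A $$ (0, 0) * mat_delete A 0 0 $$ (0, 0) - A $$ (1, 0) * mat_delete A 1 0 $$ (0, 0)"
    by (simp add: numeral_2_eq_2 cofactor_def det_single[OF c, simplified])
  also have "\<dots> = A $$ (0, 0) * A $$ (1, 1) - A $$ (1, 0) * A $$ (0, 1)"
    using assms by (simp add: mat_delete_def)
  finally show ?thesis .
qed

lemma pick_pair:
  fixes i j :: nat
  assumes "i < j"
  shows "pick {i, j} 0 = i" "pick {i, j} 1 = j"
proof -
  show 0: "pick {i, j} 0 = i" using assms by (auto intro!: Least_equality)
  show "pick {i, j} 1 = j" unfolding One_nat_def pick.simps(2) 0
    using assms by (intro Least_equality) auto
qed

lemma euclid_norm_compound_1:
  assumes M: "M \<in> carrier_mat n 1" and n: "1 \<le> n"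
  shows "(euclid_norm (col (compound 1 M) 0))\<^sup>2 = (\<Sum>i<n. (M $$ (i, 0))\<^sup>2)"
proof -
  have "(\<Sum>I | I \<subseteq> {..<n} \<and> card I = 1. (Determinant.det (submatrix M I {..<1}))\<^sup>2) =
    (\<Sum>I \<in> (\<lambda>i. {i}) ` {..<n}. (Determinant.det (submatrix M I {..<1}))\<^sup>2)"
    by (rule sum.cong) (auto simp: card_1_singleton_iff)
  also have "\<dots> = (\<Sum>i<n. (Determinant.det (submatrix M {i} {..<1}))\<^sup>2)"
    by (subst sum.reindex) (auto simp: inj_on_def)
  also have "\<dots> = (\<Sum>i<n. (M $$ (i, 0))\<^sup>2)"
  proof (rule sum.cong)
    fix i assume "i \<in> {..<n}"
    then have i: "{a. a < n \<and> a = i} = {i}" by auto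
    have S: "submatrix M {i} {..<1} \<in> carrier_mat 1 1"
      using M by (intro carrier_matI) (simp_all add: dim_submatrix i)
    have "pick {i} 0 = i" "pick {..<1} 0 = 0" by (auto intro!: Least_equality)
    moreover have "submatrix M {i} {..<1} $$ (0, 0) = M $$ (pick {i} 0, pick {..<1} 0)"
      by (rule submatrix_index) (use M in \<open>simp_all add: i\<close>)
    ultimately show "(Determinant.det (submatrix M {i} {..<1}))\<^sup>2 = (M $$ (i, 0))\<^sup>2"
      by (simp only: det_single[OF S])
  qed simp
  finally show ?thesis using euclid_norm_compound_col[OF M n] by simp
qed

text \<open>Two-element sets correspond to the strict upper triangle \<open>U\<close>. The summand
  is symmetric and vanishes on the diagonal, so the full square gives twice the sum over
  \<open>U\<close>.\<close>

lemma euclid_norm_compound_2: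
  assumes M: "M \<in> carrier_mat n 2" and n: "2 \<le> n"
  shows "2 * (euclid_norm (col (compound 2 M) 0))\<^sup>2 =
    (\<Sum>i<n. \<Sum>j<n. (M $$ (i, 0) * M $$ (j, 1) - M $$ (j, 0) * M $$ (i, 1))\<^sup>2)"
proof -
  define h where "h = (\<lambda>i j. (M $$ (i, 0) * M $$ (j, 1) - M $$ (j, 0) * M $$ (i, 1))\<^sup>2)"
  have hs: "h i j = h j i" for i j by (simp add: h_def power2_commute mult.commute)
  define U where "U = {(i, j). i < j \<and> j < n}"
  have fU: "finite U" by (rule finite_subset[of _ "{..<n} \<times> {..<n}"]) (auto simp: U_def)
  have "(\<Sum>I | I \<subseteq> {..<n} \<and> card I = 2. (Determinant.det (submatrix M I {..<2}))\<^sup>2) =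
    (\<Sum>I \<in> (\<lambda>(i, j). {i, j}) ` U. (Determinant.det (submatrix M I {..<2}))\<^sup>2)"
  proof (rule sum.cong)
    show "{I. I \<subseteq> {..<n} \<and> card I = 2} = (\<lambda>(i, j). {i, j}) ` U"
    proof (intro equalityI subsetI)
      fix I assume "I \<in> {I. I \<subseteq> {..<n} \<and> card I = 2}"
      then obtain a b where I: "I = {a, b}" "a \<noteq> b" "a < n" "b < n" by (auto simp: card_2_iff)
      then show "I \<in> (\<lambda>(i, j). {i, j}) ` U"
        by (intro image_eqI[of _ _ "(min a b, max a b)"]) (auto simp: U_def min_def max_def)
    qed (auto simp: U_def)
  qed simp
  also have "\<dots> = (\<Sum>(i, j)\<in>U. (Determinant.det (submatrix M {i, j} {..<2}))\<^sup>2)"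
  proof (subst sum.reindex)
    show "inj_on (\<lambda>(i, j). {i, j}) U" by (auto simp: inj_on_def U_def doubleton_eq_iff)
  qed (simp add: case_prod_unfold o_def)
  also have "\<dots> = (\<Sum>(i, j)\<in>U. h i j)"
  proof (rule sum.cong)
    fix z assume "z \<in> U"
    then obtain i j where z: "z = (i, j)" "i < j" "j < n" by (auto simp: U_def)
    then have ij: "{a. a < n \<and> (a = i \<or> a = j)} = {i, j}" by auto
    have two: "{a. a < 2} = {..<2 :: nat}" by auto
    have S: "submatrix M {i, j} {..<2} \<in> carrier_mat 2 2"
      using M z by (intro carrier_matI) (simp_all add: dim_submatrix ij two)
    have p: "pick {..<2} 0 = 0" "pick {..<2} (Suc 0) = Suc 0" by (auto intro!: Least_equality)
    show "(case z of (i, j) \<Rightarrow> (Determinant.det (submatrix M {i, j} {..<2}))\<^sup>2) = (case z of (i, j) \<Rightarrow> h i j)"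
      using M z pick_pair[OF z(2)] p by (simp add: det_2[OF S] submatrix_index ij two h_def del: pick.simps)
  qed simp
  finally have 1: "(euclid_norm (col (compound 2 M) 0))\<^sup>2 = (\<Sum>(i, j)\<in>U. h i j)"
    using euclid_norm_compound_col[OF M n] by simp
  have sw: "(\<Sum>(i, j)\<in>U. h i j) = (\<Sum>(i, j)\<in>prod.swap ` U. h i j)"
    by (subst sum.reindex) (auto simp: case_prod_unfold hs)
  have "(\<Sum>i<n. \<Sum>j<n. h i j) = (\<Sum>(i, j)\<in>{..<n} \<times> {..<n}. h i j)" by (simp add: sum.cartesian_product)
  also have "\<dots> = (\<Sum>(i, j)\<in>U \<union> prod.swap ` U. h i j)"
  proof (rule sum.mono_neutral_right)
    show "\<forall>z\<in>{..<n} \<times> {..<n} - (U \<union> prod.swap ` U). (case z of (i, j) \<Rightarrow> h i j) = 0"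
    proof
      fix z assume z: "z \<in> {..<n} \<times> {..<n} - (U \<union> prod.swap ` U)"
      obtain i j where ij: "z = (i, j)" by (cases z)
      have "i = j" using z by (auto simp: ij U_def image_iff)
      then show "(case z of (i, j) \<Rightarrow> h i j) = 0" by (simp add: ij h_def)
    qed
  qed (auto simp: U_def)
  also have "\<dots> = (\<Sum>(i, j)\<in>U. h i j) + (\<Sum>(i, j)\<in>prod.swap ` U. h i j)"
    using fU by (intro sum.union_disjoint) (auto simp: U_def)
  finally show ?thesis using 1 sw by (simp add: h_def)
qed

section \<open>The Hopfield network\<close>

text \<open>The trace of \<open>B\<close> compressed to a plane does not depend on the orthonormal
  basis. The plane meets the kernel of \<open>l\<close> in a unit vector \<open>a\<close>; it
  contributes at most \<open>s2\<close>, and the vector \<open>d\<close> completing the basis at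
  most \<open>s1\<close>.\<close>

lemma ky_fan_two:
  fixes B :: "'a::real_inner \<Rightarrow> 'a" and l :: "'a \<Rightarrow> real"
  assumes B: "linear B" and l: "linear l"
    and s1: "\<And>z. norm (B z) \<le> s1 * norm z" and s2: "\<And>z. l z = 0 \<Longrightarrow> norm (B z) \<le> s2 * norm z"
    and uw: "u \<bullet> w = 0"
  shows "(u \<bullet> u) * (w \<bullet> B w) + (w \<bullet> w) * (u \<bullet> B u) \<le> (s1 + s2) * ((u \<bullet> u) * (w \<bullet> w))"
proof (cases "u = 0 \<or> w = 0")
  case True
  then show ?thesis by (auto simp: linear_0[OF B])
next
  case False
  note lin = linear_add[OF B] linear_cmul[OF B] linear_diff[OF B] linear_add[OF l] linear_cmul[OF l]
      linear_diff[OF l]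
  have b: "z \<bullet> B z \<le> s" if "norm z = 1" "norm (B z) \<le> s * norm z" for z s
    using norm_cauchy_schwarz[of z "B z"] that by simp
  define e f where "e = (1 / norm u) *\<^sub>R u" and "f = (1 / norm w) *\<^sub>R w"
  have ef: "norm e = 1" "norm f = 1" "e \<bullet> f = 0" using False uw by (simp_all add: e_def f_def)
  then have ee: "e \<bullet> e = 1" "f \<bullet> f = 1" "f \<bullet> e = 0" by (simp_all add: dot_square_norm inner_commute)
  have key: "e \<bullet> B e + f \<bullet> B f \<le> s1 + s2"
  proof (cases "l e = 0 \<and> l f = 0")
    case True
    then show ?thesis using b[OF ef(1) s2] b[OF ef(2) s1] by auto
  next
    case nz: False
    define r where "r = (l e)\<^sup>2 + (l f)\<^sup>2"
    have r: "0 < r" using nz by (auto simp: r_def sum_power2_gt_zero_iff)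
    define a where "a = (1 / sqrt r) *\<^sub>R (l f *\<^sub>R e - l e *\<^sub>R f)"
    define d where "d = (1 / sqrt r) *\<^sub>R (l e *\<^sub>R e + l f *\<^sub>R f)"
    have sq: "(1 / sqrt r) * ((1 / sqrt r) * x) = x / r" for x using r by (simp add: field_simps)
    have sc: "((1 / sqrt r) *\<^sub>R z) \<bullet> B ((1 / sqrt r) *\<^sub>R z) = (z \<bullet> B z) / r" for z
      by (simp only: lin(2) inner_scaleR_left inner_scaleR_right sq)
    have "a \<bullet> a = r / r" unfolding a_def
      by (simp add: sq[simplified] inner_diff ee ef(3) r_def power2_eq_square add.commute)
         (use r in \<open>simp add: r_def field_simps power2_eq_square\<close>)
    then have a1: "norm a = 1" using r by (simp add: norm_eq_sqrt_inner)
    have "d \<bullet> d = r / r" unfolding d_def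
      by (simp add: sq[simplified] inner_add ee ef(3) r_def power2_eq_square)
         (use r in \<open>simp add: r_def field_simps power2_eq_square\<close>)
    then have d1: "norm d = 1" using r by (simp add: norm_eq_sqrt_inner)
    have "l a = 0" by (simp add: a_def lin)
    have "a \<bullet> B a + d \<bullet> B d = (r * (e \<bullet> B e + f \<bullet> B f)) / r"
    proof -
      have "a \<bullet> B a = ((l f *\<^sub>R e - l e *\<^sub>R f) \<bullet> B (l f *\<^sub>R e - l e *\<^sub>R f)) / r"
        unfolding a_def by (rule sc)
      moreover have "d \<bullet> B d = ((l e *\<^sub>R e + l f *\<^sub>R f) \<bullet> B (l e *\<^sub>R e + l f *\<^sub>R f)) / r"
        unfolding d_def by (rule sc)
      moreover have "(l f *\<^sub>R e - l e *\<^sub>R f) \<bullet> B (l f *\<^sub>R e - l e *\<^sub>R f) +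
          (l e *\<^sub>R e + l f *\<^sub>R f) \<bullet> B (l e *\<^sub>R e + l f *\<^sub>R f) = r * (e \<bullet> B e + f \<bullet> B f)"
        by (simp add: lin inner_diff inner_add r_def power2_eq_square algebra_simps)
      ultimately show ?thesis by (simp only: add_divide_distrib[symmetric])
    qed
    then have "e \<bullet> B e + f \<bullet> B f = a \<bullet> B a + d \<bullet> B d" using r by simp
    also have "\<dots> \<le> s2 + s1"
      using b[OF a1 s2[OF \<open>l a = 0\<close>]] b[OF d1 s1] by (rule add_mono)
    finally show ?thesis by simp
  qed
  have "u = norm u *\<^sub>R e" "w = norm w *\<^sub>R f" using False by (simp_all add: e_def f_def)
  then have "u \<bullet> B u = (norm u)\<^sup>2 * (e \<bullet> B e)" "w \<bullet> B w = (norm w)\<^sup>2 * (f \<bullet> B f)"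
    by (metis (no_types, lifting) inner_scaleR_left inner_scaleR_right lin(2) mult.assoc power2_eq_square)+
  then have "(u \<bullet> u) * (w \<bullet> B w) + (w \<bullet> w) * (u \<bullet> B u) = ((u \<bullet> u) * (w \<bullet> w)) * (e \<bullet> B e + f \<bullet> B f)"
    by (simp add: dot_square_norm algebra_simps)
  also have "\<dots> \<le> ((u \<bullet> u) * (w \<bullet> w)) * (s1 + s2)" using key by (intro mult_left_mono) auto
  finally show ?thesis by (simp add: mult.commute)
qed

section \<open>The Hopfield field with its first and second derivatives\<close>

lemma tanh_real_abs_le_1: "\<bar>tanh x\<bar> \<le> (1 :: real)"
  using tanh_real_bounds[of x] by auto

definition dtanh :: "real^'n \<Rightarrow> real^'n \<Rightarrow> real^'n" where
  "dtanh x u = (\<chi> i. (1 - (tanh (x $ i))\<^sup>2) * u $ i)"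

definition d2tanh :: "real^'n \<Rightarrow> real^'n \<Rightarrow> real^'n \<Rightarrow> real^'n" where
  "d2tanh x u w = (\<chi> i. - 2 * tanh (x $ i) * (1 - (tanh (x $ i))\<^sup>2) * u $ i * w $ i)"

definition dhopfield :: "real \<Rightarrow> real^'n^'n \<Rightarrow> real^'n \<Rightarrow> real^'n \<Rightarrow> real^'n" where
  "dhopfield \<alpha> W x u = - \<alpha> *\<^sub>R u + W *v dtanh x u"

lemma has_derivative_vec_nth:
  fixes f :: "'a::euclidean_space \<Rightarrow> real^'n"
  assumes "\<And>i. ((\<lambda>x. f x $ i) has_derivative (\<lambda>h. f' h $ i)) (at x)"
  shows "(f has_derivative f') (at x)"
  by (subst has_derivative_componentwise_within) (use assms in \<open>auto simp: Basis_vec_def inner_axis\<close>)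

lemma tanh_nth_has_derivative:
  "((\<lambda>x :: real^'n. tanh (x $ i)) has_derivative (\<lambda>h. (1 - (tanh (x $ i))\<^sup>2) * h $ i)) (at x)"
proof -
  have "(tanh has_real_derivative 1 - (tanh (x $ i))\<^sup>2) (at (x $ i))"
    by (auto intro!: derivative_eq_intros)
  then have "(tanh has_derivative (*) (1 - (tanh (x $ i))\<^sup>2)) (at (x $ i))"
    by (simp add: has_field_derivative_def)
  from diff_chain_at[OF bounded_linear_imp_has_derivative[OF bounded_linear_vec_nth] this]
  show ?thesis by (simp add: o_def)
qed

lemma tanh_vec_has_derivative: "((\<lambda>x. \<chi> i. tanh (x $ i)) has_derivative dtanh x) (at (x :: real^'n))"
  by (rule has_derivative_vec_nth) (simp add: dtanh_def tanh_nth_has_derivative)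

lemma dtanh_has_derivative: "((\<lambda>x. dtanh x w) has_derivative (\<lambda>u. d2tanh x u w)) (at (x :: real^'n))"
proof (rule has_derivative_vec_nth)
  fix i
  have "((\<lambda>x. (1 - (tanh (x $ i))\<^sup>2) * w $ i) has_derivative
      (\<lambda>u. - (2 * tanh (x $ i) * ((1 - (tanh (x $ i))\<^sup>2) * u $ i)) * w $ i)) (at x)"
    by (rule derivative_eq_intros tanh_nth_has_derivative refl)+ (simp add: fun_eq_iff algebra_simps)
  then show "((\<lambda>x. dtanh x w $ i) has_derivative (\<lambda>u. d2tanh x u w $ i)) (at x)"
    by (simp add: dtanh_def d2tanh_def mult_ac)
qed

lemma linear_dtanh: "linear (dtanh x)"
  by (rule linearI) (simp_all add: dtanh_def Finite_Cartesian_Product.vec_eq_iff algebra_simps)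

lemma norm_dtanh_le: "norm (dtanh x u) \<le> norm u"
proof (rule norm_le_componentwise_cart)
  fix i
  have "(tanh (x $ i))\<^sup>2 \<le> 1" using tanh_real_abs_le_1[of "x $ i"] by (simp add: abs_square_le_1)
  then have "\<bar>1 - (tanh (x $ i))\<^sup>2\<bar> \<le> 1" by (simp add: abs_le_iff)
  then show "norm (dtanh x u $ i) \<le> norm (u $ i)"
    by (simp add: dtanh_def abs_mult mult_left_le_one_le)
qed

lemma norm_d2tanh_le: "norm (d2tanh x u w) \<le> 2 * norm u * norm w"
proof -
  have "norm (d2tanh x u w) \<le> norm ((2 * norm w) *\<^sub>R u)"
  proof (rule norm_le_componentwise_cart)
    fix i
    have t: "\<bar>tanh (x $ i)\<bar> \<le> 1" by (rule tanh_real_abs_le_1)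
    then have "(tanh (x $ i))\<^sup>2 \<le> 1" by (simp add: abs_square_le_1)
    then have "\<bar>1 - (tanh (x $ i))\<^sup>2\<bar> \<le> 1" by (simp add: abs_le_iff)
    with t have "\<bar>tanh (x $ i)\<bar> * \<bar>1 - (tanh (x $ i))\<^sup>2\<bar> \<le> 1 * 1" by (intro mult_mono) auto
    then have "(\<bar>tanh (x $ i)\<bar> * \<bar>1 - (tanh (x $ i))\<^sup>2\<bar>) * (\<bar>w $ i\<bar> * \<bar>u $ i\<bar>) \<le> 1 * (norm w * \<bar>u $ i\<bar>)"
      using component_le_norm_cart[of w i] by (intro mult_mono mult_right_mono) auto
    then show "norm (d2tanh x u w $ i) \<le> norm (((2 * norm w) *\<^sub>R u) $ i)"
      by (simp add: d2tanh_def abs_mult mult_ac)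
  qed
  then show ?thesis by (simp add: mult_ac)
qed

lemma norm_tanh_vec_le: "norm (\<chi> i. tanh (x $ i) :: real^'n) \<le> CARD('n)"
proof -
  have "norm (\<chi> i. tanh (x $ i) :: real^'n) \<le> (\<Sum>i\<in>UNIV. \<bar>(\<chi> i. tanh (x $ i) :: real^'n) $ i\<bar>)"
    by (rule norm_le_l1_cart)
  also have "\<dots> \<le> (\<Sum>i\<in>(UNIV :: 'n set). 1)" by (intro sum_mono) (simp add: tanh_real_abs_le_1)
  finally show ?thesis by simp
qed

lemma hopfield_has_derivative: "(hopfield \<alpha> W has_derivative dhopfield \<alpha> W x) (at x)"
proof -
  have "((\<lambda>x. W *v (\<chi> i. tanh (x $ i))) has_derivative (\<lambda>u. W *v dtanh x u)) (at x)"
    by (rule bounded_linear.has_derivative[OF matrix_vector_mul_bounded_linear tanh_vec_has_derivative])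
  then show ?thesis
    unfolding hopfield_def[abs_def] dhopfield_def[abs_def] by (auto intro!: derivative_eq_intros)
qed

lemma dhopfield_has_derivative:
  "((\<lambda>x. dhopfield \<alpha> W x w) has_derivative (\<lambda>u. W *v d2tanh x u w)) (at x)"
proof -
  have "((\<lambda>x. W *v dtanh x w) has_derivative (\<lambda>u. W *v d2tanh x u w)) (at x)"
    by (rule bounded_linear.has_derivative[OF matrix_vector_mul_bounded_linear dtanh_has_derivative])
  then show ?thesis
    unfolding dhopfield_def by (auto intro!: derivative_eq_intros)
qed

lemma continuous_on_d2tanh: "continuous_on UNIV (\<lambda>(x, u, w). W *v d2tanh x u w)"
  unfolding d2tanh_def case_prod_unfold
  by (intro matrix_vector_mul_bounded_linear[THEN bounded_linear.continuous_on] continuous_intros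
      continuous_on_tanh) auto

lemma continuous_on_dtanh: "continuous_on UNIV (\<lambda>(x, u). dtanh x u)"
  unfolding dtanh_def case_prod_unfold
  by (intro continuous_intros continuous_on_tanh) auto

lemma jacobian_hopfield: "jacobian (hopfield \<alpha> W) (at x) *v u = dhopfield \<alpha> W x u"
  using frechet_derivative_at[OF hopfield_has_derivative[of \<alpha> W x]]
    has_derivative_linear[OF hopfield_has_derivative[of \<alpha> W x]]
  by (simp add: jacobian_def matrix_works)

text \<open>Singular values enter only as numbers with the two operator bounds, so no order on the
  index type is involved. \<open>W_bound2\<close> says in particular that \<open>W\<close> has norm
  at most \<open>s2\<close> on the orthogonal complement of \<open>w1\<close>.\<close>

locale two_contracting_hopfield =
  fixes \<alpha> :: real and W :: "real^'n^'n" and s1 s2 :: real and w1 :: "real^'n"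
  assumes s2_nonneg: "0 \<le> s2" and s2_le: "s2 \<le> s1" and sum_less: "s1 + s2 < 2 * \<alpha>"
    and W_bound: "norm (W *v z) \<le> s1 * norm z"
    and W_bound2: "(norm (W *v z))\<^sup>2 \<le> s2\<^sup>2 * (norm z)\<^sup>2 + (s1\<^sup>2 - s2\<^sup>2) * (w1 \<bullet> z)\<^sup>2"
    and w1: "norm w1 = 1"
begin

lemma s1_nonneg: "0 \<le> s1" using s2_nonneg s2_le by simp

lemma W_dtanh_bound: "norm (W *v dtanh x u) \<le> s1 * norm u"
  using W_bound[of "dtanh x u"] mult_left_mono[OF norm_dtanh_le[of x u] s1_nonneg] by linarith

text \<open>The diagonal matrix of the derivatives of tanh has norm at most 1. Hence its product
  with \<open>W\<close> is bounded by \<open>s1\<close>, and by \<open>s2\<close> on the kernel of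
  \<open>w1 \<bullet> dtanh x z\<close>, as \<open>ky_fan_two\<close> requires. The summands 1 keep
  the constants positive for \<open>W = 0\<close>.\<close>

sublocale contracting_field "hopfield \<alpha> W" "dhopfield \<alpha> W" "\<lambda>x u w. W *v d2tanh x u w"
  "\<bar>\<alpha>\<bar> + s1 + 1" "2 * s1 + 1" "2 * \<alpha> - s1 - s2"
proof
  fix x u w :: "real^'n"
  show "(hopfield \<alpha> W has_derivative dhopfield \<alpha> W x) (at x)" by (rule hopfield_has_derivative)
  show "((\<lambda>x. dhopfield \<alpha> W x w) has_derivative (\<lambda>u. W *v d2tanh x u w)) (at x)"
    by (rule dhopfield_has_derivative)
  show "W *v d2tanh x u w = W *v d2tanh x w u"
    by (rule arg_cong[of _ _ "(*v) W"]) (simp add: d2tanh_def Finite_Cartesian_Product.vec_eq_iff mult_ac)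
  show "continuous_on UNIV (\<lambda>(x, u, w). W *v d2tanh x u w)" by (rule continuous_on_d2tanh)
  have "norm (dhopfield \<alpha> W x w) \<le> norm (- \<alpha> *\<^sub>R w) + norm (W *v dtanh x w)"
    unfolding dhopfield_def by (rule norm_triangle_ineq)
  also have "\<dots> \<le> \<bar>\<alpha>\<bar> * norm w + s1 * norm w" using W_dtanh_bound[of x w] by simp
  also have "\<dots> \<le> (\<bar>\<alpha>\<bar> + s1 + 1) * norm w" by (simp add: algebra_simps)
  finally show "norm (dhopfield \<alpha> W x w) \<le> (\<bar>\<alpha>\<bar> + s1 + 1) * norm w" .
  have "norm (W *v d2tanh x u w) \<le> s1 * (2 * norm u * norm w)"
    using W_bound[of "d2tanh x u w"] mult_left_mono[OF norm_d2tanh_le[of x u w] s1_nonneg] by linarith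
  also have "\<dots> \<le> (2 * s1 + 1) * norm u * norm w" by (simp add: algebra_simps)
  finally show "norm (W *v d2tanh x u w) \<le> (2 * s1 + 1) * norm u * norm w" .
  show "0 < \<bar>\<alpha>\<bar> + s1 + 1" "0 < 2 * s1 + 1" "0 < 2 * \<alpha> - s1 - s2"
    using s1_nonneg sum_less by auto
  assume uw: "u \<bullet> w = 0"
  have "(u \<bullet> u) * (w \<bullet> (W *v dtanh x w)) + (w \<bullet> w) * (u \<bullet> (W *v dtanh x u)) \<le> (s1 + s2) * ((u \<bullet> u) *
      (w \<bullet> w))"
  proof (rule ky_fan_two[where l = "\<lambda>z. w1 \<bullet> dtanh x z", OF _ _ W_dtanh_bound _ uw])
    show "linear (\<lambda>z. W *v dtanh x z)"
      using linear_compose[OF linear_dtanh matrix_vector_mul_linear] by (simp add: o_def)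
    show "linear (\<lambda>z. w1 \<bullet> dtanh x z)"
      by (rule linearI) (simp_all add: linear_add[OF linear_dtanh] linear_cmul[OF linear_dtanh]
          inner_add_right)
    fix z assume "w1 \<bullet> dtanh x z = 0"
    then have "(norm (W *v dtanh x z))\<^sup>2 \<le> (s2 * norm (dtanh x z))\<^sup>2"
      using W_bound2[of "dtanh x z"] by (simp add: power_mult_distrib)
    then have "norm (W *v dtanh x z) \<le> s2 * norm (dtanh x z)"
      by (rule power2_le_imp_le) (use s2_nonneg in simp)
    also have "\<dots> \<le> s2 * norm z" by (intro mult_left_mono norm_dtanh_le s2_nonneg)
    finally show "norm (W *v dtanh x z) \<le> s2 * norm z" .
  qed
  then show "(u \<bullet> u) * (w \<bullet> dhopfield \<alpha> W x w) + (w \<bullet> w) * (u \<bullet> dhopfield \<alpha> W x u)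
      \<le> - (2 * \<alpha> - s1 - s2) * ((u \<bullet> u) * (w \<bullet> w))"
    by (simp add: dhopfield_def inner_diff_right inner_add_right algebra_simps)
qed

text \<open>The midpoint of \<open>s2\<close> and \<alpha>: an expansion rate of \<open>W\<close>
  times the diagonal that slow directions still attain and that exceeds \<open>s2\<close>. Solving
  \<open>W_bound2\<close> for the component along \<open>w1\<close> gives \<open>c1\<close>; the
  summand 1 in its denominator covers \<open>s1 = s2\<close>.\<close>

definition \<gamma> :: real where "\<gamma> = (\<alpha> + s2) / 2"
definition c1 :: real where "c1 = sqrt ((\<gamma>\<^sup>2 - s2\<^sup>2) / (s1\<^sup>2 - s2\<^sup>2 + 1))"

lemma s2_less_gamma: "s2 < \<gamma>"
  using s2_le sum_less by (simp add: \<gamma>_def)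

lemma c1_pos: "0 < c1"
proof -
  have "s2\<^sup>2 < \<gamma>\<^sup>2" using s2_less_gamma s2_nonneg by (intro power_strict_mono) auto
  moreover have "s2\<^sup>2 \<le> s1\<^sup>2" using s2_le s2_nonneg by (intro power_mono) auto
  ultimately show ?thesis by (simp add: c1_def)
qed

text \<open>A vector that decays slowly under the linearization is almost an eigenvector on which \<open>W D\<close> expands
  by more than \<open>s2\<close>, so it has a component along the top singular direction \<open>w1\<close>.\<close>

lemma slow_direction:
  assumes e: "norm (dhopfield \<alpha> W x u - \<rho> *\<^sub>R u) \<le> (\<alpha> - s2) / 3 * norm u"
    and rho: "- (2 * \<alpha> - s1 - s2) / 12 \<le> \<rho>"
  shows "c1 * norm u \<le> \<bar>w1 \<bullet> dtanh x u\<bar>"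
proof -
  define z where "z = dhopfield \<alpha> W x u - \<rho> *\<^sub>R u"
  have "W *v dtanh x u = (\<alpha> + \<rho>) *\<^sub>R u + z" by (simp add: z_def dhopfield_def algebra_simps)
  then have "norm ((\<alpha> + \<rho>) *\<^sub>R u) \<le> norm (W *v dtanh x u) + norm z"
    by (metis add_diff_cancel_right' norm_triangle_ineq4)
  then have 1: "\<bar>\<alpha> + \<rho>\<bar> * norm u \<le> norm (W *v dtanh x u) + norm z" by (simp only: norm_scaleR)
  \<comment> \<open>With the lower bound for \<rho> inserted, clearing denominators leaves exactly
    \<open>s2 \<le> s1\<close>. This fixes the thresholds \<eta>/12 and
    \<open>(\<alpha> - s2) / 3\<close>.\<close>
  have "\<gamma> + (\<alpha> - s2) / 3 \<le> \<alpha> + \<rho>"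
    using rho s2_le by (simp add: \<gamma>_def field_simps)
  then have "(\<gamma> + (\<alpha> - s2) / 3) * norm u \<le> \<bar>\<alpha> + \<rho>\<bar> * norm u" by (intro mult_right_mono) auto
  then have "\<gamma> * norm u \<le> norm (W *v dtanh x u)"
    using 1 e[folded z_def] unfolding distrib_right by linarith
  then have "(\<gamma> * norm u)\<^sup>2 \<le> (norm (W *v dtanh x u))\<^sup>2"
    using s2_less_gamma s2_nonneg by (intro power_mono) auto
  also have "\<dots> \<le> s2\<^sup>2 * (norm (dtanh x u))\<^sup>2 + (s1\<^sup>2 - s2\<^sup>2) * (w1 \<bullet> dtanh x u)\<^sup>2" by (rule W_bound2)
  also have "\<dots> \<le> s2\<^sup>2 * (norm u)\<^sup>2 + (s1\<^sup>2 - s2\<^sup>2 + 1) * (w1 \<bullet> dtanh x u)\<^sup>2"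
    by (intro add_mono mult_left_mono power_mono norm_dtanh_le mult_right_mono) auto
  finally have "(\<gamma>\<^sup>2 - s2\<^sup>2) * (norm u)\<^sup>2 \<le> (s1\<^sup>2 - s2\<^sup>2 + 1) * (w1 \<bullet> dtanh x u)\<^sup>2"
    by (simp add: power_mult_distrib algebra_simps)
  moreover have "0 < s1\<^sup>2 - s2\<^sup>2 + 1"
    using power_mono[OF s2_le s2_nonneg, of 2] by simp
  ultimately have "(\<gamma>\<^sup>2 - s2\<^sup>2) / (s1\<^sup>2 - s2\<^sup>2 + 1) * (norm u)\<^sup>2 \<le> (w1 \<bullet> dtanh x u)\<^sup>2"
    by (simp add: divide_le_eq mult.commute)
  then have "sqrt ((\<gamma>\<^sup>2 - s2\<^sup>2) / (s1\<^sup>2 - s2\<^sup>2 + 1) * (norm u)\<^sup>2) \<le> sqrt ((w1 \<bullet> dtanh x u)\<^sup>2)"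
    by (rule real_sqrt_le_mono)
  then show ?thesis by (simp only: c1_def real_sqrt_mult real_sqrt_abs abs_norm_cancel)
qed

text \<open>The coupling term is bounded by \<open>m\<close> since tanh is, so linear damping makes
  the excess of the squared norm over the square of \<open>m / \<alpha>\<close> decay at the rate
  \<alpha>.\<close>

lemma orbit_bounded:
  assumes y: "\<And>t. 0 \<le> t \<Longrightarrow> (y has_vector_derivative hopfield \<alpha> W (y t)) (at t within {0..})" and t: "0 \<le> t"
  shows "norm (y t) \<le> sqrt ((norm (y 0))\<^sup>2 + (s1 * CARD('n) / \<alpha>)\<^sup>2)"
proof -
  define m where "m = s1 * CARD('n)"
  have a: "0 < \<alpha>" using s2_nonneg s2_le sum_less by simp
  have m: "norm (W *v (\<chi> i. tanh (z $ i))) \<le> m" for z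
    unfolding m_def by (rule order_trans[OF W_bound mult_left_mono[OF norm_tanh_vec_le s1_nonneg]])
  have "y t \<bullet> y t - (m / \<alpha>)\<^sup>2 \<le> exp (- \<alpha> * (t - 0)) * (y 0 \<bullet> y 0 - (m / \<alpha>)\<^sup>2)"
  proof (rule gronwall_le[of 0 t "{0..}" "\<lambda>t. y t \<bullet> y t - (m / \<alpha>)\<^sup>2" "\<lambda>t. 2 * (y t \<bullet> hopfield \<alpha> W (y t))"])
    show "((\<lambda>t. y t \<bullet> y t - (m / \<alpha>)\<^sup>2) has_real_derivative 2 * (y s \<bullet> hopfield \<alpha> W (y s))) (at s
        within {0..})"
      if "s \<in> {0..t}" for s
    proof -
      have "((\<lambda>t. y t \<bullet> y t) has_real_derivative y s \<bullet> hopfield \<alpha> W (y s) + hopfield \<alpha> W (y s) \<bullet> y s)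
          (at s within {0..})"
        using that by (intro has_real_derivative_inner y) auto
      from DERIV_diff[OF this DERIV_const[of "(m / \<alpha>)\<^sup>2"]] show ?thesis
        by (simp add: inner_commute[of "hopfield \<alpha> W (y s)"])
    qed
    show "2 * (y s \<bullet> hopfield \<alpha> W (y s)) \<le> - \<alpha> * (y s \<bullet> y s - (m / \<alpha>)\<^sup>2)" for s
    proof -
      have "y s \<bullet> (W *v (\<chi> i. tanh (y s $ i))) \<le> norm (y s) * m"
        by (intro order_trans[OF norm_cauchy_schwarz] mult_left_mono m) auto
      moreover have "2 * (norm (y s) * m) \<le> \<alpha> * (norm (y s))\<^sup>2 + \<alpha> * (m / \<alpha>)\<^sup>2"
      proof -
        have "0 \<le> \<alpha> * (norm (y s) - m / \<alpha>)\<^sup>2" using a by simp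
        then show ?thesis using a by (simp add: power2_diff algebra_simps)
      qed
      ultimately show ?thesis
        by (simp add: hopfield_def inner_add_right inner_diff_right dot_square_norm algebra_simps)
    qed
  qed (use t in auto)
  also have "\<dots> \<le> y 0 \<bullet> y 0"
  proof -
    have "exp (- \<alpha> * (t - 0)) * (y 0 \<bullet> y 0) \<le> 1 * (y 0 \<bullet> y 0)" using a t by (intro mult_right_mono) auto
    moreover have "0 \<le> exp (- \<alpha> * (t - 0)) * (m / \<alpha>)\<^sup>2" by simp
    ultimately show ?thesis unfolding right_diff_distrib by linarith
  qed
  finally show ?thesis by (intro real_le_rsqrt) (simp add: m_def dot_square_norm)
qed

lemma orbit_converges:
  assumes y: "\<And>t. 0 \<le> t \<Longrightarrow> (y has_vector_derivative hopfield \<alpha> W (y t)) (at t within {0..})"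
  shows "\<exists>e. hopfield \<alpha> W e = 0 \<and> (y \<longlongrightarrow> e) at_top"
proof -
  interpret separating_functional "hopfield \<alpha> W" "dhopfield \<alpha> W" "\<lambda>x u w. W *v d2tanh x u w"
    "\<bar>\<alpha>\<bar> + s1 + 1" "2 * s1 + 1" "2 * \<alpha> - s1 - s2" y "sqrt ((norm (y 0))\<^sup>2 + (s1 * CARD('n) / \<alpha>)\<^sup>2)"
    "\<lambda>x. w1 \<bullet> (\<chi> i. tanh (x $ i))" "\<lambda>x u. w1 \<bullet> dtanh x u" "CARD('n)" c1 "(\<alpha> - s2) / 3"
  proof
    show "0 \<le> t \<Longrightarrow> norm (y t) \<le> sqrt ((norm (y 0))\<^sup>2 + (s1 * CARD('n) / \<alpha>)\<^sup>2)" for t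
      using orbit_bounded[OF y] .
    show "((\<lambda>x. w1 \<bullet> (\<chi> i. tanh (x $ i))) has_derivative (\<lambda>u. w1 \<bullet> dtanh x u)) (at x)" for x
      by (rule has_derivative_inner_right[OF tanh_vec_has_derivative])
    show "continuous_on UNIV (\<lambda>(x, u). w1 \<bullet> dtanh x u)"
      using continuous_on_dtanh by (auto simp: case_prod_unfold intro!: continuous_intros)
    show "\<bar>w1 \<bullet> (\<chi> i. tanh (x $ i))\<bar> \<le> CARD('n)" for x
      using Cauchy_Schwarz_ineq2[of w1 "\<chi> i. tanh (x $ i)"] norm_tanh_vec_le[of x] w1 by simp
    show "0 < (\<alpha> - s2) / 3" using s2_le sum_less by simp
  qed (auto intro: y c1_pos slow_direction)
  from converges_to_equilibrium show ?thesis .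
qed

lemma gram_contracts:
  assumes "a \<le> b" "\<And>t. t \<in> {a..b} \<Longrightarrow> (p has_vector_derivative dhopfield \<alpha> W (x t) (p t)) (at t within
      {a..b})"
    "\<And>t. t \<in> {a..b} \<Longrightarrow> (q has_vector_derivative dhopfield \<alpha> W (x t) (q t)) (at t within {a..b})"
  shows "gram (p b) (q b) \<le> exp (- 2 * (2 * \<alpha> - s1 - s2) * (b - a)) * gram (p a) (q a)"
proof (rule gronwall_le[OF assms(1) order_refl])
  fix t
  define X Y where "X = dhopfield \<alpha> W (x t) (p t)" and "Y = dhopfield \<alpha> W (x t) (q t)"
  define D where "D = 2 * ((p t \<bullet> p t) * (q t \<bullet> Y) + (q t \<bullet> q t) * (p t \<bullet> X) - (p t \<bullet> q t) * (p t \<bullet> Y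
      + q t \<bullet> X))"
  {
    assume t: "t \<in> {a..b}"
    note pq = assms(2,3)[OF t, folded X_def Y_def]
    show "((\<lambda>t. gram (p t) (q t)) has_real_derivative D) (at t within {a..b})"
      unfolding gram_def D_def
      by (rule derivative_eq_intros has_real_derivative_inner pq refl)+
         (simp add: inner_commute power2_eq_square algebra_simps)
  next
    show "D \<le> - 2 * (2 * \<alpha> - s1 - s2) * gram (p t) (q t)"
    proof -
      have "- 2 * (2 * \<alpha> - s1 - s2) * gram (p t) (q t) = 2 * (- (2 * \<alpha> - s1 - s2) * gram (p t) (q t))"
          by simp
      then show ?thesis
        unfolding D_def X_def Y_def by (simp only:) (rule mult_left_mono[OF trace_gram], simp)
    qed
  }
qed

end

section \<open>Compound norms as lengths and areas, and the statements on the network\<close>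

lemma sum_lessThan_coord_index:
  "(\<Sum>i<CARD('n). h (coord_index i)) = (\<Sum>i\<in>(UNIV :: 'n::{finite,linorder} set). h i)"
  using sum_coord_index[where ?'n = 'n, of h] by (simp add: atLeast0LessThan)

lemma mat_of_cols_vec_of:
  fixes \<delta> :: "nat \<Rightarrow> real^'n::{finite,linorder}"
  shows "mat_of_cols CARD('n) (map (\<lambda>j. vec_of (\<delta> j)) [0..<k]) \<in> carrier_mat CARD('n) k"
    and "i < CARD('n) \<Longrightarrow> j < k \<Longrightarrow>
      mat_of_cols CARD('n) (map (\<lambda>j. vec_of (\<delta> j)) [0..<k]) $$ (i, j) = vec_nth (\<delta> j) (coord_index i)"
  by (auto simp: mat_of_cols_index vec_of_def intro: carrier_matI)

lemma euclid_norm_compound_vec_1: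
  fixes \<delta> :: "nat \<Rightarrow> real^'n::{finite,linorder}"
  shows "euclid_norm (col (compound 1 (mat_of_cols CARD('n) (map (\<lambda>j. vec_of (\<delta> j)) [0..<1]))) 0) =
      norm (\<delta> 0)"
proof -
  define M where "M = mat_of_cols CARD('n) (map (\<lambda>j. vec_of (\<delta> j)) [0..<1])"
  have n1: "1 \<le> CARD('n)" by (simp add: Suc_leI)
  have M: "M \<in> carrier_mat CARD('n) 1" unfolding M_def by (rule mat_of_cols_vec_of)
  have "(euclid_norm (col (compound 1 M) 0))\<^sup>2 = (\<Sum>i<CARD('n). (vec_nth (\<delta> 0) (coord_index i))\<^sup>2)"
    unfolding euclid_norm_compound_1[OF M n1]
    by (rule sum.cong) (simp_all add: M_def mat_of_cols_vec_of del: upt_Suc One_nat_def)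
  also have "\<dots> = (norm (\<delta> 0))\<^sup>2"
    unfolding sum_lessThan_coord_index[where h = "\<lambda>i. (vec_nth (\<delta> 0) i)\<^sup>2"]
    unfolding power2_norm_eq_inner inner_vec_def by (simp add: power2_eq_square)
  finally show ?thesis
    unfolding M_def[symmetric] by (rule power2_eq_imp_eq) (simp_all add: euclid_norm_def sum_nonneg)
qed

lemma euclid_norm_compound_vec_2:
  fixes \<delta> :: "nat \<Rightarrow> real^'n::{finite,linorder}"
  assumes "2 \<le> CARD('n)"
  shows "euclid_norm (col (compound 2 (mat_of_cols CARD('n) (map (\<lambda>j. vec_of (\<delta> j)) [0..<2]))) 0)
    = sqrt (gram (\<delta> 0) (\<delta> 1))"
proof -
  define M where "M = mat_of_cols CARD('n) (map (\<lambda>j. vec_of (\<delta> j)) [0..<2])"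
  have M: "M \<in> carrier_mat CARD('n) 2" unfolding M_def by (rule mat_of_cols_vec_of)
  have Mi: "M $$ (i, 0) = vec_nth (\<delta> 0) (coord_index i)" "M $$ (i, 1) = vec_nth (\<delta> 1) (coord_index i)"
    if "i < CARD('n)" for i
    unfolding M_def using that by (auto simp del: upt_Suc One_nat_def intro!: mat_of_cols_vec_of)
  define h where "h = (\<lambda>a b. (vec_nth (\<delta> 0) a * vec_nth (\<delta> 1) b - vec_nth (\<delta> 0) b * vec_nth (\<delta> 1) a)\<^sup>2)"
  have "2 * (euclid_norm (col (compound 2 M) 0))\<^sup>2
      = (\<Sum>i<CARD('n). \<Sum>j<CARD('n). h (coord_index i) (coord_index j))"
    unfolding euclid_norm_compound_2[OF M assms] h_def
    by (intro sum.cong refl) (simp add: Mi del: One_nat_def)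
  also have "\<dots> = 2 * gram (\<delta> 0) (\<delta> 1)"
    unfolding gram_coordinates
    unfolding sum_lessThan_coord_index[where h = "h _"]
      sum_lessThan_coord_index[where h = "\<lambda>a. \<Sum>b\<in>UNIV. h a b"] by (simp add: h_def)
  finally have "(euclid_norm (col (compound 2 M) 0))\<^sup>2 = gram (\<delta> 0) (\<delta> 1)" by simp
  then show ?thesis
    unfolding M_def[symmetric]
    by (intro real_sqrt_unique[symmetric]) (simp_all add: euclid_norm_def sum_nonneg gram_nonneg)
qed

lemma variational_solution_hopfield:
  "variational_solution_on (\<lambda>t. hopfield \<alpha> W) UNIV I x \<delta> \<longleftrightarrow>
    (\<forall>t\<in>I. (\<delta> has_vector_derivative dhopfield \<alpha> W (x t) (\<delta> t)) (at t within I))"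
  by (simp add: variational_solution_on_def solution_on_def jacobian_hopfield)

lemma exp_minus_double: "exp (- 2 * a * x) = (exp (- a * x :: real))\<^sup>2"
  using exp_double[of "- a * x"] by (simp only: mult.assoc mult_minus_left mult_minus_right)

text \<open>In the Euclidean norm the rate is \<open>\<alpha> - s1\<close>: damping contributes
  \<alpha>, and the coupling has norm at most \<open>s1\<close> because the slopes of tanh are at
  most 1.\<close>

lemma hopfield_contractive:
  fixes W :: "real^'n::{finite,linorder}^'n::{finite,linorder}"
  assumes W: "\<And>z. norm (W *v z) \<le> s1 * norm z" and s1: "0 \<le> s1" "s1 < \<alpha>"
  shows "contractive (\<lambda>t. hopfield \<alpha> W) UNIV"
  unfolding k_contractive_def
proof (intro exI conjI)
  show "0 < \<alpha> - s1" using s1 by simp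
  show "is_norm_on (CARD('n) choose 1) euclid_norm" by (rule is_norm_on_euclid_norm)
  show "k_contractive_with 1 (\<lambda>t. hopfield \<alpha> W) UNIV (\<alpha> - s1) euclid_norm"
    unfolding k_contractive_with_def Let_def euclid_norm_compound_vec_1
  proof (intro allI impI ballI)
    fix s T x t and \<delta> :: "nat \<Rightarrow> real \<Rightarrow> real^'n::{finite,linorder}"
    assume *: "0 \<le> s \<and> s < T \<and> solution_on (\<lambda>t. hopfield \<alpha> W) UNIV {s..T} x \<and>
      (\<forall>j<1. variational_solution_on (\<lambda>t. hopfield \<alpha> W) UNIV {s..T} x (\<delta> j))" and t: "t \<in> {s..T}"
    then have d: "(\<delta> 0 has_vector_derivative dhopfield \<alpha> W (x r) (\<delta> 0 r)) (at r within {s..T})" if "r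
        \<in> {s..T}" for r
      using that by (simp add: variational_solution_hopfield)
    have "\<delta> 0 t \<bullet> \<delta> 0 t \<le> exp (- 2 * (\<alpha> - s1) * (t - s)) * (\<delta> 0 s \<bullet> \<delta> 0 s)"
    proof (rule gronwall_le[of s t "{s..T}" _ "\<lambda>r. 2 * (\<delta> 0 r \<bullet> dhopfield \<alpha> W (x r) (\<delta> 0 r))"])
      show "((\<lambda>r. \<delta> 0 r \<bullet> \<delta> 0 r) has_real_derivative 2 * (\<delta> 0 r \<bullet> dhopfield \<alpha> W (x r) (\<delta> 0 r))) (at r
          within {s..T})"
        if "r \<in> {s..t}" for r
      proof -
        have "r \<in> {s..T}" using that t by simp
        from has_real_derivative_inner[OF d[OF this] d[OF this]] show ?thesis
          by (simp add: inner_commute[of "dhopfield \<alpha> W (x r) (\<delta> 0 r)"])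
      qed
      show "2 * (\<delta> 0 r \<bullet> dhopfield \<alpha> W (x r) (\<delta> 0 r)) \<le> - 2 * (\<alpha> - s1) * (\<delta> 0 r \<bullet> \<delta> 0 r)" for r
      proof -
        have "\<delta> 0 r \<bullet> (W *v dtanh (x r) (\<delta> 0 r)) \<le> norm (\<delta> 0 r) * (s1 * norm (\<delta> 0 r))"
          by (intro order_trans[OF norm_cauchy_schwarz] mult_left_mono order_trans[OF W] norm_dtanh_le
              s1) auto
        then show ?thesis
          by (simp add: dhopfield_def inner_diff_right inner_add_right dot_square_norm
              power2_eq_square algebra_simps)
      qed
    qed (use t in auto)
    then have "(norm (\<delta> 0 t))\<^sup>2 \<le> (exp (- (\<alpha> - s1) * (t - s)) * norm (\<delta> 0 s))\<^sup>2"
      by (simp only: power_mult_distrib power2_norm_eq_inner exp_minus_double)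
    then show "norm (\<delta> 0 t) \<le> exp (- (\<alpha> - s1) * (t - s)) * norm (\<delta> 0 s)"
      by (rule power2_le_imp_le) simp
  qed
qed

lemma two_contracting_hopfield_2_contractive:
  fixes W :: "real^'n::{finite,linorder}^'n::{finite,linorder}"
  assumes "two_contracting_hopfield \<alpha> W s1 s2 w1" and n: "2 \<le> CARD('n)"
  shows "k_contractive 2 (\<lambda>t. hopfield \<alpha> W) UNIV"
  unfolding k_contractive_def
proof (intro exI conjI)
  interpret two_contracting_hopfield \<alpha> W s1 s2 w1 by (rule assms(1))
  show "0 < 2 * \<alpha> - s1 - s2" using sum_less by simp
  show "is_norm_on (CARD('n) choose 2) euclid_norm" by (rule is_norm_on_euclid_norm)
  show "k_contractive_with 2 (\<lambda>t. hopfield \<alpha> W) UNIV (2 * \<alpha> - s1 - s2) euclid_norm"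
    unfolding k_contractive_with_def Let_def euclid_norm_compound_vec_2[OF n]
  proof (intro allI impI ballI)
    fix s T x t and \<delta> :: "nat \<Rightarrow> real \<Rightarrow> real^'n::{finite,linorder}"
    assume *: "0 \<le> s \<and> s < T \<and> solution_on (\<lambda>t. hopfield \<alpha> W) UNIV {s..T} x \<and>
      (\<forall>j<2. variational_solution_on (\<lambda>t. hopfield \<alpha> W) UNIV {s..T} x (\<delta> j))" and t: "t \<in> {s..T}"
    have d: "(\<delta> j has_vector_derivative dhopfield \<alpha> W (x r) (\<delta> j r)) (at r within {s..t})"
      if "r \<in> {s..t}" "j < 2" for r j
    proof (rule has_vector_derivative_within_subset)
      show "(\<delta> j has_vector_derivative dhopfield \<alpha> W (x r) (\<delta> j r)) (at r within {s..T})"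
        using * t that by (simp add: variational_solution_hopfield)
    qed (use t in auto)
    have "gram (\<delta> 0 t) (\<delta> 1 t) \<le> exp (- 2 * (2 * \<alpha> - s1 - s2) * (t - s)) * gram (\<delta> 0 s) (\<delta> 1 s)"
      by (rule gram_contracts[where x = x]) (use t d in auto)
    also have "\<dots> = (exp (- (2 * \<alpha> - s1 - s2) * (t - s)))\<^sup>2 * gram (\<delta> 0 s) (\<delta> 1 s)"
      by (simp only: exp_minus_double)
    finally have "sqrt (gram (\<delta> 0 t) (\<delta> 1 t)) \<le> sqrt ((exp (- (2 * \<alpha> - s1 - s2) * (t - s)))\<^sup>2 * gram
        (\<delta> 0 s) (\<delta> 1 s))"
      by (rule real_sqrt_le_mono)
    then show "sqrt (gram (\<delta> 0 t) (\<delta> 1 t)) \<le> exp (- (2 * \<alpha> - s1 - s2) * (t - s)) * sqrt (gram (\<delta> 0 s)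
        (\<delta> 1 s))"
      by (simp only: real_sqrt_mult real_sqrt_abs abs_exp_cancel)
  qed
qed

lemma two_contracting_hopfield_converges:
  fixes W :: "real^'n::{finite,linorder}^'n::{finite,linorder}"
  assumes "two_contracting_hopfield \<alpha> W s1 s2 w1"
    and x: "solution_on (\<lambda>t. hopfield \<alpha> W) UNIV {s..} x"
  shows "\<exists>e. equilibrium (hopfield \<alpha> W) e \<and> (x \<longlongrightarrow> e) at_top"
proof -
  interpret two_contracting_hopfield \<alpha> W s1 s2 w1 by (rule assms(1))
  \<comment> \<open>The field is autonomous, so the initial time may be moved to 0.\<close>
  define y where "y = (\<lambda>t. x (s + t))"
  have "(y has_vector_derivative hopfield \<alpha> W (y t)) (at t within {0..})" if "0 \<le> t" for t
  proof -
    have im: "(\<lambda>t. s + t) ` {0..} = {s..}" by (auto simp: image_iff intro: bexI[of _ "_ - s"])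
    have 1: "((\<lambda>t. s + t) has_vector_derivative 1) (at t within {0..})"
      by (auto intro!: derivative_eq_intros)
    have 2: "(x has_vector_derivative hopfield \<alpha> W (x (s + t))) (at (s + t) within (\<lambda>t. s + t) ` {0..})"
      unfolding im using x that by (simp add: solution_on_def)
    from vector_diff_chain_within[OF 1 2] show ?thesis by (simp add: o_def y_def)
  qed
  from orbit_converges[OF this] obtain e where e: "hopfield \<alpha> W e = 0" "(y \<longlongrightarrow> e) at_top" by blast
  have "filterlim (\<lambda>t. - s + t) at_top at_top"
    by (rule filterlim_tendsto_add_at_top[OF tendsto_const filterlim_ident])
  from filterlim_compose[OF e(2) this] have "(x \<longlongrightarrow> e) at_top" by (simp add: y_def)
  with e(1) show ?thesis by (auto simp: equilibrium_def)
qed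

theorem corollary2:
  fixes \<alpha> :: real and W :: "real^'n::{finite,linorder}^'n::{finite,linorder}"
  shows "(singular_value 1 W < \<alpha> \<longrightarrow> contractive (\<lambda>t. hopfield \<alpha> W) UNIV) \<and>
    (2 \<le> CARD('n) \<and>
       sqrt ((singular_value 1 W)\<^sup>2 + (singular_value 2 W)\<^sup>2) < sqrt 2 * \<alpha> \<longrightarrow>
       k_contractive 2 (\<lambda>t. hopfield \<alpha> W) UNIV \<and>
       (\<forall>s x. 0 \<le> s \<and> solution_on (\<lambda>t. hopfield \<alpha> W) UNIV {s..} x \<longrightarrow>
          (\<exists>e. equilibrium (hopfield \<alpha> W) e \<and> (x \<longlongrightarrow> e) at_top)))"
proof -
  obtain w where w: "norm w = 1" and s1: "0 \<le> singular_value 1 W"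
    and W1: "\<And>y. norm (W *v y) \<le> singular_value 1 W * norm y"
    and W2: "2 \<le> CARD('n) \<Longrightarrow> 0 \<le> singular_value 2 W \<and> singular_value 2 W \<le> singular_value 1 W \<and>
      (\<forall>y. (norm (W *v y))\<^sup>2 \<le> (singular_value 2 W)\<^sup>2 * (norm y)\<^sup>2 +
        ((singular_value 1 W)\<^sup>2 - (singular_value 2 W)\<^sup>2) * (w \<bullet> y)\<^sup>2)"
    using singular_value_bounds[of W] by blast
  have "two_contracting_hopfield \<alpha> W (singular_value 1 W) (singular_value 2 W) w"
    if n: "2 \<le> CARD('n)" and less: "sqrt ((singular_value 1 W)\<^sup>2 + (singular_value 2 W)\<^sup>2) < sqrt 2 * \<alpha>"
  proof
    define a b where "a = singular_value 1 W" and "b = singular_value 2 W"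
    \<comment> \<open>The arithmetic mean of the two singular values is at most their quadratic
      mean, which turns the hypothesis into \<open>s1 + s2 < 2 * \<alpha>\<close>.\<close>
    have "a + b = sqrt ((a + b)\<^sup>2)" using W2[OF n] s1 by (simp add: a_def b_def)
    also have "\<dots> \<le> sqrt (2 * (a\<^sup>2 + b\<^sup>2))"
      using zero_le_power2[of "a - b"] by (intro real_sqrt_le_mono) (simp add: power2_eq_square
          algebra_simps)
    also have "\<dots> = sqrt 2 * sqrt (a\<^sup>2 + b\<^sup>2)" by (rule real_sqrt_mult)
    also have "\<dots> < sqrt 2 * (sqrt 2 * \<alpha>)" using less by (intro mult_strict_left_mono) (auto simp:
        a_def b_def)
    also have "\<dots> = 2 * \<alpha>" by simp
    finally show "singular_value 1 W + singular_value 2 W < 2 * \<alpha>" by (simp add: a_def b_def)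
  qed (use W2[OF n] W1 w in auto)
  then show ?thesis
    using hopfield_contractive[OF W1 s1] two_contracting_hopfield_2_contractive
      two_contracting_hopfield_converges by blast
qed

end
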